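(* Let $k$ be an algebraically closed field of characteristic $p>2$, $r\ge 1$, $\mathcal{G}:=SL(2)_1T_r$ and $\mathcal{N}:=SL(2)_1$. Let $C\subseteq SL(2,k)$ be a set of representatives for $SL(2,k)/B$ with $\{1,w_0\}\subseteq C$, let $g\in C\setminus\{1,w_0\}$ and $0\le a\le p-2$. Let $$Z(a)^g\cong N_0\subseteq N_1\subseteq\dots\subseteq N_{p^{r-1}-1}=k\mathcal{G}\otimes_{k\mathcal{N}}Z(a)^g$$ be the filtration by $\mathcal{N}$-modules of the induced module. Then for all $l\in\{0,\dots,p^{r-1}-1\}$ the $\mathcal{N}$-module $N_l$ is isomorphic to $g.W((l+1)p+a)$.
   Context: $B\subseteq SL(2)$ is the Borel subgroup of upper triangular matrices, $T$ the torus of diagonal matrices, $w_0=\begin{pmatrix}0&1\\-1&0\end{pmatrix}$. $SL(2)_1$ is the first Frobenius kernel of $SL(2)$ and $T_r$ the $r$-th Frobenius kernel of $T$. $k\mathcal{G}:=k[\mathcal{G}]^*$ is the group algebra of a finite group scheme; $kSL(2)_1\cong U_0(\mathfrak{sl}(2))$, the restricted enveloping algebra. Let $\{e,f,h\}$ be the standard basis of $\mathfrak{sl}(2)$. Baby Verma module: $Z(a):=U_0(\mathfrak{sl}(2))\otimes_{U_0(\mathfrak{b})}k_a$, where $\mathfrak{b}=kh\oplus ke$ and $k_a$ is one-dimensional with $h.1=a$, $e.1=0$. For $g\in SL(2,k)$, $Z(a)^g$ is the space $Z(a)$ with action twisted by $g^{-1}$ (that is, $x\in\mathfrak{sl}(2)$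 acts as $g^{-1}xg$). $V(d)$ is the $(d+1)$-dimensional Weyl module of $SL(2)$ of highest weight $d$, with basis $v_0,\dots,v_d$, $v_0$ of weight $d$, $v_i=f^{(i)}v_0$, so that $e.v_i=(d-i+1)v_{i-1}$, $f.v_i=(i+1)v_{i+1}$, $h.v_i=(d-2i)v_i$. For $d=sp+a$ with $s\ge1$, $0\le a\le p-2$, $W(d)\subseteq V(d)$ is the $B$-stable $U_0(\mathfrak{sl}(2))$-submodule of dimension $sp$, spanned by $v_0,\dots,v_{sp-1}$; and $g.W(d)\subseteq V(d)$ is its translate, a $U_0(\mathfrak{sl}(2))$-submodule. Filtration of an induced module: for a normal subgroup scheme $\mathcal{N}\subseteq\mathcal{G}$ with $\mathcal{G}/\mathcal{N}$ infinitesimal and an $\mathcal{N}$-module $Z$, let $J=\ker(k[\mathcal{G}]\to k[\mathcal{N}])$, $H_l:=\{v\in k\mathcal{G}\mid v(J^{l+1})=0\}$ (a $(k\mathcal{N},k\mathcal{N})$-bimodule), and let $N_l$ be the image of the injective map $H_l\otimes_{k\mathcal{N}}Z\to k\mathcal{G}\otimes_{k\mathcal{N}}Z$. *)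

theory Defs
  imports
    "HOL-Analysis.Determinants"
    "HOL-Computational_Algebra.Polynomial"
    "HOL-Algebra.Free_Abelian_Groups"
    "HOL-Algebra.Ideal_Product"
    "HOL-Algebra.Generated_Rings"
    "HOL-Algebra.Module"
begin

section \<open>The group $SL(2,k)$\<close>

typedef (overloaded) ('k::field) SL2 = "{A :: 'k^2^2. det A = 1}"
  by (rule exI[of _ "mat 1"]) simp

setup_lifting type_definition_SL2

instantiation SL2 :: (field) monoid_mult
begin

lift_definition one_SL2 :: "'a SL2" is "mat 1" by simp

lift_definition times_SL2 :: "'a SL2 \<Rightarrow> 'a SL2 \<Rightarrow> 'a SL2" is "(**)"
  by (simp add: det_mul)

instance
  by standard (transfer; simp add: matrix_mul_assoc)+

end

lemma matrix_inv_det_1: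
  fixes A :: "'k::field^2^2"
  assumes "det A = 1"
  shows "A ** matrix_inv A = mat 1 \<and> matrix_inv A ** A = mat 1"
proof -
  have "\<exists>A'. A ** A' = mat 1 \<and> A' ** A = mat 1"
    using assms invertible_det_nz[of A] by (auto simp: invertible_def)
  then show ?thesis unfolding matrix_inv_def by (rule someI_ex)
qed

instantiation SL2 :: (field) inverse
begin

lift_definition inverse_SL2 :: "'a SL2 \<Rightarrow> 'a SL2" is matrix_inv
proof -
  fix A :: "'a^2^2" assume A: "det A = 1"
  then have "A ** matrix_inv A = mat 1" by (simp add: matrix_inv_det_1)
  then have "det A * det (matrix_inv A) = 1"
    by (metis det_I det_mul)
  with A show "det (matrix_inv A) = 1" by simp
qed

definition divide_SL2 :: "'a SL2 \<Rightarrow> 'a SL2 \<Rightarrow> 'a SL2" where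
  "divide_SL2 x y = x * inverse y"

instance ..

end

lemma SL2_inverse [simp]:
  fixes x :: "'k::field SL2"
  shows "x * inverse x = 1" "inverse x * x = 1"
  by (transfer, simp add: matrix_inv_det_1)+

lift_definition entry :: "2 \<Rightarrow> 2 \<Rightarrow> 'k::field SL2 \<Rightarrow> 'k" is "\<lambda>i j A. vec_nth (vec_nth A i) j" .

lift_definition w0 :: "'k::field SL2" is "vector [vector [0, 1], vector [-1, 0]]"
  by (simp add: det_2)

definition borel :: "'k::field SL2 set" where
  "borel = {x. entry 2 1 x = 0}"

definition torus :: "'k::field SL2 set" where
  "torus = {x. entry 1 2 x = 0 \<and> entry 2 1 x = 0}"

definition coset_reps :: "'k::field SL2 set \<Rightarrow> bool" where
  "coset_reps C \<longleftrightarrow> (\<forall>x. \<exists>!c. c \<in> C \<and> inverse c * x \<in> borel)"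


section \<open>Closed subgroup schemes of $SL(2)$\<close>

text \<open>
  All of this is used over an algebraically closed field. There the reduced scheme $SL(2)$ is
  determined by its rational points, and \<open>k[SL(2)]\<close> is the algebra of polynomial functions on
  \<open>SL(2,k)\<close>. A closed subscheme is represented by its ideal in \<open>k[SL(2)]\<close>.
\<close>

inductive_set regular :: "('k::field SL2 \<Rightarrow> 'k) set" where
  const: "(\<lambda>_. c) \<in> regular"
| entry: "entry i j \<in> regular"
| add: "f \<in> regular \<Longrightarrow> g \<in> regular \<Longrightarrow> (\<lambda>x. f x + g x) \<in> regular"
| mult: "f \<in> regular \<Longrightarrow> g \<in> regular \<Longrightarrow> (\<lambda>x. f x * g x) \<in> regular"

definition coord_ring :: "('k::field SL2 \<Rightarrow> 'k) ring" where
  "coord_ring = \<lparr>carrier = regular, mult = (\<lambda>f g x. f x * g x), one = (\<lambda>_. 1),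
     zero = (\<lambda>_. 0), add = (\<lambda>f g x. f x + g x)\<rparr>"

definition vanishing :: "'k::field SL2 set \<Rightarrow> ('k SL2 \<Rightarrow> 'k) set" where
  "vanishing S = {f \<in> regular. \<forall>x\<in>S. f x = 0}"

text \<open>
  If \<open>I\<close> is the ideal of \<open>\<H>\<close>, then \<open>\<H>\<^sub>r\<close> is cut out in \<open>\<H>\<close> by the
  \<open>p\<^sup>r\<close>-th powers of the elements of the augmentation ideal.
\<close>

definition frobenius_kernel ::
    "nat \<Rightarrow> ('k::field SL2 \<Rightarrow> 'k) set \<Rightarrow> ('k SL2 \<Rightarrow> 'k) set" where
  "frobenius_kernel r I =
     Idl\<^bsub>coord_ring\<^esub> (I \<union> {\<lambda>x. f x ^ (CHAR('k) ^ r) |f. f \<in> regular \<and> f 1 = 0})"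

text \<open>
  The product of two closed subgroup schemes (one normalizing the other) is the scheme-theoretic
  image of the multiplication. Its ideal is the preimage of
  \<open>I\<^sub>1 \<otimes> k[SL(2)] + k[SL(2)] \<otimes> I\<^sub>2\<close> under the comultiplication \<open>f \<mapsto> ((x, y) \<mapsto> f (x y))\<close>.
\<close>

definition product_scheme ::
    "('k::field SL2 \<Rightarrow> 'k) set \<Rightarrow> ('k SL2 \<Rightarrow> 'k) set \<Rightarrow> ('k SL2 \<Rightarrow> 'k) set" where
  "product_scheme I\<^sub>1 I\<^sub>2 = {f \<in> regular. \<exists>n \<phi> \<psi>.
     (\<forall>i<n. \<phi> i \<in> regular \<and> \<psi> i \<in> regular \<and> (\<phi> i \<in> I\<^sub>1 \<or> \<psi> i \<in> I\<^sub>2)) \<and>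
     (\<forall>x y. f (x * y) = (\<Sum>i<(n::nat). \<phi> i x * \<psi> i y))}"

definition SL2_1 :: "('k::field SL2 \<Rightarrow> 'k) set" where
  "SL2_1 = frobenius_kernel 1 (vanishing UNIV)"

definition T_frob :: "nat \<Rightarrow> ('k::field SL2 \<Rightarrow> 'k) set" where
  "T_frob r = frobenius_kernel r (vanishing torus)"

definition SL2_1_T :: "nat \<Rightarrow> ('k::field SL2 \<Rightarrow> 'k) set" where
  "SL2_1_T r = product_scheme SL2_1 (T_frob r)"


section \<open>Group algebras\<close>

type_synonym 'k functional = "('k SL2 \<Rightarrow> 'k) \<Rightarrow> 'k"

text \<open>
  The linear dual of \<open>k[SL(2)]\<close>; functionals take the value \<open>0\<close> outside \<open>k[SL(2)]\<close>.
\<close>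

definition dual :: "'k::field functional set" where
  "dual = {u. (\<forall>f\<in>regular. \<forall>g\<in>regular. u (\<lambda>x. f x + g x) = u f + u g) \<and>
              (\<forall>c. \<forall>f\<in>regular. u (\<lambda>x. c * f x) = c * u f) \<and>
              (\<forall>f. f \<notin> regular \<longrightarrow> u f = 0)}"

definition convolution :: "'k::field functional \<Rightarrow> 'k functional \<Rightarrow> 'k functional" where
  "convolution u v = (\<lambda>f. if f \<in> regular then u (\<lambda>x. v (\<lambda>y. f (x * y))) else 0)"

definition scalar :: "'k::field \<Rightarrow> 'k functional" where
  "scalar c = (\<lambda>f. if f \<in> regular then c * f 1 else 0)"

text \<open>
  For a subgroup scheme with ideal \<open>I\<close>, the dual \<open>k\<G>\<close> of \<open>k[\<G>] = k[SL(2)] / I\<close> is identified with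
  the functionals on \<open>k[SL(2)]\<close> that vanish on \<open>I\<close>. For subgroup schemes \<open>\<N> \<subseteq> \<G>\<close> this makes
  \<open>k\<N>\<close> a subring of \<open>k\<G>\<close>.
\<close>

definition group_algebra :: "('k::field SL2 \<Rightarrow> 'k) set \<Rightarrow> 'k functional ring" where
  "group_algebra I = \<lparr>carrier = {u \<in> dual. \<forall>f\<in>I. u f = 0}, mult = convolution, one = scalar 1,
     zero = (\<lambda>_. 0), add = (\<lambda>u v f. u f + v f)\<rparr>"

text \<open>
  \<open>sl(2)\<close> is the space of point derivations at the identity. Such a \<open>D\<close> corresponds to the matrix
  \<open>(D x\<^sub>i\<^sub>j)\<close>, where \<open>x\<^sub>i\<^sub>j\<close> are the coordinate functions; for \<open>e, f, h\<close> the entries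
  \<open>(x\<^sub>1\<^sub>1, x\<^sub>1\<^sub>2, x\<^sub>2\<^sub>1)\<close> are sent to \<open>(0,1,0)\<close>, \<open>(0,0,1)\<close>, \<open>(1,0,0)\<close>. The
  inclusion of \<open>sl(2)\<close> into \<open>kSL(2)\<^sub>1\<close> induces the isomorphism
  \<open>U\<^sub>0(sl(2)) \<cong> kSL(2)\<^sub>1\<close>, through which the two algebras are identified below.
\<close>

definition sl2 :: "'k::field functional set" where
  "sl2 = {D \<in> dual. \<forall>f\<in>regular. \<forall>g\<in>regular. D (\<lambda>x. f x * g x) = f 1 * D g + D f * g 1}"

definition borel_algebra :: "'k::field functional set" where
  "borel_algebra = {D \<in> sl2. D (entry 2 1) = 0}"

definition U0_sl2 :: "'k::field functional ring" where
  "U0_sl2 = group_algebra SL2_1"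

definition U0_b :: "'k::field functional set" where
  "U0_b = generate_ring U0_sl2 (range scalar \<union> borel_algebra)"


section \<open>Modules\<close>

text \<open>
  The record type \<open>module\<close> is used for left modules over a ring that need not be commutative. Its
  fields \<open>mult\<close> and \<open>one\<close> play no role. As \<open>kSL(2)\<^sub>1\<close> contains the scalars, its module
  homomorphisms are automatically \<open>k\<close>-linear.
\<close>

definition module_iso ::
    "('u, 'c) ring_scheme \<Rightarrow> ('u, 'm) module \<Rightarrow> ('u, 'n) module \<Rightarrow> bool" where
  "module_iso R M N \<longleftrightarrow> (\<exists>\<phi>. bij_betw \<phi> (carrier M) (carrier N) \<and>
     (\<forall>x\<in>carrier M. \<forall>y\<in>carrier M. \<phi> (x \<oplus>\<^bsub>M\<^esub> y) = \<phi> x \<oplus>\<^bsub>N\<^esub> \<phi> y) \<and>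
     (\<forall>u\<in>carrier R. \<forall>x\<in>carrier M. \<phi> (u \<odot>\<^bsub>M\<^esub> x) = u \<odot>\<^bsub>N\<^esub> \<phi> x))"

text \<open>
  Let \<open>R\<close> be a subring of the ring \<open>A\<close>, \<open>H \<subseteq> A\<close> an additive subgroup with \<open>H R \<subseteq> H\<close> and \<open>Z\<close> a left
  \<open>R\<close>-module. Then \<open>H \<otimes>\<^sub>R Z\<close> is the quotient of the free abelian group on \<open>H \<times> Z\<close> by the subgroup
  generated by the usual relations, and \<open>s \<in> A\<close> with \<open>s H \<subseteq> H\<close> acts by
  \<open>s (h \<otimes> z) = (s h) \<otimes> z\<close>.
\<close>

definition tensor_relations ::
    "('u, 'c) ring_scheme \<Rightarrow> 'u set \<Rightarrow> 'u set \<Rightarrow> ('u, 'z) module \<Rightarrow> ('u \<times> 'z \<Rightarrow>\<^sub>0 int) set" where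
  "tensor_relations A R H Z =
     {frag_of (h \<oplus>\<^bsub>A\<^esub> h', z) - frag_of (h, z) - frag_of (h', z) |h h' z.
        h \<in> H \<and> h' \<in> H \<and> z \<in> carrier Z} \<union>
     {frag_of (h, z \<oplus>\<^bsub>Z\<^esub> z') - frag_of (h, z) - frag_of (h, z') |h z z'.
        h \<in> H \<and> z \<in> carrier Z \<and> z' \<in> carrier Z} \<union>
     {frag_of (h \<otimes>\<^bsub>A\<^esub> r, z) - frag_of (h, r \<odot>\<^bsub>Z\<^esub> z) |h r z.
        h \<in> H \<and> r \<in> R \<and> z \<in> carrier Z}"

definition tensor_kernel ::
    "('u, 'c) ring_scheme \<Rightarrow> 'u set \<Rightarrow> 'u set \<Rightarrow> ('u, 'z) module \<Rightarrow> ('u \<times> 'z \<Rightarrow>\<^sub>0 int) set" where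
  "tensor_kernel A R H Z =
     generate (free_Abelian_group (H \<times> carrier Z)) (tensor_relations A R H Z)"

definition tensor ::
    "('u, 'c) ring_scheme \<Rightarrow> 'u set \<Rightarrow> 'u set \<Rightarrow> ('u, 'z) module \<Rightarrow>
       ('u, ('u \<times> 'z \<Rightarrow>\<^sub>0 int) set) module" where
  "tensor A R H Z =
     (let F = free_Abelian_group (H \<times> carrier Z); K = tensor_kernel A R H Z; Q = F Mod K in
      \<lparr>carrier = carrier Q, mult = undefined, one = undefined,
       zero = one Q, add = mult Q,
       smult = (\<lambda>s X. \<Union>c\<in>X. K #>\<^bsub>F\<^esub> frag_extend (\<lambda>(h, z). frag_of (s \<otimes>\<^bsub>A\<^esub> h, z)) c)\<rparr>)"

text \<open>
  The \<open>b\<close>-module \<open>k\<^sub>a\<close>: the character \<open>x\<^sub>1\<^sub>1\<^sup>a\<close> of \<open>B\<close> is group-like, hence evaluation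
  at it is multiplicative on \<open>U\<^sub>0(b)\<close>, and it gives \<open>h.1 = a\<close> and \<open>e.1 = 0\<close>; see
  \<open>k_char_action\<close>.
\<close>

definition k_char :: "nat \<Rightarrow> ('k::field functional, 'k) module" where
  "k_char a = \<lparr>carrier = UNIV, mult = undefined, one = undefined, zero = 0, add = (+),
     smult = (\<lambda>u c. u (\<lambda>x. entry 1 1 x ^ a) * c)\<rparr>"

definition baby_verma ::
    "nat \<Rightarrow> ('k::field functional, ('k functional \<times> 'k \<Rightarrow>\<^sub>0 int) set) module" where
  "baby_verma a = tensor U0_sl2 U0_b (carrier U0_sl2) (k_char a)"

text \<open>
  \<open>adjoint g u\<close> is \<open>g u g\<^sup>-\<^sup>1\<close>, where \<open>x \<in> SL(2,k)\<close> is viewed as the functional \<open>f \<mapsto> f x\<close>.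
\<close>

definition adjoint :: "'k::field SL2 \<Rightarrow> 'k functional \<Rightarrow> 'k functional" where
  "adjoint g u = (\<lambda>f. if f \<in> regular then u (\<lambda>x. f (g * x * inverse g)) else 0)"

definition twist ::
    "'k::field SL2 \<Rightarrow> ('k functional, 'm) module \<Rightarrow> ('k functional, 'm) module" where
  "twist g M = M\<lparr>smult := (\<lambda>u. smult M (adjoint (inverse g) u))\<rparr>"


section \<open>Weyl modules\<close>

text \<open>
  \<open>weyl_coeff d i j\<close> is the \<open>(i, j)\<close>-th matrix coefficient of \<open>V(d)\<close> with respect to
  \<open>v\<^sub>0, \<dots>, v\<^sub>d\<close>, that is \<open>x.v\<^sub>j = (\<Sum>i\<le>d. weyl_coeff d i j x * v\<^sub>i)\<close>. It is obtained from
  the realization of \<open>V(d)\<close> as the \<open>d\<close>-th divided power of \<open>k\<^sup>2 = kX + kY\<close>, with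
  \<open>v\<^sub>j = X\<^sup>(\<^sup>d\<^sup>-\<^sup>j\<^sup>) Y\<^sup>(\<^sup>j\<^sup>)\<close>, by expanding
  \<open>(x\<^sub>1\<^sub>1 X + x\<^sub>2\<^sub>1 Y)\<^sup>(\<^sup>d\<^sup>-\<^sup>j\<^sup>) (x\<^sub>1\<^sub>2 X + x\<^sub>2\<^sub>2 Y)\<^sup>(\<^sup>j\<^sup>)\<close>: the pair \<open>(s, t)\<close> takes \<open>s\<close> factors
  \<open>Y\<close> from the first and \<open>t\<close> from the second divided power, where \<open>s + t = i\<close>.
\<close>

definition weyl_coeff :: "nat \<Rightarrow> nat \<Rightarrow> nat \<Rightarrow> 'k::field SL2 \<Rightarrow> 'k" where
  "weyl_coeff d i j x = (\<Sum>(s, t) \<in> {(s, t). s \<le> d - j \<and> t \<le> j \<and> s + t = i}.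
     of_nat ((d - i) choose (j - t)) * of_nat (i choose t) *
     entry 1 1 x ^ (d - j - s) * entry 2 1 x ^ s * entry 1 2 x ^ (j - t) * entry 2 2 x ^ t)"

definition weyl_carrier :: "nat \<Rightarrow> (nat \<Rightarrow> 'k::field) set" where
  "weyl_carrier d = {v. \<forall>i>d. v i = 0}"

definition weyl_group_act :: "nat \<Rightarrow> 'k::field SL2 \<Rightarrow> (nat \<Rightarrow> 'k) \<Rightarrow> (nat \<Rightarrow> 'k)" where
  "weyl_group_act d g v = (\<lambda>i. if i \<le> d then \<Sum>j\<le>d. weyl_coeff d i j g * v j else 0)"

definition weyl_act :: "nat \<Rightarrow> 'k::field functional \<Rightarrow> (nat \<Rightarrow> 'k) \<Rightarrow> (nat \<Rightarrow> 'k)" where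
  "weyl_act d u v = (\<lambda>i. if i \<le> d then \<Sum>j\<le>d. u (weyl_coeff d i j) * v j else 0)"

text \<open>\<open>weyl_sub d S\<close> is the submodule of \<open>V(d)\<close> with underlying set \<open>S\<close>.\<close>

definition weyl_sub ::
    "nat \<Rightarrow> (nat \<Rightarrow> 'k::field) set \<Rightarrow> ('k functional, nat \<Rightarrow> 'k) module" where
  "weyl_sub d S = \<lparr>carrier = S, mult = undefined, one = undefined,
     zero = (\<lambda>_. 0), add = (\<lambda>v w i. v i + w i), smult = weyl_act d\<rparr>"

text \<open>
  \<open>W(d)\<close> is spanned by the \<open>v\<^sub>i\<close> with \<open>i < s p\<close>; here \<open>s = d div p\<close>, because \<open>d = s p + a\<close> with
  \<open>a \<le> p - 2\<close>.
\<close>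

definition W_carrier :: "nat \<Rightarrow> (nat \<Rightarrow> 'k::field) set" where
  "W_carrier d = {v \<in> weyl_carrier d. \<forall>i \<ge> (d div CHAR('k)) * CHAR('k). v i = 0}"

definition translated_W ::
    "'k::field SL2 \<Rightarrow> nat \<Rightarrow> ('k functional, nat \<Rightarrow> 'k) module" where
  "translated_W g d = weyl_sub d (weyl_group_act d g ` W_carrier d)"


section \<open>The filtration of an induced module\<close>

text \<open>
  \<open>I\<^sub>G\<close> and \<open>I\<^sub>N\<close> are the ideals of \<open>\<G>\<close> and \<open>\<N> \<subseteq> \<G>\<close> in \<open>k[SL(2)]\<close>, so that \<open>J\<close> is the image of \<open>I\<^sub>N\<close>
  in \<open>k[\<G>]\<close>, and \<open>v \<in> k\<G>\<close> vanishes on \<open>J\<^sup>l\<^sup>+\<^sup>1\<close> iff it vanishes on \<open>I\<^sub>N\<^sup>l\<^sup>+\<^sup>1\<close> as a functional on \<open>k[SL(2)]\<close>.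
\<close>

definition filtration_bimodule ::
    "('k::field SL2 \<Rightarrow> 'k) set \<Rightarrow> ('k SL2 \<Rightarrow> 'k) set \<Rightarrow> nat \<Rightarrow> 'k functional set" where
  "filtration_bimodule I\<^sub>G I\<^sub>N l = {v \<in> carrier (group_algebra I\<^sub>G).
     \<forall>f \<in> (ideal_prod coord_ring I\<^sub>N ^^ l) I\<^sub>N. v f = 0}"

definition induced_module ::
    "('k::field SL2 \<Rightarrow> 'k) set \<Rightarrow> ('k SL2 \<Rightarrow> 'k) set \<Rightarrow> ('k functional, 'z) module \<Rightarrow>
       ('k functional, ('k functional \<times> 'z \<Rightarrow>\<^sub>0 int) set) module" where
  "induced_module I\<^sub>G I\<^sub>N Z = tensor (group_algebra I\<^sub>G) (carrier (group_algebra I\<^sub>N))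
     (carrier (group_algebra I\<^sub>G)) Z"

text \<open>
  Translating a coset of the relation subgroup of \<open>H\<^sub>l \<otimes> Z\<close> by the relation subgroup of \<open>k\<G> \<otimes> Z\<close>
  is the map \<open>H\<^sub>l \<otimes> Z \<rightarrow> k\<G> \<otimes> Z\<close> induced by the inclusion.
\<close>

definition induced_filtration ::
    "('k::field SL2 \<Rightarrow> 'k) set \<Rightarrow> ('k SL2 \<Rightarrow> 'k) set \<Rightarrow> ('k functional, 'z) module \<Rightarrow> nat \<Rightarrow>
       ('k functional, ('k functional \<times> 'z \<Rightarrow>\<^sub>0 int) set) module" where
  "induced_filtration I\<^sub>G I\<^sub>N Z l =
     (let A = group_algebra I\<^sub>G; R = carrier (group_algebra I\<^sub>N);
          H = filtration_bimodule I\<^sub>G I\<^sub>N l in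
      (induced_module I\<^sub>G I\<^sub>N Z)
        \<lparr>carrier := (\<lambda>X. tensor_kernel A R (carrier A) Z
            <#>\<^bsub>free_Abelian_group (carrier A \<times> carrier Z)\<^esub> X) ` carrier (tensor A R H Z)\<rparr>)"


section \<open>The action of $\mathfrak{sl}(2)$\<close>


lemma sl2_add:
  "D \<in> sl2 \<Longrightarrow> f \<in> regular \<Longrightarrow> g \<in> regular \<Longrightarrow> D (\<lambda>x. f x + g x) = D f + D g"
  by (auto simp: sl2_def dual_def)

lemma sl2_scale: "D \<in> sl2 \<Longrightarrow> f \<in> regular \<Longrightarrow> D (\<lambda>x. c * f x) = c * D f"
  by (auto simp: sl2_def dual_def)

lemma sl2_mult:
  "D \<in> sl2 \<Longrightarrow> f \<in> regular \<Longrightarrow> g \<in> regular \<Longrightarrow> D (\<lambda>x. f x * g x) = f 1 * D g + D f * g 1"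
  by (auto simp: sl2_def)

lemma sl2_const: assumes "D \<in> sl2" shows "D (\<lambda>_. c) = 0"
proof -
  have "D (\<lambda>x. 1 * 1) = 1 * D (\<lambda>_. 1) + D (\<lambda>_. 1) * 1"
    by (rule sl2_mult[OF assms regular.const regular.const])
  then have "D (\<lambda>_. 1) = D (\<lambda>_. 1) + D (\<lambda>_. 1)" by (simp only: mult_1_left mult_1_right)
  then have "D (\<lambda>_. 1) = 0" by (metis add_cancel_right_right)
  moreover have "D (\<lambda>x. c * 1) = c * D (\<lambda>_. 1)"
    by (rule sl2_scale[OF assms regular.const])
  ultimately show ?thesis by simp
qed

lemma regular_power: "f \<in> regular \<Longrightarrow> (\<lambda>x. f x ^ n) \<in> regular"
  by (induction n) (auto intro: regular.intros)

lemma sl2_power: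
  assumes "D \<in> sl2" "f \<in> regular"
  shows "D (\<lambda>x. f x ^ n) = of_nat n * f 1 ^ (n - 1) * D f"
proof (induction n)
  case 0
  then show ?case using sl2_const[OF assms(1), of 1] by simp
next
  case (Suc n)
  then show ?case
    using sl2_mult[OF assms(1) assms(2) regular_power[OF assms(2), of n]]
    by (cases n) (simp_all add: algebra_simps)
qed

lemma regular_sum: "finite S \<Longrightarrow> (\<And>s. s \<in> S \<Longrightarrow> f s \<in> regular) \<Longrightarrow> (\<lambda>x. \<Sum>s\<in>S. f s x) \<in> regular"
  by (induction S rule: finite_induct) (auto intro: regular.intros)

lemma sl2_sum:
  assumes "D \<in> sl2" "finite S" "\<And>s. s \<in> S \<Longrightarrow> f s \<in> regular"
  shows "D (\<lambda>x. \<Sum>s\<in>S. f s x) = (\<Sum>s\<in>S. D (f s))"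
  using assms(2,3)
proof (induction S rule: finite_induct)
  case empty
  then show ?case using sl2_const[OF assms(1), of 0] by simp
next
  case (insert a S)
  then show ?case
    using sl2_add[OF assms(1), of "f a" "\<lambda>x. \<Sum>s\<in>S. f s x"] by (simp add: regular_sum)
qed

lemma entry_1 [simp]:
  "entry 1 1 1 = 1" "entry 1 2 1 = 0" "entry 2 1 1 = 0" "entry 2 2 1 = 1"
  by (transfer, simp add: mat_def)+

lemma entry_det: "entry 1 1 x * entry 2 2 x + (-1) * (entry 1 2 x * entry 2 1 x) = 1"
  by transfer (simp add: det_2)

lemma sl2_trace:
  assumes "D \<in> sl2" shows "D (entry 2 2) = - D (entry 1 1)"
proof -
  have "D (\<lambda>x. entry 1 1 x * entry 2 2 x + (-1) * (entry 1 2 x * entry 2 1 x)) = 0"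
    using sl2_const[OF assms] by (simp only: entry_det)
  moreover have "D (\<lambda>x. entry 1 1 x * entry 2 2 x + (-1) * (entry 1 2 x * entry 2 1 x)) =
      D (entry 1 1) + D (entry 2 2)"
    by (subst sl2_add[OF assms] sl2_mult[OF assms], (intro regular.intros)+)+
       (simp add: sl2_const[OF assms] algebra_simps)
  ultimately show ?thesis by (simp add: eq_neg_iff_add_eq_0 add.commute)
qed

lemma k_char_action:
  assumes "D \<in> sl2" shows "D \<odot>\<^bsub>k_char a\<^esub> c = of_nat a * D (entry 1 1) * c"
  by (simp add: k_char_def sl2_power[OF assms regular.entry])

lemma sl2_weyl_term:
  assumes D: "D \<in> sl2"
  shows "D (\<lambda>x. c * entry 1 1 x ^ A * entry 2 1 x ^ s * entry 1 2 x ^ B * entry 2 2 x ^ t) =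
    c * ((of_nat A - of_nat t) * (if s = 0 \<and> B = 0 then D (entry 1 1) else 0)
      + (if s = 1 \<and> B = 0 then D (entry 2 1) else 0)
      + (if s = 0 \<and> B = 1 then D (entry 1 2) else 0))"
proof -
  have r: "(\<lambda>x. entry i j x ^ n) \<in> regular" for i j :: 2 and n
    by (intro regular_power regular.entry)
  note m = regular.mult
  note r1 = m[OF regular.const[of c] r[of 1 1 A]]
  note r2 = m[OF r1 r[of 2 1 s]]
  note r3 = m[OF r2 r[of 1 2 B]]
  show ?thesis
    unfolding sl2_mult[OF D r3 r] sl2_mult[OF D r2 r] sl2_mult[OF D r1 r]
      sl2_mult[OF D regular.const r] sl2_power[OF D regular.entry] sl2_const[OF D] sl2_trace[OF D]
    by (cases s; cases B) (auto simp: algebra_simps power_0_left)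
qed

lemma sl2_weyl_coeff:
  assumes D: "D \<in> sl2" and ij: "i \<le> d" "j \<le> d"
  shows "D (weyl_coeff d i j) =
    (if i = j then (of_nat d - 2 * of_nat j) * D (entry 1 1)
     else if i = j + 1 then of_nat (j + 1) * D (entry 2 1)
     else if j = i + 1 then of_nat (d - j + 1) * D (entry 1 2) else 0)"
proof -
  define S where "S = {(s, t). s \<le> d - j \<and> t \<le> j \<and> s + t = i}"
  define c where "c t = (of_nat ((d - i) choose (j - t)) * of_nat (i choose t) :: 'a)" for t
  define E where "E s t = c t * ((of_nat (d - j - s) - of_nat t) *
      (if s = 0 \<and> j - t = 0 then D (entry 1 1) else 0)
      + (if s = 1 \<and> j - t = 0 then D (entry 2 1) else 0)
      + (if s = 0 \<and> j - t = 1 then D (entry 1 2) else 0))" for s t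
  have "finite ({..d - j} \<times> {..j})" by simp
  then have fin: "finite S" by (rule rev_finite_subset) (auto simp: S_def)
  have eq: "weyl_coeff d i j = (\<lambda>x. \<Sum>q\<in>S. c (snd q) * entry 1 1 x ^ (d - j - fst q) *
      entry 2 1 x ^ fst q * entry 1 2 x ^ (j - snd q) * entry 2 2 x ^ snd q)"
    unfolding weyl_coeff_def S_def c_def by (simp add: case_prod_beta)
  have "D (weyl_coeff d i j) = (\<Sum>q\<in>S. E (fst q) (snd q))"
    unfolding eq E_def
    by (subst sl2_sum[OF D fin], intro regular.intros regular_power) (simp only: sl2_weyl_term[OF D])
  also have "\<dots> = (\<Sum>q\<in>S \<inter> {(0, j), (1, j), (0, j - 1)}. E (fst q) (snd q))"
  proof (rule sum.mono_neutral_right[OF fin])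
    show "\<forall>q \<in> S - S \<inter> {(0, j), (1, j), (0, j - 1)}. E (fst q) (snd q) = 0"
      by (auto simp: S_def E_def)
  qed simp
  also have "S \<inter> {(0, j), (1, j), (0, j - 1)} =
      (if i = j then {(0, j)} else if i = j + 1 then {(1, j)}
       else if j = i + 1 then {(0, j - 1)} else {})"
    using ij by (auto simp: S_def)
  also have "(\<Sum>q\<in>\<dots>. E (fst q) (snd q)) =
    (if i = j then (of_nat d - 2 * of_nat j) * D (entry 1 1)
     else if i = j + 1 then of_nat (j + 1) * D (entry 2 1)
     else if j = i + 1 then of_nat (d - j + 1) * D (entry 1 2) else 0)"
    using ij by (auto simp: E_def c_def of_nat_diff algebra_simps)
  finally show ?thesis .
qed

text \<open>
  On \<open>V(d)\<close> this is \<open>e.v\<^sub>j = (d - j + 1) v\<^sub>j\<^sub>-\<^sub>1\<close>, \<open>f.v\<^sub>j = (j + 1) v\<^sub>j\<^sub>+\<^sub>1\<close> and \<open>h.v\<^sub>j = (d - 2 j) v\<^sub>j\<close>.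
\<close>

lemma weyl_act_sl2:
  assumes "D \<in> sl2" and "j \<le> d"
  shows "weyl_act d D (\<lambda>i. if i = j then 1 else 0) =
    (\<lambda>i. if i \<le> d then
       (if i = j then (of_nat d - 2 * of_nat j) * D (entry 1 1)
        else if i = j + 1 then of_nat (j + 1) * D (entry 2 1)
        else if j = i + 1 then of_nat (d - j + 1) * D (entry 1 2) else 0) else 0)"
proof
  fix i
  have "(\<Sum>j'\<le>d. D (weyl_coeff d i j') * (if j' = j then 1 else 0)) = D (weyl_coeff d i j)"
    using assms(2) by (simp add: sum.delta if_distrib cong: if_cong)
  then show "weyl_act d D (\<lambda>i. if i = j then 1 else 0) i =
    (if i \<le> d then
       (if i = j then (of_nat d - 2 * of_nat j) * D (entry 1 1)
        else if i = j + 1 then of_nat (j + 1) * D (entry 2 1)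
        else if j = i + 1 then of_nat (d - j + 1) * D (entry 1 2) else 0) else 0)"
    using sl2_weyl_coeff[OF assms(1) _ assms(2), of i] by (simp add: weyl_act_def)
qed

end

theory Submission
  imports Defs "HOL-Computational_Algebra.Polynomial_FPS"
begin

text \<open>
  The group algebras in question consist of the functionals that kill certain \<open>p\<close>-th powers:
  \<open>kSL(2)\<^sub>1\<close>, \<open>H\<^sub>l\<close> and \<open>k\<G>\<close> kill \<open>x\<^sub>1\<^sub>2\<^sup>p\<close>, \<open>x\<^sub>2\<^sub>1\<^sup>p\<close> and
  \<open>(x\<^sub>1\<^sub>1 - 1)\<^sup>p\<^sup>m\<close> with \<open>m = 1\<close>, \<open>l + 1\<close> and \<open>p\<^sup>r\<^sup>-\<^sup>1\<close>. With the divided powers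
  \<open>\<delta>\<^sub>i = (h choose p i)\<close> of the torus one gets \<open>H\<^sub>l = (\<Sum>i\<le>l. \<delta>\<^sub>i kSL(2)\<^sub>1)\<close>, so that \<open>N\<^sub>l\<close> is
  spanned by the \<open>\<delta>\<^sub>i \<otimes> z\<close> with \<open>i \<le> l\<close>.

  For \<open>d = (l + 1) p + a\<close> the span of \<open>v\<^sub>0, \<dots>, v\<^sub>p\<^sub>-\<^sub>1\<close> in \<open>V(d)\<close> is a copy of \<open>Z(a)\<close>, and its
  translate by \<open>g\<close> is a copy of \<open>Z(a)\<^sup>g\<close>. The action of \<open>k\<G>\<close> on \<open>V(d)\<close> extends this embedding to \<open>N\<^sub>l\<close>.
  Since \<open>g\<^sup>-\<^sup>1 diag(t, 1/t) g\<close> has lower left entry \<open>g\<^sub>1\<^sub>1 g\<^sub>2\<^sub>1 (1/t - t)\<close>, the functional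
  \<open>g\<^sup>-\<^sup>1 \<delta>\<^sub>i g\<close> maps \<open>v\<^sub>j\<close> with \<open>j < p\<close> to \<open>(-2 g\<^sub>1\<^sub>1 g\<^sub>2\<^sub>1)\<^sup>p\<^sup>i v\<^sub>i\<^sub>p\<^sub>+\<^sub>j\<close> plus terms of index
  below \<open>i p\<close>. As \<open>g\<close> lies neither in \<open>B\<close> nor in \<open>w\<^sub>0B\<close>, the scalar is nonzero, and this
  triangularity identifies \<open>N\<^sub>l\<close> with the translate of the span of \<open>v\<^sub>0, \<dots>, v\<^sub>(\<^sub>l\<^sub>+\<^sub>1\<^sub>)\<^sub>p\<^sub>-\<^sub>1\<close>.
\<close>

section \<open>Regular functions\<close>

text \<open>An element of \<open>kSL(2)_1\<close> cannot see p-th powers: its value at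
  \<open>f ^ p * h\<close> is \<open>f(1) ^ p\<close> times its value at \<open>h\<close>.
  Convolving with it therefore preserves every condition of the form "kills a p-th power", and the
  part of highest order along the torus can be isolated by multiplying with
  \<open>(x_11 - 1) ^ (p m)\<close> and removed with \<open>\<delta> m\<close>. Similar removals
  with \<open>h\<close>, \<open>e\<close> and \<open>f\<close> describe \<open>U_0(b)\<close> and
  the powers of \<open>f\<close> over it. On the tensor side only spanning is proved: elements have
  normal forms over the \<open>\<delta> i\<close>, or over the \<open>f ^ j\<close> in the case of
  \<open>Z(a)\<close>. That these are unique is read off from their images in \<open>V(d)\<close>.
  As \<open>d = a\<close> mod p, \<open>U_0(b)\<close> acts on \<open>v_0\<close> through the
  character \<open>a\<close>. The factor -2 is the value at \<open>t = 1\<close> of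
  \<open>-(t + 1) / t\<close> in \<open>1/t - t = -(t - 1) (t + 1) / t\<close>; here p > 2 enters.
  Functions on the torus involve \<open>1/t\<close>, so their expansions in \<open>t - 1\<close> are
  power series. In the matrix coefficients, terms of too low degree in the lower left entry
  disappear because \<open>(np + j choose t) = (j choose t)\<close> mod p for
  \<open>t < p\<close>.\<close>

lemma index_2_cases:
  obtains "i = (1::2)" | "i = 2"
  using exhaust_2 by blast

lemma entry_mult: "entry i j (x * y) = entry i 1 x * entry 1 j y + entry i 2 x * entry 2 j y"
  by transfer (simp add: matrix_matrix_mult_def sum_2)

lemma SL2_eqI:
  assumes "\<And>i j. entry i j x = entry i j y"
  shows "x = y"
  using assms by transfer (simp add: vec_eq_iff)

lift_definition mk_SL2 :: "'k::field \<Rightarrow> 'k \<Rightarrow> 'k \<Rightarrow> 'k \<Rightarrow> 'k SL2" is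
  "\<lambda>a b c d. if a * d - b * c = 1 then vector [vector [a, b], vector [c, d]] else mat 1"
  by (simp add: det_2 mat_def)

lemma entry_mk_SL2:
  assumes "a * d - b * c = 1"
  shows "entry 1 1 (mk_SL2 a b c d) = a" "entry 1 2 (mk_SL2 a b c d) = b"
    "entry 2 1 (mk_SL2 a b c d) = c" "entry 2 2 (mk_SL2 a b c d) = d"
  using assms by (transfer, simp)+

lemma entry_w0:
  "entry 1 1 w0 = 0" "entry 1 2 w0 = 1" "entry 2 1 w0 = -1" "entry 2 2 w0 = 0"
  by (transfer, simp)+

text \<open>\<open>inverse\<close> comes from a choice of inverse matrix, so the adjugate is written
  down, checked to be a right inverse and identified by cancellation.\<close>

lemma entry_inverse:
  "entry 1 1 (inverse x) = entry 2 2 x" "entry 1 2 (inverse x) = - entry 1 2 x"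
  "entry 2 1 (inverse x) = - entry 2 1 x" "entry 2 2 (inverse x) = entry 1 1 x"
proof -
  define y where "y = mk_SL2 (entry 2 2 x) (- entry 1 2 x) (- entry 2 1 x) (entry 1 1 x)"
  have det: "entry 1 1 x * entry 2 2 x - entry 1 2 x * entry 2 1 x = 1"
    using entry_det[of x] by simp
  have y: "entry 1 1 y = entry 2 2 x" "entry 1 2 y = - entry 1 2 x"
    "entry 2 1 y = - entry 2 1 x" "entry 2 2 y = entry 1 1 x"
    unfolding y_def by (subst entry_mk_SL2; use det in \<open>simp add: mult.commute\<close>)+
  have "x * y = 1"
  proof (rule SL2_eqI)
    fix i j :: 2
    show "entry i j (x * y) = entry i j 1"
      using det by (cases i rule: index_2_cases; cases j rule: index_2_cases)
        (simp_all add: entry_mult y algebra_simps)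
  qed
  then have "inverse x = inverse x * (x * y)" by simp
  also have "\<dots> = y" by (simp flip: mult.assoc)
  finally have "inverse x = y" .
  then show "entry 1 1 (inverse x) = entry 2 2 x" "entry 1 2 (inverse x) = - entry 1 2 x"
    "entry 2 1 (inverse x) = - entry 2 1 x" "entry 2 2 (inverse x) = entry 1 1 x"
    using y by simp_all
qed

lemma SL2_inverse_inverse [simp]: "inverse (inverse x) = (x :: 'k::field SL2)"
proof (rule SL2_eqI)
  fix i j :: 2
  show "entry i j (inverse (inverse x)) = entry i j x"
    by (cases i rule: index_2_cases; cases j rule: index_2_cases) (simp_all add: entry_inverse)
qed

lemma regular_uminus: "f \<in> regular \<Longrightarrow> (\<lambda>x. - f x) \<in> regular"
  using regular.mult[OF regular.const[of "-1"], of f] by simp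

lemma regular_diff: "f \<in> regular \<Longrightarrow> g \<in> regular \<Longrightarrow> (\<lambda>x. f x - g x) \<in> regular"
  using regular.add[OF _ regular_uminus, of f g] by simp

lemmas regular_intros =
  regular.const regular.entry regular.add regular.mult regular_uminus regular_diff regular_power

lemma regular_compose:
  assumes "\<And>i j. (\<lambda>x. entry i j (\<sigma> x)) \<in> regular" and "f \<in> regular"
  shows "(\<lambda>x. f (\<sigma> x)) \<in> regular"
  using assms(2) by induction (auto intro: regular_intros assms(1))

lemma regular_left: "f \<in> regular \<Longrightarrow> (\<lambda>y. f (x * y)) \<in> regular"
  by (rule regular_compose) (auto simp: entry_mult intro!: regular_intros)

lemma regular_right: "f \<in> regular \<Longrightarrow> (\<lambda>x. f (x * y)) \<in> regular"
  by (rule regular_compose) (auto simp: entry_mult intro!: regular_intros)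

lemma regular_conj: "f \<in> regular \<Longrightarrow> (\<lambda>x. f (g * x * h)) \<in> regular"
  using regular_left[OF regular_right[of f h], of g] by simp

text \<open>
  \<open>biregular I J\<close> consists of the elements of \<open>k[SL(2)] \<otimes> k[SL(2)]\<close> that lie in
  \<open>I \<otimes> k[SL(2)] + k[SL(2)] \<otimes> J\<close>.
\<close>

inductive_set biregular ::
    "('k::field SL2 \<Rightarrow> 'k) set \<Rightarrow> ('k SL2 \<Rightarrow> 'k) set \<Rightarrow> ('k SL2 \<Rightarrow> 'k SL2 \<Rightarrow> 'k) set"
  for I J where
  zero: "(\<lambda>x y. 0) \<in> biregular I J"
| step: "F \<in> biregular I J \<Longrightarrow> \<phi> \<in> regular \<Longrightarrow> \<psi> \<in> regular \<Longrightarrow> \<phi> \<in> I \<or> \<psi> \<in> J \<Longrightarrow>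
    (\<lambda>x y. F x y + \<phi> x * \<psi> y) \<in> biregular I J"

text \<open>Ties the inductive set to the explicit sums in \<open>product_scheme\<close>; the
  inductive form supports arguments term by term.\<close>

lemma biregular_iff:
  "F \<in> biregular I J \<longleftrightarrow> (\<exists>n \<phi> \<psi>.
     (\<forall>i<n. \<phi> i \<in> regular \<and> \<psi> i \<in> regular \<and> (\<phi> i \<in> I \<or> \<psi> i \<in> J)) \<and>
     (\<forall>x y. F x y = (\<Sum>i<(n::nat). \<phi> i x * \<psi> i y)))" (is "_ \<longleftrightarrow> ?R F")
proof
  assume "F \<in> biregular I J"
  then show "?R F"
  proof induction
    case zero
    show ?case by (rule exI[of _ 0]) simp
  next
    case (step F \<phi> \<psi>)
    then obtain n \<phi>' \<psi>' where
      *: "\<And>i. i < n \<Longrightarrow> \<phi>' i \<in> regular \<and> \<psi>' i \<in> regular \<and> (\<phi>' i \<in> I \<or> \<psi>' i \<in> J)"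
        "\<And>x y. F x y = (\<Sum>i<(n::nat). \<phi>' i x * \<psi>' i y)"
      by blast
    show ?case
      by (rule exI[of _ "Suc n"], rule exI[of _ "\<phi>'(n := \<phi>)"], rule exI[of _ "\<psi>'(n := \<psi>)"])
        (use step * in \<open>auto simp: less_Suc_eq intro!: sum.cong\<close>)
  qed
next
  assume "?R F"
  then obtain n \<phi> \<psi> where
    *: "\<And>i. i < n \<Longrightarrow> \<phi> i \<in> regular \<and> \<psi> i \<in> regular \<and> (\<phi> i \<in> I \<or> \<psi> i \<in> J)"
      "\<And>x y. F x y = (\<Sum>i<(n::nat). \<phi> i x * \<psi> i y)"
    by blast
  have "(\<lambda>x y. \<Sum>i<m. \<phi> i x * \<psi> i y) \<in> biregular I J" if "m \<le> n" for m
    using that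
  proof (induction m)
    case 0
    then show ?case using biregular.zero by simp
  next
    case (Suc m)
    then show ?case using biregular.step[of _ I J "\<phi> m" "\<psi> m"] * by (simp add: Suc_le_eq)
  qed
  moreover have "F = (\<lambda>x y. \<Sum>i<n. \<phi> i x * \<psi> i y)" using *(2) by blast
  ultimately show "F \<in> biregular I J" by simp
qed

lemma biregular_single:
  "\<phi> \<in> regular \<Longrightarrow> \<psi> \<in> regular \<Longrightarrow> \<phi> \<in> I \<or> \<psi> \<in> J \<Longrightarrow> (\<lambda>x y. \<phi> x * \<psi> y) \<in> biregular I J"
  using biregular.step[OF biregular.zero] by simp

lemma biregular_add:
  assumes "G \<in> biregular I J" "F \<in> biregular I J"
  shows "(\<lambda>x y. F x y + G x y) \<in> biregular I J"
  using assms(1)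
proof induction
  case (step G \<phi> \<psi>)
  then show ?case using biregular.step[of "\<lambda>x y. F x y + G x y" I J \<phi> \<psi>]
    by (simp add: add.assoc)
qed (use assms(2) in simp)

text \<open>Sums are built into \<open>biregular\<close>, so absorption by \<open>I\<close> and
  \<open>J\<close> in each tensor factor makes it an ideal of the tensor product.\<close>

lemma biregular_mult:
  assumes F: "F \<in> biregular UNIV UNIV" and G: "G \<in> biregular I J"
    and I: "\<And>\<phi> f. \<phi> \<in> I \<Longrightarrow> f \<in> regular \<Longrightarrow> (\<lambda>x. f x * \<phi> x) \<in> I"
    and J: "\<And>\<phi> f. \<phi> \<in> J \<Longrightarrow> f \<in> regular \<Longrightarrow> (\<lambda>x. f x * \<phi> x) \<in> J"
  shows "(\<lambda>x y. F x y * G x y) \<in> biregular I J"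
proof -
  have single: "(\<lambda>x y. \<phi> x * \<psi> y * G x y) \<in> biregular I J"
    if "\<phi> \<in> regular" "\<psi> \<in> regular" for \<phi> \<psi>
    using G
  proof induction
    case zero
    then show ?case using biregular.zero by simp
  next
    case (step G \<phi>' \<psi>')
    have "(\<lambda>x y. \<phi> x * \<psi> y * G x y + (\<phi> x * \<phi>' x) * (\<psi> y * \<psi>' y)) \<in> biregular I J"
      by (rule biregular.step) (use step that I J in \<open>auto intro: regular_intros\<close>)
    then show ?case by (simp add: algebra_simps)
  qed
  show ?thesis using F
  proof induction
    case zero
    then show ?case using biregular.zero by simp
  next
    case (step F \<phi> \<psi>)
    show ?case
      using biregular_add[OF single step(5)] step by (simp add: algebra_simps)
  qed
qed

text \<open>Matrix multiplication settles the entries, and the algebraic tensor product is a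
  subalgebra of the functions of two variables. This is what makes partial evaluations
  regular.\<close>

lemma biregular_comult: "f \<in> regular \<Longrightarrow> (\<lambda>x y. f (x * y)) \<in> biregular UNIV UNIV"
proof (induction rule: regular.induct)
  case (const c)
  then show ?case using biregular_single[of "\<lambda>_. c" "\<lambda>_. 1"] by (simp add: regular_intros)
next
  case (entry i j)
  show ?case unfolding entry_mult
    by (intro biregular_add biregular_single regular_intros) auto
qed (auto intro: biregular_add biregular_mult)

section \<open>Functionals and convolution\<close>

lemma dual_add:
  "u \<in> dual \<Longrightarrow> f \<in> regular \<Longrightarrow> g \<in> regular \<Longrightarrow> u (\<lambda>x. f x + g x) = u f + u g"
  by (simp add: dual_def)

lemma dual_scale: "u \<in> dual \<Longrightarrow> f \<in> regular \<Longrightarrow> u (\<lambda>x. c * f x) = c * u f"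
  by (simp add: dual_def)

lemma dual_outside: "u \<in> dual \<Longrightarrow> f \<notin> regular \<Longrightarrow> u f = 0"
  by (simp add: dual_def)

lemma dual_zero: "u \<in> dual \<Longrightarrow> u (\<lambda>_. 0) = 0"
  using dual_scale[of u "\<lambda>_. 0" 0] by (simp add: regular_intros)

lemma dual_uminus: "u \<in> dual \<Longrightarrow> f \<in> regular \<Longrightarrow> u (\<lambda>x. - f x) = - u f"
  using dual_scale[of u f "-1"] by simp

lemma dual_diff:
  "u \<in> dual \<Longrightarrow> f \<in> regular \<Longrightarrow> g \<in> regular \<Longrightarrow> u (\<lambda>x. f x - g x) = u f - u g"
  using dual_add[of u f "\<lambda>x. - g x"] by (simp add: dual_uminus regular_intros)

lemma dual_sum:
  assumes "u \<in> dual" "finite S" "\<And>s. s \<in> S \<Longrightarrow> f s \<in> regular"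
  shows "u (\<lambda>x. \<Sum>s\<in>S. f s x) = (\<Sum>s\<in>S. u (f s))"
  using assms(2,3)
proof (induction S rule: finite_induct)
  case empty
  then show ?case using dual_zero[OF assms(1)] by simp
next
  case (insert a S)
  then show ?case
    using dual_add[OF assms(1), of "f a" "\<lambda>x. \<Sum>s\<in>S. f s x"] by (simp add: regular_sum)
qed

lemma dual_eqI:
  assumes "u \<in> dual" "v \<in> dual" "\<And>f. f \<in> regular \<Longrightarrow> u f = v f"
  shows "u = v"
  using assms by (metis dual_outside ext)

lemma dualI:
  assumes "\<And>f g. f \<in> regular \<Longrightarrow> g \<in> regular \<Longrightarrow> u (\<lambda>x. f x + g x) = u f + u g"
    and "\<And>c f. f \<in> regular \<Longrightarrow> u (\<lambda>x. c * f x) = c * u f"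
    and "\<And>f. f \<notin> regular \<Longrightarrow> u f = 0"
  shows "u \<in> dual"
  using assms by (auto simp: dual_def)

text \<open>For a finite sum of products both iterated values are the sum of the
  \<open>u \<phi> * v \<psi>\<close>. Regularity is part of the same induction because additivity of
  \<open>u\<close> and \<open>v\<close> on the partial values depends on it.\<close>

lemma biregular_dual:
  assumes "F \<in> biregular I J" and u: "u \<in> dual" and v: "v \<in> dual"
  shows "(\<lambda>y. F x y) \<in> regular" "(\<lambda>x. F x y) \<in> regular"
    "(\<lambda>x. v (\<lambda>y. F x y)) \<in> regular" "(\<lambda>y. u (\<lambda>x. F x y)) \<in> regular"
    "u (\<lambda>x. v (\<lambda>y. F x y)) = v (\<lambda>y. u (\<lambda>x. F x y))"
proof -
  have "(\<forall>x. (\<lambda>y. F x y) \<in> regular) \<and> (\<forall>y. (\<lambda>x. F x y) \<in> regular) \<and>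
    (\<lambda>x. v (\<lambda>y. F x y)) \<in> regular \<and> (\<lambda>y. u (\<lambda>x. F x y)) \<in> regular \<and>
    u (\<lambda>x. v (\<lambda>y. F x y)) = v (\<lambda>y. u (\<lambda>x. F x y))"
    using assms(1)
  proof induction
    case zero
    then show ?case by (simp add: dual_zero u v regular_intros)
  next
    case (step F \<phi> \<psi>)
    have v': "v (\<lambda>y. F x y + \<phi> x * \<psi> y) = v (\<lambda>y. F x y) + v \<psi> * \<phi> x" for x
      using step by (subst dual_add[OF v]) (auto simp: dual_scale[OF v] intro: regular_intros)
    have u': "u (\<lambda>x. F x y + \<phi> x * \<psi> y) = u (\<lambda>x. F x y) + u \<phi> * \<psi> y" for y
      using step dual_scale[OF u, of \<phi> "\<psi> y"]
      by (subst dual_add[OF u]) (auto simp: mult.commute[of "\<phi> _"] intro: regular_intros)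
    have *: "(\<lambda>x. v \<psi> * \<phi> x) \<in> regular" "(\<lambda>y. u \<phi> * \<psi> y) \<in> regular"
      using step by (auto intro: regular_intros)
    have "u (\<lambda>x. v (\<lambda>y. F x y) + v \<psi> * \<phi> x) = v (\<lambda>y. u (\<lambda>x. F x y) + u \<phi> * \<psi> y)"
      using step * dual_scale[OF u, of \<phi> "v \<psi>"] dual_scale[OF v, of \<psi> "u \<phi>"]
      by (simp add: dual_add[OF u] dual_add[OF v])
    then show ?case unfolding u' v' using step * by (auto intro!: regular_intros)
  qed
  then show "(\<lambda>y. F x y) \<in> regular" "(\<lambda>x. F x y) \<in> regular"
    "(\<lambda>x. v (\<lambda>y. F x y)) \<in> regular" "(\<lambda>y. u (\<lambda>x. F x y)) \<in> regular"
    "u (\<lambda>x. v (\<lambda>y. F x y)) = v (\<lambda>y. u (\<lambda>x. F x y))" by auto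
qed

lemma regular_partial:
  assumes "v \<in> dual" "f \<in> regular"
  shows "(\<lambda>x. v (\<lambda>y. f (x * y))) \<in> regular" "(\<lambda>y. v (\<lambda>x. f (x * y))) \<in> regular"
  using biregular_dual[OF biregular_comult[OF assms(2)] assms(1,1)] by auto

lemma convolution_apply: "f \<in> regular \<Longrightarrow> convolution u v f = u (\<lambda>x. v (\<lambda>y. f (x * y)))"
  by (simp add: convolution_def)

lemma convolution_apply':
  assumes "u \<in> dual" "v \<in> dual" "f \<in> regular"
  shows "convolution u v f = v (\<lambda>y. u (\<lambda>x. f (x * y)))"
  using biregular_dual(5)[OF biregular_comult[OF assms(3)] assms(1,2)] assms(3)
  by (simp add: convolution_apply)

lemma convolution_dual:
  assumes u: "u \<in> dual" and v: "v \<in> dual"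
  shows "convolution u v \<in> dual"
proof (rule dualI)
  fix f g :: "'a SL2 \<Rightarrow> 'a" assume fg: "f \<in> regular" "g \<in> regular"
  then have "convolution u v (\<lambda>x. f x + g x) = u (\<lambda>x. v (\<lambda>y. f (x * y)) + v (\<lambda>y. g (x * y)))"
    by (simp add: convolution_apply regular_intros dual_add[OF v] regular_left)
  also have "\<dots> = convolution u v f + convolution u v g"
    using fg by (simp add: convolution_apply dual_add[OF u] regular_partial[OF v])
  finally show "convolution u v (\<lambda>x. f x + g x) = convolution u v f + convolution u v g" .
next
  fix c and f :: "'a SL2 \<Rightarrow> 'a" assume f: "f \<in> regular"
  then have "convolution u v (\<lambda>x. c * f x) = u (\<lambda>x. c * v (\<lambda>y. f (x * y)))"
    by (simp add: convolution_apply regular_intros dual_scale[OF v] regular_left)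
  also have "\<dots> = c * convolution u v f"
    using f by (simp add: convolution_apply dual_scale[OF u] regular_partial[OF v])
  finally show "convolution u v (\<lambda>x. c * f x) = c * convolution u v f" .
qed (simp add: convolution_def)

lemma convolution_assoc:
  assumes u: "u \<in> dual" and v: "v \<in> dual" and w: "w \<in> dual"
  shows "convolution (convolution u v) w = convolution u (convolution v w)"
proof (rule dual_eqI)
  fix f :: "'a SL2 \<Rightarrow> 'a" assume f: "f \<in> regular"
  show "convolution (convolution u v) w f = convolution u (convolution v w) f"
    using f by (simp add: convolution_apply regular_partial[OF w] regular_left mult.assoc)
qed (use assms in \<open>auto intro: convolution_dual\<close>)

lemma dual_plus: "u \<in> dual \<Longrightarrow> v \<in> dual \<Longrightarrow> (\<lambda>f. u f + v f) \<in> dual"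
  by (auto simp: dual_def algebra_simps)

lemma dual_minus: "u \<in> dual \<Longrightarrow> v \<in> dual \<Longrightarrow> (\<lambda>f. u f - v f) \<in> dual"
  by (auto simp: dual_def algebra_simps)

lemma dual_neg: "u \<in> dual \<Longrightarrow> (\<lambda>f. - u f) \<in> dual"
  by (auto simp: dual_def algebra_simps)

lemma dual_0: "(\<lambda>_. 0) \<in> dual"
  by (auto simp: dual_def)

lemma scalar_dual: "scalar c \<in> dual"
  by (auto simp: dual_def scalar_def algebra_simps intro: regular_intros)

lemma dual_sum_closed:
  assumes "\<And>i. i \<in> S \<Longrightarrow> u i \<in> dual" shows "(\<lambda>f. \<Sum>i\<in>S. u i f) \<in> dual"
  using assms by (induction S rule: infinite_finite_induct) (auto intro: dual_0 dual_plus)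

lemma convolution_plus_right:
  assumes "u \<in> dual" "v \<in> dual" "v' \<in> dual"
  shows "convolution u (\<lambda>f. v f + v' f) = (\<lambda>f. convolution u v f + convolution u v' f)"
  using assms
  by (auto simp: convolution_def dual_add[OF assms(1)] regular_partial[OF assms(2)] regular_partial[OF assms(3)]
      intro!: ext)

lemma convolution_zero_right: "u \<in> dual \<Longrightarrow> convolution u (\<lambda>_. 0) = (\<lambda>_. 0)"
  by (auto simp: convolution_def dual_zero)

lemma convolution_sum_right:
  assumes "u \<in> dual" "finite S" "\<And>i. i \<in> S \<Longrightarrow> v i \<in> dual"
  shows "convolution u (\<lambda>f. \<Sum>i\<in>S. v i f) = (\<lambda>f. \<Sum>i\<in>S. convolution u (v i) f)"
  using assms(2,3)
proof (induction S rule: finite_induct)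
  case empty
  then show ?case by (simp add: convolution_zero_right assms(1))
next
  case (insert a S)
  then show ?case
    by (simp add: convolution_plus_right assms(1) dual_sum_closed)
qed

lemma convolution_scalar_left: "u \<in> dual \<Longrightarrow> convolution (scalar c) u = (\<lambda>f. c * u f)"
  by (auto simp: convolution_def scalar_def regular_partial dual_outside)

section \<open>Group elements as functionals, and conjugation\<close>

definition evaluation :: "'k::field SL2 \<Rightarrow> 'k functional" where
  "evaluation g = (\<lambda>f. if f \<in> regular then f g else 0)"

lemma evaluation_dual: "evaluation g \<in> dual"
  by (auto simp: dual_def evaluation_def intro: regular_intros)

lemma adjoint_eq:
  assumes u: "u \<in> dual"
  shows "adjoint g u = convolution (evaluation g) (convolution u (evaluation (inverse g)))"
proof
  fix f :: "'a SL2 \<Rightarrow> 'a"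
  show "adjoint g u f = convolution (evaluation g) (convolution u (evaluation (inverse g))) f"
  proof (cases "f \<in> regular")
    case True
    note c = convolution_dual[OF u evaluation_dual[of "inverse g"]]
    have "convolution (evaluation g) (convolution u (evaluation (inverse g))) f =
      convolution u (evaluation (inverse g)) (\<lambda>y. f (g * y))"
      using True regular_partial(1)[OF c True] by (simp add: convolution_apply evaluation_def)
    also have "\<dots> = u (\<lambda>x. f (g * (x * inverse g)))"
      using True regular_left[OF regular_left[OF True], of g]
      by (simp add: convolution_apply evaluation_def regular_left mult.assoc)
    finally show ?thesis using True by (simp add: adjoint_def mult.assoc)
  qed (simp_all add: adjoint_def convolution_def)
qed

lemma adjoint_dual: "u \<in> dual \<Longrightarrow> adjoint g u \<in> dual"
  by (simp add: adjoint_eq convolution_dual evaluation_dual)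

lemma evaluation_mult: "convolution (evaluation g) (evaluation h) = evaluation (g * h)"
  by (auto simp: convolution_def evaluation_def regular_left regular_right)

lemma evaluation_1: "evaluation 1 = scalar 1"
  by (auto simp: evaluation_def scalar_def)

text \<open>Moves a functional past a group element; this is what turns the twist of a module by
  \<open>g\<close> into translation by \<open>g\<close>.\<close>

lemma convolution_adjoint:
  assumes u: "u \<in> dual"
  shows "convolution u (evaluation g) = convolution (evaluation g) (adjoint (inverse g) u)"
proof -
  note d = evaluation_dual convolution_dual u
  have "convolution (evaluation g) (adjoint (inverse g) u) =
    convolution (convolution (evaluation g) (evaluation (inverse g))) (convolution u (evaluation g))"
    by (simp add: adjoint_eq u convolution_assoc d)
  also have "\<dots> = convolution u (evaluation g)"
    by (simp add: evaluation_mult evaluation_1 convolution_scalar_left d)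
  finally show ?thesis by simp
qed

text \<open>The \<open>k[SL(2)]\<close>-module structure of the dual, transposed from
  multiplication. Acting with a power of an equation isolates the top-order part of a
  functional.\<close>

definition fn_act :: "('k::field SL2 \<Rightarrow> 'k) \<Rightarrow> 'k functional \<Rightarrow> 'k functional" where
  "fn_act q u = (\<lambda>f. if f \<in> regular then u (\<lambda>x. q x * f x) else 0)"

lemma fn_act_dual:
  assumes "u \<in> dual" "q \<in> regular" shows "fn_act q u \<in> dual"
proof (rule dualI)
  fix f g :: "'a SL2 \<Rightarrow> 'a" assume "f \<in> regular" "g \<in> regular"
  then show "fn_act q u (\<lambda>x. f x + g x) = fn_act q u f + fn_act q u g"
    using dual_add[of u "\<lambda>x. q x * f x" "\<lambda>x. q x * g x"]
    by (simp add: fn_act_def regular_intros distrib_left assms)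
next
  fix c and f :: "'a SL2 \<Rightarrow> 'a" assume "f \<in> regular"
  then show "fn_act q u (\<lambda>x. c * f x) = c * fn_act q u f"
    using dual_scale[of u "\<lambda>x. q x * f x" c]
    by (simp add: fn_act_def regular_intros assms mult.left_commute)
qed (simp add: fn_act_def)

text \<open>Vanishing on the principal ideal of \<open>q\<close>. Unlike vanishing at
  \<open>q\<close> alone, this is stable under \<open>fn_act\<close>.\<close>

definition kills :: "'k::field functional \<Rightarrow> ('k SL2 \<Rightarrow> 'k) \<Rightarrow> bool" where
  "kills u q \<longleftrightarrow> (\<forall>f\<in>regular. u (\<lambda>x. q x * f x) = 0)"

lemma killsD: "kills u q \<Longrightarrow> f \<in> regular \<Longrightarrow> u (\<lambda>x. q x * f x) = 0"
  by (simp add: kills_def)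

lemma kills_fn_act: "kills u q \<Longrightarrow> h \<in> regular \<Longrightarrow> kills (fn_act h u) q"
  using killsD[of u q "\<lambda>x. h x * f x" for f]
  by (auto simp: kills_def fn_act_def mult.left_commute intro: regular_intros)

lemma kills_minus: "kills u q \<Longrightarrow> kills v q \<Longrightarrow> kills (\<lambda>f. u f - v f) q"
  by (simp add: kills_def)

lemma kills_plus: "kills u q \<Longrightarrow> kills v q \<Longrightarrow> kills (\<lambda>f. u f + v f) q"
  by (simp add: kills_def)

lemma kills_mult: "kills u q \<Longrightarrow> h \<in> regular \<Longrightarrow> kills u (\<lambda>x. q x * h x)"
  by (simp add: kills_def mult.assoc regular_intros)

lemma kills_power_mono:
  assumes "kills u (\<lambda>x. q x ^ m)" "q \<in> regular" "m \<le> n"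
  shows "kills u (\<lambda>x. q x ^ n)"
  using kills_mult[OF assms(1) regular_power[OF assms(2), of "n - m"]] assms(3)
  by (simp flip: power_add)

section \<open>Functionals supported at Frobenius neighbourhoods of the identity\<close>

text \<open>
  With \<open>p = CHAR('k)\<close>, this turns out to be \<open>kSL(2)\<^sub>1\<close> for \<open>m = 1\<close>, \<open>k\<G>\<close> for
  \<open>m = p\<^sup>r\<^sup>-\<^sup>1\<close>, and \<open>H\<^sub>l\<close> for \<open>m = l + 1\<close>.
\<close>

definition frob_dist :: "nat \<Rightarrow> 'k::field functional set" where
  "frob_dist m = {u \<in> dual. kills u (\<lambda>x. entry 1 2 x ^ CHAR('k)) \<and> kills u (\<lambda>x. entry 2 1 x ^ CHAR('k)) \<and>
     kills u (\<lambda>x. (entry 1 1 x - 1) ^ (CHAR('k) * m))}"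

lemma frob_dist_dual: "u \<in> frob_dist m \<Longrightarrow> u \<in> dual"
  by (simp add: frob_dist_def)

lemma frob_dist_minus: "u \<in> frob_dist m \<Longrightarrow> v \<in> frob_dist m \<Longrightarrow> (\<lambda>f. u f - v f) \<in> frob_dist m"
  by (simp add: frob_dist_def dual_minus kills_minus)

lemma frob_dist_plus: "u \<in> frob_dist m \<Longrightarrow> v \<in> frob_dist m \<Longrightarrow> (\<lambda>f. u f + v f) \<in> frob_dist m"
  by (simp add: frob_dist_def dual_plus kills_plus)

lemma frob_dist_fn_act: "u \<in> frob_dist m \<Longrightarrow> h \<in> regular \<Longrightarrow> fn_act h u \<in> frob_dist m"
  by (simp add: frob_dist_def fn_act_dual kills_fn_act)

lemma frob_dist_zero: "(\<lambda>_. 0) \<in> frob_dist m"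
  by (simp add: frob_dist_def dual_0 kills_def)

lemma frob_dist_mono: "u \<in> frob_dist m \<Longrightarrow> m \<le> n \<Longrightarrow> u \<in> frob_dist n"
  using kills_power_mono[of u "\<lambda>x. entry 1 1 x - 1" "CHAR('a) * m" "CHAR('a) * n"]
  by (simp add: frob_dist_def regular_intros)

text \<open>Taking p-th powers is a ring homomorphism, so everything reduces to the matrix entries.
  The factor \<open>h\<close> stays arbitrary because in the product case one of the two p-th powers
  is absorbed into it.\<close>

lemma frob_dist_1_power:
  assumes p: "prime CHAR('k::field)" and u: "u \<in> frob_dist 1"
    and f: "f \<in> regular" and "h \<in> regular"
  shows "u (\<lambda>x. f x ^ CHAR('k) * h x) = f 1 ^ CHAR('k) * u (h :: 'k SL2 \<Rightarrow> 'k)"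
  using f \<open>h \<in> regular\<close>
proof (induction f arbitrary: h rule: regular.induct)
  case (const c)
  then show ?case using dual_scale[OF frob_dist_dual[OF u], of h "c ^ CHAR('k)"] by simp
next
  case (entry i j)
  have d: "u \<in> dual" using u by (rule frob_dist_dual)
  have p0: "CHAR('k) > 0" using p by (simp add: prime_gt_0_nat)
  have k12: "u (\<lambda>x. entry 1 2 x ^ CHAR('k) * h x) = 0" if "h \<in> regular" for h
    using u that by (simp add: frob_dist_def kills_def)
  have k21: "u (\<lambda>x. entry 2 1 x ^ CHAR('k) * h x) = 0" if "h \<in> regular" for h
    using u that by (simp add: frob_dist_def kills_def)
  have k11: "u (\<lambda>x. entry 1 1 x ^ CHAR('k) * h x) = u h" if h: "h \<in> regular" for h
  proof -
    have "u (\<lambda>x. entry 1 1 x ^ CHAR('k) * h x) = u (\<lambda>x. (entry 1 1 x - 1) ^ CHAR('k) * h x + h x)"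
      using freshmans_dream[OF p refl, of "entry 1 1 x - 1" 1 for x] by (simp add: algebra_simps)
    also have "\<dots> = u (\<lambda>x. (entry 1 1 x - 1) ^ CHAR('k) * h x) + u h"
      by (rule dual_add[OF d]) (intro regular_intros h)+
    finally show ?thesis using u h by (simp add: frob_dist_def kills_def)
  qed
  \<comment> \<open>The defining conditions do not mention \<open>x_22\<close>; its p-th power is
    recovered from the determinant, as \<open>x_11^p x_22^p = 1 + (x_12 x_21)^p\<close>.\<close>
  have k22: "u (\<lambda>x. entry 2 2 x ^ CHAR('k) * h x) = u h" if h: "h \<in> regular" for h
  proof -
    have "u (\<lambda>x. entry 2 2 x ^ CHAR('k) * h x) =
      u (\<lambda>x. entry 1 1 x ^ CHAR('k) * (entry 2 2 x ^ CHAR('k) * h x))"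
      by (rule k11[symmetric]) (intro regular_intros h)
    also have "(entry 1 1 x * entry 2 2 x) ^ CHAR('k) = 1 + (entry 1 2 x * entry 2 1 x) ^ CHAR('k)" for x :: "'k SL2"
      using entry_det[of x] freshmans_dream[OF p refl, of 1 "entry 1 2 x * entry 2 1 x"]
      by (simp add: algebra_simps)
    then have "(\<lambda>x. entry 1 1 x ^ CHAR('k) * (entry 2 2 x ^ CHAR('k) * h x)) =
      (\<lambda>x. entry 1 2 x ^ CHAR('k) * (entry 2 1 x ^ CHAR('k) * h x) + h x)"
      by (simp add: power_mult_distrib distrib_right add.commute flip: mult.assoc)
    also have "u \<dots> = u h"
      using k12[of "\<lambda>x. entry 2 1 x ^ CHAR('k) * h x"] h
      by (subst dual_add[OF d]) (simp_all add: regular_intros)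
    finally show ?thesis .
  qed
  show ?case
    using k11[OF entry] k12[OF entry] k21[OF entry] k22[OF entry] p0
    by (cases i rule: index_2_cases; cases j rule: index_2_cases) simp_all
next
  case (add f g)
  have d: "u \<in> dual" using u by (rule frob_dist_dual)
  have "u (\<lambda>x. (f x + g x) ^ CHAR('k) * h x) = u (\<lambda>x. f x ^ CHAR('k) * h x + g x ^ CHAR('k) * h x)"
    by (simp add: freshmans_dream[OF p refl] algebra_simps)
  also have "\<dots> = u (\<lambda>x. f x ^ CHAR('k) * h x) + u (\<lambda>x. g x ^ CHAR('k) * h x)"
    by (rule dual_add[OF d]) (intro regular_intros add)+
  finally show ?case using add by (simp add: freshmans_dream[OF p refl] algebra_simps)
next
  case (mult f g)
  have "u (\<lambda>x. f x ^ CHAR('k) * (g x ^ CHAR('k) * h x)) = f 1 ^ CHAR('k) * u (\<lambda>x. g x ^ CHAR('k) * h x)"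
    by (rule mult) (intro regular_intros mult)
  then show ?case using mult by (simp add: power_mult_distrib mult.assoc)
qed

text \<open>Trades three coordinates for all functions vanishing at 1. The second form is stable
  under conjugation and matches the generators of the ideal \<open>SL2_1\<close>.\<close>

lemma frob_dist_1_iff:
  assumes p: "prime CHAR('k::field)"
  shows "(u :: 'k functional) \<in> frob_dist 1 \<longleftrightarrow>
    u \<in> dual \<and> (\<forall>f\<in>regular. f 1 = 0 \<longrightarrow> kills u (\<lambda>x. f x ^ CHAR('k)))"
proof (intro iffI conjI ballI impI)
  assume u: "u \<in> frob_dist 1"
  then show "u \<in> dual" by (rule frob_dist_dual)
  fix f :: "'k SL2 \<Rightarrow> 'k" assume "f \<in> regular" "f 1 = 0"
  then show "kills u (\<lambda>x. f x ^ CHAR('k))"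
    using p by (auto simp: kills_def frob_dist_1_power[OF p u] prime_gt_0_nat)
next
  assume u: "u \<in> dual \<and> (\<forall>f\<in>regular. f 1 = 0 \<longrightarrow> kills u (\<lambda>x. f x ^ CHAR('k)))"
  show "u \<in> frob_dist 1"
    using u[THEN conjunct2, rule_format, of "entry 1 2"] u[THEN conjunct2, rule_format, of "entry 2 1"]
      u[THEN conjunct2, rule_format, of "\<lambda>x. entry 1 1 x - 1"] u
    by (simp add: frob_dist_def regular_intros)
qed

text \<open>In \<open>F(xy) ^ p\<close> the functional \<open>s\<close> acts on \<open>y\<close> and
  sees only the value at \<open>y = 1\<close>, so the power passes through. The left version
  exchanges the two variables.\<close>

lemma convolution_dist_1_right:
  assumes p: "prime CHAR('k::field)" and s: "s \<in> frob_dist 1"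
    and F: "F \<in> regular" and f: "f \<in> regular"
  shows "convolution w s (\<lambda>x. F x ^ CHAR('k) * f x) =
    w (\<lambda>x. F x ^ CHAR('k) * s (\<lambda>y. f (x * y) :: 'k))"
  using frob_dist_1_power[OF p s regular_left[OF F] regular_left[OF f]]
  by (simp add: convolution_apply regular_intros F f)

lemma convolution_dist_1_left:
  assumes p: "prime CHAR('k::field)" and s: "s \<in> frob_dist 1" and w: "w \<in> dual"
    and F: "F \<in> regular" and f: "f \<in> regular"
  shows "convolution s w (\<lambda>x. F x ^ CHAR('k) * f x) =
    w (\<lambda>y. F y ^ CHAR('k) * s (\<lambda>x. f (x * y) :: 'k))"
  using frob_dist_1_power[OF p s regular_right[OF F] regular_right[OF f]]
  by (simp add: convolution_apply'[OF frob_dist_dual[OF s] w] regular_intros F f)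

lemma kills_convolution_dist_1:
  assumes p: "prime CHAR('k::field)" and s: "s \<in> frob_dist 1" and w: "w \<in> dual"
    and F: "F \<in> regular" and k: "kills w (\<lambda>x. F x ^ CHAR('k) :: 'k)"
  shows "kills (convolution w s) (\<lambda>x. F x ^ CHAR('k))" "kills (convolution s w) (\<lambda>x. F x ^ CHAR('k))"
  using k by (simp_all add: kills_def convolution_dist_1_right[OF p s F] regular_partial[OF frob_dist_dual[OF s]]
      convolution_dist_1_left[OF p s w F])

lemma frob_dist_convolution:
  assumes p: "prime CHAR('k::field)" and s: "(s :: 'k functional) \<in> frob_dist 1" and w: "w \<in> frob_dist m"
  shows "convolution w s \<in> frob_dist m" "convolution s w \<in> frob_dist m"
proof -
  note d = frob_dist_dual[OF s] frob_dist_dual[OF w]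
  note k = kills_convolution_dist_1[OF p s d(2)]
  \<comment> \<open>\<open>(x_11 - 1) ^ (p m)\<close> is the p-th power of this function, so all
    three defining conditions concern p-th powers.\<close>
  have r: "(\<lambda>x. (entry 1 1 x - 1) ^ m) \<in> (regular :: ('k SL2 \<Rightarrow> 'k) set)"
    by (intro regular_intros)
  show "convolution w s \<in> frob_dist m" "convolution s w \<in> frob_dist m"
    using k[OF regular.entry, of 1 2] k[OF regular.entry, of 2 1] k[OF r] w
    by (simp_all add: frob_dist_def convolution_dual d mult.commute[of "CHAR('k)"] power_mult)
qed

text \<open>Normality of the first Frobenius kernel: conjugation fixes 1, so it carries functions
  vanishing at 1 to such functions.\<close>

lemma adjoint_dist_1:
  assumes p: "prime CHAR('k::field)" and u: "(u :: 'k functional) \<in> frob_dist 1"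
  shows "adjoint g u \<in> frob_dist 1"
  unfolding frob_dist_1_iff[OF p]
proof (intro conjI ballI impI)
  show "adjoint g u \<in> dual" using frob_dist_dual[OF u] by (rule adjoint_dual)
  fix f :: "'k SL2 \<Rightarrow> 'k" assume f: "f \<in> regular" "f 1 = 0"
  have "u (\<lambda>x. f (g * x * inverse g) ^ CHAR('k) * h (g * x * inverse g)) = 0" if "h \<in> regular" for h
    using frob_dist_1_power[OF p u regular_conj[OF f(1)] regular_conj[OF that]] f(2) p
    by (simp add: prime_gt_0_nat)
  then show "kills (adjoint g u) (\<lambda>x. f x ^ CHAR('k))"
    by (simp add: kills_def adjoint_def regular_intros f)
qed

lemma sl2_dual: "D \<in> sl2 \<Longrightarrow> D \<in> dual"
  by (simp add: sl2_def)

lemma sl2_dist_1: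
  assumes p: "prime CHAR('k::field)" and D: "(D :: 'k functional) \<in> sl2"
  shows "D \<in> frob_dist 1"
  using p unfolding frob_dist_1_iff[OF p]
  by (auto simp: kills_def sl2_mult[OF D] sl2_power[OF D] regular_intros sl2_dual[OF D] prime_gt_0_nat)

lemma scalar_dist_1:
  assumes p: "prime CHAR('k::field)" shows "scalar (c :: 'k) \<in> frob_dist 1"
  using p unfolding frob_dist_1_iff[OF p]
  by (auto simp: kills_def scalar_def scalar_dual[unfolded scalar_def] prime_gt_0_nat)

section \<open>Peeling off powers of a derivation\<close>

text \<open>Convolution by \<open>D\<close> is dual to the invariant derivation sending
  \<open>f\<close> to the function \<open>y \<mapsto> D (\<lambda>x. f (x * y))\<close>. It sends
  \<open>q\<close> to \<open>\<kappa>\<close>, and the Leibniz rule gives the two terms.\<close>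

lemma convolution_sl2_power:
  assumes D: "D \<in> sl2" and w: "w \<in> dual" and q: "q \<in> regular" and f: "f \<in> regular"
    and \<kappa>: "\<And>y. D (\<lambda>x. q (x * y)) = \<kappa> y"
  shows "convolution D w (\<lambda>x. q x ^ n * f x) =
    w (\<lambda>y. q y ^ n * D (\<lambda>x. f (x * y))) + of_nat n * w (\<lambda>y. q y ^ (n - 1) * (\<kappa> y * f y))"
proof -
  have "D (\<lambda>x. q (x * y) ^ n * f (x * y)) =
    q y ^ n * D (\<lambda>x. f (x * y)) + of_nat n * (q y ^ (n - 1) * (\<kappa> y * f y))" for y
    using sl2_mult[OF D regular_power[OF regular_right[OF q], of y n] regular_right[OF f, of y]]
      sl2_power[OF D regular_right[OF q], of y n]
    by (simp add: \<kappa> mult.assoc)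
  then have "convolution D w (\<lambda>x. q x ^ n * f x) =
    w (\<lambda>y. q y ^ n * D (\<lambda>x. f (x * y)) + of_nat n * (q y ^ (n - 1) * (\<kappa> y * f y)))"
    using q f by (simp add: convolution_apply'[OF sl2_dual[OF D] w] regular_intros)
  moreover have "\<kappa> \<in> regular"
    using regular_partial(2)[OF sl2_dual[OF D] q] \<kappa> by simp
  ultimately show ?thesis
    using f q by (simp add: dual_add[OF w] dual_scale[OF w] regular_intros regular_partial(2)[OF sl2_dual[OF D]])
qed

text \<open>In the Leibniz formula the first term keeps the exponent of \<open>q\<close> and the
  second lowers it by one: at exponent \<open>m + 1\<close> both vanish, at \<open>m\<close> only
  the second remains.\<close>

lemma kills_convolution_sl2:
  assumes D: "D \<in> sl2" and w: "w \<in> dual" and q: "q \<in> regular"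
    and \<kappa>: "\<And>y. D (\<lambda>x. q (x * y)) = \<kappa> y" and k: "kills w (\<lambda>x. q x ^ m)"
  shows "kills (convolution D w) (\<lambda>x. q x ^ Suc m)"
    "f \<in> regular \<Longrightarrow> convolution D w (\<lambda>x. q x ^ m * f x) = of_nat m * w (\<lambda>y. q y ^ (m - 1) * (\<kappa> y * f y))"
proof -
  have "\<kappa> \<in> regular"
    using regular_partial(2)[OF sl2_dual[OF D] q] \<kappa> by simp
  then show "kills (convolution D w) (\<lambda>x. q x ^ Suc m)"
    unfolding kills_def convolution_sl2_power[OF D w q _ \<kappa>] Ball_def
    using killsD[OF kills_power_mono[OF k q, of "Suc m"]] killsD[OF k]
    by (auto simp: convolution_sl2_power[OF D w q _ \<kappa>] regular_intros regular_partial(2)[OF sl2_dual[OF D]]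
        simp del: power_Suc)
  show "f \<in> regular \<Longrightarrow> convolution D w (\<lambda>x. q x ^ m * f x) = of_nat m * w (\<lambda>y. q y ^ (m - 1) * (\<kappa> y * f y))"
    using killsD[OF k] by (simp add: convolution_sl2_power[OF D w q _ \<kappa>] regular_partial(2)[OF sl2_dual[OF D]])
qed

text \<open>
  A functional \<open>u\<close> killed by \<open>q\<^sup>m\<^sup>+\<^sup>1\<close> is modified to one killed by \<open>q\<^sup>m\<close> by subtracting
  \<open>D\<^sup>m w\<close> for a suitable \<open>w\<close> killed by \<open>q\<close>. As \<open>(D\<^sup>m w)(q\<^sup>m f) = m! w(\<kappa>\<^sup>m f)\<close>, one takes
  \<open>w(f) = u(q\<^sup>m \<kappa>\<^sup>(\<^sup>p\<^sup>-\<^sup>1\<^sup>)\<^sup>m f) / m!\<close>.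
\<close>

lemma peel:
  fixes P :: "'k::field functional set" and S :: "nat \<Rightarrow> 'k functional set"
  assumes p: "prime CHAR('k)" and D: "D \<in> sl2" and q: "q \<in> regular"
    and \<kappa>: "\<And>y. D (\<lambda>x. q (x * y)) = \<kappa> y"
    and P_dual: "P \<subseteq> dual"
    and P_minus: "\<And>u v. u \<in> P \<Longrightarrow> v \<in> P \<Longrightarrow> (\<lambda>f. u f - v f) \<in> P"
    and P_fn: "\<And>u h. u \<in> P \<Longrightarrow> h \<in> regular \<Longrightarrow> fn_act h u \<in> P"
    and P_D: "\<And>u. u \<in> P \<Longrightarrow> convolution D u \<in> P"
    and P_\<kappa>: "\<And>u f. u \<in> P \<Longrightarrow> f \<in> regular \<Longrightarrow> u (\<lambda>x. \<kappa> x ^ CHAR('k) * f x) = u f"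
    and S_0: "(\<lambda>_. 0) \<in> S 0"
    and S_plus: "\<And>u v n. u \<in> S n \<Longrightarrow> v \<in> S n \<Longrightarrow> (\<lambda>f. u f + v f) \<in> S n"
    and S_Suc: "\<And>u n. u \<in> S n \<Longrightarrow> u \<in> S (Suc n)"
    and S_D: "\<And>u n. u \<in> S n \<Longrightarrow> convolution D u \<in> S (Suc n)"
    and S_1: "\<And>u. u \<in> P \<Longrightarrow> kills u q \<Longrightarrow> u \<in> S 1"
    and "u \<in> P" "kills u (\<lambda>x. q x ^ m)" "m \<le> CHAR('k)"
  shows "u \<in> S m"
  using assms(15-17)
proof (induction m arbitrary: u)
  case 0
  then have "u = (\<lambda>_. 0)"
    using P_dual by (intro dual_eqI[OF _ dual_0]) (auto simp: kills_def)
  then show ?case using S_0 by simp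
next
  case (Suc m)
  have \<kappa>_reg: "\<kappa> \<in> regular"
    using regular_partial(2)[OF sl2_dual[OF D] q] \<kappa> by simp
  \<comment> \<open>The factorial is invertible because \<open>m < p\<close>.\<close>
  define c where "c = inverse (of_nat (fact m) :: 'k)"
  have "\<not> CHAR('k) dvd fact m"
    using Suc(4) p by (simp add: prime_dvd_fact_iff)
  then have c: "of_nat (fact m) * c = 1"
    unfolding c_def using of_nat_eq_0_iff_char_dvd[of "fact m", where 'a = 'k] by simp
  define \<psi> where "\<psi> = (\<lambda>x. q x ^ m * (c * \<kappa> x ^ ((CHAR('k) - 1) * m)))"
  have \<psi>: "\<psi> \<in> regular" unfolding \<psi>_def by (intro regular_intros q \<kappa>_reg)
  define w where "w j = (convolution D ^^ j) (fn_act \<psi> u)" for j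
  \<comment> \<open>\<open>w 0\<close> is killed by \<open>q\<close> because \<open>u\<close> is
    killed by \<open>q ^ (m + 1)\<close>. Each further convolution with \<open>D\<close> raises the
    killed power by one and contributes one factor \<open>\<kappa>\<close> and the factor
    \<open>j + 1\<close>.\<close>
  have w: "w j \<in> P \<and> w j \<in> S (Suc j) \<and> kills (w j) (\<lambda>x. q x ^ Suc j) \<and>
    (\<forall>f\<in>regular. w j (\<lambda>x. q x ^ j * f x) = of_nat (fact j) * w 0 (\<lambda>x. \<kappa> x ^ j * f x))" for j
  proof (induction j)
    case 0
    have k: "kills (w 0) q"
    proof -
      have "u (\<lambda>x. q x ^ Suc m * (c * \<kappa> x ^ ((CHAR('k) - 1) * m) * f x)) = 0" if "f \<in> regular" for f
        by (rule killsD[OF Suc(3)]) (intro regular_intros \<kappa>_reg that)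
      then show ?thesis
        by (simp add: kills_def w_def fn_act_def regular_intros q \<psi>_def algebra_simps)
    qed
    then show ?case using P_fn[OF Suc(2) \<psi>] S_1[of "w 0"] by (simp add: w_def)
  next
    case (Suc j)
    then have wj: "w j \<in> dual" using P_dual by blast
    have [simp]: "w (Suc j) = convolution D (w j)" by (simp add: w_def)
    note k = kills_convolution_sl2[OF D wj q \<kappa> Suc[THEN conjunct2, THEN conjunct2, THEN conjunct1]]
    have "convolution D (w j) (\<lambda>x. q x ^ Suc j * f x) = of_nat (fact (Suc j)) * w 0 (\<lambda>x. \<kappa> x ^ Suc j * f x)"
      if f: "f \<in> regular" for f
    proof -
      have "w j (\<lambda>y. q y ^ j * (\<kappa> y * f y)) = of_nat (fact j) * w 0 (\<lambda>x. \<kappa> x ^ j * (\<kappa> x * f x))"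
        by (rule Suc[THEN conjunct2, THEN conjunct2, THEN conjunct2, rule_format, OF regular.mult[OF \<kappa>_reg f]])
      then show ?thesis using k(2)[OF f] by (simp add: mult_ac) (simp add: algebra_simps)
    qed
    with k(1) show ?case
      using P_D[OF Suc[THEN conjunct1]] S_D[OF Suc[THEN conjunct2, THEN conjunct1]] by simp
  qed
  define v where "v = (\<lambda>f. u f - w m f)"
  have "kills v (\<lambda>x. q x ^ m)"
  proof -
    have "w m (\<lambda>x. q x ^ m * f x) = u (\<lambda>x. q x ^ m * f x)" if f: "f \<in> regular" for f
    proof -
      have "w m (\<lambda>x. q x ^ m * f x) = of_nat (fact m) * w 0 (\<lambda>x. \<kappa> x ^ m * f x)" using w f by blast
      also have "w 0 (\<lambda>x. \<kappa> x ^ m * f x) = u (\<lambda>x. \<psi> x * (\<kappa> x ^ m * f x))"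
        unfolding w_def using f \<kappa>_reg by (simp add: fn_act_def regular_intros)
      \<comment> \<open>The exponent \<open>(p - 1) m\<close> in \<open>\<psi>\<close> is chosen so
        that, together with the \<open>\<kappa> ^ m\<close> produced by the m-fold convolution, it
        gives a p-th power, which \<open>u\<close> ignores.\<close>
      also have "(\<lambda>x. \<psi> x * (\<kappa> x ^ m * f x)) =
        (\<lambda>x. c * ((\<kappa> x ^ m) ^ CHAR('k) * (q x ^ m * f x)))"
      proof
        fix x
        have "\<kappa> x ^ ((CHAR('k) - 1) * m) * \<kappa> x ^ m = (\<kappa> x ^ m) ^ CHAR('k)"
          using prime_gt_0_nat[OF p] by (cases "CHAR('k)") (simp_all add: ac_simps flip: power_mult power_add)
        then show "\<psi> x * (\<kappa> x ^ m * f x) = c * ((\<kappa> x ^ m) ^ CHAR('k) * (q x ^ m * f x))"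
          unfolding \<psi>_def by (simp add: mult_ac flip: \<open>_ = (\<kappa> x ^ m) ^ CHAR('k)\<close>)
      qed
      also have "u \<dots> = c * u (\<lambda>x. (\<kappa> x ^ m) ^ CHAR('k) * (q x ^ m * f x))"
        using Suc(2) P_dual f q \<kappa>_reg by (intro dual_scale) (auto intro!: regular_intros)
      also have "u (\<lambda>x. (\<kappa> x ^ m) ^ CHAR('k) * (q x ^ m * f x)) = u (\<lambda>x. q x ^ m * f x)"
      proof -
        have "u (\<lambda>x. (\<kappa> x ^ n) ^ CHAR('k) * h x) = u h" if "h \<in> regular" for h n
          using that
        proof (induction n arbitrary: h)
          case (Suc n)
          then show ?case
            using P_\<kappa>[OF \<open>u \<in> P\<close>, of "\<lambda>x. (\<kappa> x ^ n) ^ CHAR('k) * h x"] \<kappa>_reg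
            by (simp add: power_mult_distrib mult.assoc regular_intros)
        qed simp
        then show ?thesis using f q by (simp add: regular_intros)
      qed
      finally show ?thesis using c by (simp flip: mult.assoc)
    qed
    then show ?thesis by (simp add: kills_def v_def)
  qed
  moreover have "v \<in> P" unfolding v_def using P_minus[OF Suc(2) w[THEN conjunct1]] .
  ultimately have "v \<in> S m" using Suc(1)[of v] Suc(4) by simp
  from S_plus[OF S_Suc[OF this] w[THEN conjunct2, THEN conjunct1]]
  have "(\<lambda>f. v f + w m f) \<in> S (Suc m)" .
  then show ?case by (simp add: v_def)
qed

section \<open>Ideals and group algebras\<close>

lemma coord_ring_simps [simp]:
  "carrier coord_ring = regular" "f \<otimes>\<^bsub>coord_ring\<^esub> g = (\<lambda>x. f x * g x)"
  "f \<oplus>\<^bsub>coord_ring\<^esub> g = (\<lambda>x. f x + g x)" "\<zero>\<^bsub>coord_ring\<^esub> = (\<lambda>_. 0)" "\<one>\<^bsub>coord_ring\<^esub> = (\<lambda>_. 1)"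
  by (simp_all add: coord_ring_def)

lemma cring_coord_ring: "cring (coord_ring :: ('k::field SL2 \<Rightarrow> 'k) ring)"
proof (rule cringI)
  show "abelian_group (coord_ring :: ('k SL2 \<Rightarrow> 'k) ring)"
  proof (rule abelian_groupI)
    fix f :: "'k SL2 \<Rightarrow> 'k" assume "f \<in> carrier coord_ring"
    then show "\<exists>g\<in>carrier coord_ring. g \<oplus>\<^bsub>coord_ring\<^esub> f = \<zero>\<^bsub>coord_ring\<^esub>"
      by (intro bexI[of _ "\<lambda>x. - f x"]) (auto intro: regular_intros)
  qed (auto intro: regular_intros simp: algebra_simps)
  show "comm_monoid (coord_ring :: ('k SL2 \<Rightarrow> 'k) ring)"
    by (rule comm_monoidI) (auto intro: regular_intros simp: algebra_simps)
qed (auto simp: algebra_simps)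

lemma idealI_coord_ring:
  assumes "J \<subseteq> regular" "(\<lambda>_. 0) \<in> J" "\<And>f g. f \<in> J \<Longrightarrow> g \<in> J \<Longrightarrow> (\<lambda>x. f x + g x) \<in> J"
    and "\<And>f h. f \<in> J \<Longrightarrow> h \<in> regular \<Longrightarrow> (\<lambda>x. h x * f x) \<in> J"
  shows "ideal J (coord_ring :: ('k::field SL2 \<Rightarrow> 'k) ring)"
proof (rule idealI)
  interpret cring "coord_ring :: ('k SL2 \<Rightarrow> 'k) ring" by (rule cring_coord_ring)
  show "ring (coord_ring :: ('k SL2 \<Rightarrow> 'k) ring)" by (rule ring_axioms)
  show "subgroup J (add_monoid (coord_ring :: ('k SL2 \<Rightarrow> 'k) ring))"
  proof (rule group.subgroupI)
    show "group (add_monoid (coord_ring :: ('k SL2 \<Rightarrow> 'k) ring))" by (rule a_group)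
    fix f assume f: "f \<in> J"
    have "inv\<^bsub>add_monoid coord_ring\<^esub> f = (\<lambda>x. - f x)"
      using f assms(1) by (intro group.inv_equality a_group) (auto intro: regular_intros)
    then show "inv\<^bsub>add_monoid coord_ring\<^esub> f \<in> J"
      using assms(4)[OF f regular.const[of "-1"]] by simp
  qed (use assms in auto)
qed (use assms in \<open>auto simp: mult.commute\<close>)

lemma Idl_mult:
  assumes "S \<subseteq> regular" "f \<in> Idl\<^bsub>coord_ring\<^esub> S" "h \<in> regular"
  shows "(\<lambda>x. f x * h x) \<in> Idl\<^bsub>coord_ring\<^esub> (S :: ('k::field SL2 \<Rightarrow> 'k) set)"
proof -
  interpret cring "coord_ring :: ('k SL2 \<Rightarrow> 'k) ring" by (rule cring_coord_ring)
  show ?thesis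
    using ideal.I_r_closed[OF genideal_ideal, of S f h] assms by simp
qed

lemma Idl_incl: "S \<subseteq> regular \<Longrightarrow> f \<in> S \<Longrightarrow> f \<in> Idl\<^bsub>coord_ring\<^esub> (S :: ('k::field SL2 \<Rightarrow> 'k) set)"
  using ring.genideal_self[OF cring.axioms(1)[OF cring_coord_ring], of S] by auto

lemma Idl_regular: "S \<subseteq> regular \<Longrightarrow> Idl\<^bsub>coord_ring\<^esub> (S :: ('k::field SL2 \<Rightarrow> 'k) set) \<subseteq> regular"
  using ideal.Icarr[OF ring.genideal_ideal[OF cring.axioms(1)[OF cring_coord_ring], of S]] by auto

text \<open>The regular functions killed by \<open>u\<close> form an ideal, so minimality of the
  generated ideal applies.\<close>

lemma vanishes_on_Idl_iff:
  assumes u: "u \<in> dual" and S: "S \<subseteq> (regular :: ('k::field SL2 \<Rightarrow> 'k) set)"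
  shows "(\<forall>f \<in> Idl\<^bsub>coord_ring\<^esub> S. u f = 0) \<longleftrightarrow> (\<forall>q\<in>S. kills u q)"
proof
  assume "\<forall>f \<in> Idl\<^bsub>coord_ring\<^esub> S. u f = 0"
  then show "\<forall>q\<in>S. kills u q"
    using Idl_mult[OF S] Idl_incl[OF S] by (auto simp: kills_def)
next
  assume k: "\<forall>q\<in>S. kills u q"
  have "ideal {f \<in> regular. kills u f} coord_ring"
  proof (rule idealI_coord_ring)
    show "(\<lambda>x. 0) \<in> {f \<in> regular. kills u f}"
      by (simp add: kills_def regular_intros dual_zero[OF u])
    show "(\<lambda>x. h x * f x) \<in> {f \<in> regular. kills u f}" if "f \<in> {f \<in> regular. kills u f}" "h \<in> regular" for f h
      using that kills_mult[of u f h] by (auto simp: mult.commute intro: regular_intros)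
  qed (auto simp: kills_def regular_intros dual_add[OF u] algebra_simps)
  then have "Idl\<^bsub>coord_ring\<^esub> S \<subseteq> {f \<in> regular. kills u f}"
    using S k by (intro ring.genideal_minimal[OF cring.axioms(1)[OF cring_coord_ring]]) auto
  then show "\<forall>f \<in> Idl\<^bsub>coord_ring\<^esub> S. u f = 0"
    using killsD[of u _ "\<lambda>_. 1"] by (auto simp: regular_intros)
qed

lemma group_algebra_simps [simp]:
  "u \<otimes>\<^bsub>group_algebra I\<^esub> v = convolution u v" "u \<oplus>\<^bsub>group_algebra I\<^esub> v = (\<lambda>f. u f + v f)"
  "\<zero>\<^bsub>group_algebra I\<^esub> = (\<lambda>_. 0)" "\<one>\<^bsub>group_algebra I\<^esub> = scalar 1"
  by (simp_all add: group_algebra_def)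

lemma carrier_group_algebra: "carrier (group_algebra I) = {u \<in> dual. \<forall>f\<in>I. u f = 0}"
  by (simp add: group_algebra_def)

lemma group_algebra_a_inv:
  assumes u: "u \<in> carrier (group_algebra (I :: ('k::field SL2 \<Rightarrow> 'k) set))"
  shows "\<ominus>\<^bsub>group_algebra I\<^esub> u = (\<lambda>f. - u f)"
proof -
  have g: "abelian_group (group_algebra I)"
  proof (rule abelian_groupI)
    fix f assume "f \<in> carrier (group_algebra I)"
    then show "\<exists>g\<in>carrier (group_algebra I). g \<oplus>\<^bsub>group_algebra I\<^esub> f = \<zero>\<^bsub>group_algebra I\<^esub>"
      by (intro bexI[of _ "\<lambda>x. - f x"]) (auto simp: carrier_group_algebra dual_neg)
  qed (auto simp: carrier_group_algebra dual_plus dual_0 algebra_simps)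
  have "(\<lambda>f. - u f) \<in> carrier (group_algebra I)"
    using u by (auto simp: carrier_group_algebra dual_neg)
  then show ?thesis
    using u by (intro abelian_group.minus_equality[OF g]) auto
qed

lemma SL2_1_generators_regular:
  "vanishing UNIV \<union> {\<lambda>x. f x ^ (CHAR('k) ^ n) |f. f \<in> regular \<and> f 1 = 0}
    \<subseteq> (regular :: ('k::field SL2 \<Rightarrow> 'k) set)"
  by (auto simp: vanishing_def intro: regular_intros)

text \<open>\<open>vanishing UNIV\<close> contributes only 0, so \<open>SL2_1\<close> is generated
  by the p-th powers of the functions vanishing at 1, and \<open>frob_dist_1_iff\<close>
  applies.\<close>

lemma carrier_group_algebra_SL2_1:
  assumes p: "prime CHAR('k::field)"
  shows "carrier (group_algebra SL2_1) = (frob_dist 1 :: 'k functional set)"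
proof -
  have "(\<forall>f\<in>SL2_1. u f = 0) \<longleftrightarrow> (\<forall>f\<in>regular. f 1 = 0 \<longrightarrow> kills u (\<lambda>x. f x ^ CHAR('k)))"
    if u: "u \<in> dual" for u :: "'k functional"
  proof -
    have "kills u q" if "q \<in> vanishing UNIV" for q
    proof -
      have "q = (\<lambda>_. 0)" using that by (auto simp: vanishing_def)
      then show ?thesis by (simp add: kills_def dual_zero[OF u])
    qed
    then show ?thesis
      unfolding SL2_1_def frobenius_kernel_def vanishes_on_Idl_iff[OF u SL2_1_generators_regular]
      by auto
  qed
  then show ?thesis
    using frob_dist_1_iff[OF p] by (auto simp: carrier_group_algebra)
qed

lemma SL2_1_regular: "(SL2_1 :: ('k::field SL2 \<Rightarrow> 'k) set) \<subseteq> regular"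
  unfolding SL2_1_def frobenius_kernel_def by (rule Idl_regular[OF SL2_1_generators_regular])

lemma SL2_1_power:
  "f \<in> regular \<Longrightarrow> f 1 = 0 \<Longrightarrow> (\<lambda>x. f x ^ CHAR('k)) \<in> (SL2_1 :: ('k::field SL2 \<Rightarrow> 'k) set)"
  unfolding SL2_1_def frobenius_kernel_def
  by (rule Idl_incl[OF SL2_1_generators_regular]) auto

lemma SL2_1_mult:
  "f \<in> SL2_1 \<Longrightarrow> h \<in> regular \<Longrightarrow> (\<lambda>x. f x * h x) \<in> (SL2_1 :: ('k::field SL2 \<Rightarrow> 'k) set)"
  unfolding SL2_1_def frobenius_kernel_def
  by (rule Idl_mult[OF SL2_1_generators_regular])

lemma frob_dist_1_SL2_1:
  assumes p: "prime CHAR('k::field)" and "u \<in> frob_dist 1" "f \<in> SL2_1"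
  shows "u (f :: 'k SL2 \<Rightarrow> 'k) = 0"
  using assms(2,3) unfolding carrier_group_algebra_SL2_1[OF p, symmetric]
  by (simp add: carrier_group_algebra)

text \<open>The factor \<open>(x_11 - 1) ^ (p m)\<close> uses up all but the last p of the exponent
  \<open>p (m + 1)\<close>.\<close>

lemma frob_dist_Suc_peel:
  assumes "u \<in> frob_dist (Suc m)"
  shows "fn_act (\<lambda>x. (entry 1 1 x - 1) ^ (CHAR('k) * m)) u \<in> (frob_dist 1 :: 'k::field functional set)"
proof -
  have "(entry 1 1 x - 1) ^ (CHAR('k) * m) * ((entry 1 1 x - 1) ^ CHAR('k) * f x) =
    (entry 1 1 x - 1) ^ (CHAR('k) * Suc m) * f x" for x :: "'k SL2" and f :: "'k SL2 \<Rightarrow> 'k"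
    by (simp add: power_add)
  note * = this
  show ?thesis
    using assms
    by (simp add: frob_dist_def kills_fn_act fn_act_dual regular_intros)
      (auto simp: kills_def fn_act_def regular_intros *)
qed

text \<open>The l-fold iterate is the ideal power with exponent \<open>l + 1\<close>. In the step to
  \<open>l + 1\<close>, the functional \<open>(x_11 - 1) ^ (p (l + 1))\<close> times
  \<open>u\<close> lies in \<open>frob_dist 1\<close> and vanishes on multiples of any
  \<open>i\<close> in the ideal; hence \<open>fn_act i u\<close> has order one less than
  \<open>u\<close>.\<close>

lemma frob_dist_vanishes_on_power:
  assumes p: "prime CHAR('k::field)" and "u \<in> frob_dist (Suc l)"
    and "f \<in> (ideal_prod coord_ring SL2_1 ^^ l) SL2_1"
  shows "f \<in> regular \<and> u (f :: 'k SL2 \<Rightarrow> 'k) = 0"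
  using assms(2,3)
proof (induction l arbitrary: u f)
  case 0
  then show ?case using frob_dist_1_SL2_1[OF p] SL2_1_regular by auto
next
  case (Suc l)
  from Suc(3) have "f \<in> ideal_prod coord_ring SL2_1 ((ideal_prod coord_ring SL2_1 ^^ l) SL2_1)"
    by simp
  then show ?case
  proof induction
    case (prod i j)
    have i: "i \<in> regular" using prod SL2_1_regular by auto
    have "fn_act i u \<in> frob_dist (Suc l)"
    proof -
      have "kills (fn_act i u) (\<lambda>x. (entry 1 1 x - 1) ^ (CHAR('k) * Suc l))"
        unfolding kills_def
      proof
        fix h :: "'k SL2 \<Rightarrow> 'k" assume h: "h \<in> regular"
        have "fn_act (\<lambda>x. (entry 1 1 x - 1) ^ (CHAR('k) * Suc l)) u (\<lambda>x. i x * h x) = 0"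
          by (rule frob_dist_1_SL2_1[OF p frob_dist_Suc_peel[OF Suc(2)] SL2_1_mult[OF prod(1) h]])
        then show "fn_act i u (\<lambda>x. (entry 1 1 x - 1) ^ (CHAR('k) * Suc l) * h x) = 0"
          using i h by (simp add: fn_act_def regular_intros mult.left_commute del: mult_Suc_right)
      qed
      then show ?thesis using Suc(2) frob_dist_fn_act[OF Suc(2) i] by (simp add: frob_dist_def)
    qed
    from Suc.IH[OF this prod(2)] show ?case
      using i by (auto simp: fn_act_def intro!: regular.mult split: if_splits)
  next
    case (sum f g)
    then show ?case using dual_add[OF frob_dist_dual[OF Suc(2)]] by (simp add: regular_intros)
  qed
qed

lemma power_in_SL2_1_power:
  assumes "h \<in> regular"
  shows "(\<lambda>x. (entry 1 1 x - 1) ^ (CHAR('k) * Suc l) * h x) \<in>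
    (ideal_prod coord_ring SL2_1 ^^ l) (SL2_1 :: ('k::field SL2 \<Rightarrow> 'k) set)"
proof (induction l)
  case 0
  then show ?case
    using SL2_1_mult[OF SL2_1_power[of "\<lambda>x. entry 1 1 x - 1"] assms] by (simp add: regular_intros)
next
  case (Suc l)
  have "(\<lambda>x. (entry 1 1 x - 1) ^ CHAR('k)) \<in> (SL2_1 :: ('k SL2 \<Rightarrow> 'k) set)"
    by (rule SL2_1_power) (auto intro: regular_intros)
  from ideal_prod.prod[OF this Suc, of coord_ring] show ?case
    by (simp add: mult.assoc power_add)
qed

text \<open>The conditions on the off-diagonal entries come from \<open>frob_dist n\<close>;
  multiples of \<open>(x_11 - 1) ^ (p (l + 1))\<close> lie in the ideal power and supply the
  remaining one. The converse is \<open>frob_dist_vanishes_on_power\<close>.\<close>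

lemma filtration_bimodule_eq:
  assumes p: "prime CHAR('k::field)" and I: "carrier (group_algebra I) = (frob_dist n :: 'k functional set)"
    and "Suc l \<le> n"
  shows "filtration_bimodule I SL2_1 l = frob_dist (Suc l)"
proof -
  have "u \<in> frob_dist (Suc l)"
    if u: "u \<in> frob_dist n" "\<forall>f\<in>(ideal_prod coord_ring SL2_1 ^^ l) SL2_1. u f = 0" for u :: "'k functional"
  proof -
    have "kills u (\<lambda>x. (entry 1 1 x - 1) ^ (CHAR('k) * Suc l))"
      unfolding kills_def using u(2) power_in_SL2_1_power by blast
    then show ?thesis using u(1) by (simp add: frob_dist_def)
  qed
  moreover have "u \<in> frob_dist n \<and> (\<forall>f\<in>(ideal_prod coord_ring SL2_1 ^^ l) SL2_1. u f = 0)"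
    if "u \<in> frob_dist (Suc l)" for u :: "'k functional"
    using frob_dist_mono[OF that \<open>Suc l \<le> n\<close>] frob_dist_vanishes_on_power[OF p that] by simp
  ultimately have "u \<in> frob_dist n \<and> (\<forall>f\<in>(ideal_prod coord_ring SL2_1 ^^ l) SL2_1. u f = 0) \<longleftrightarrow>
    u \<in> frob_dist (Suc l)" for u :: "'k functional"
    by metis
  then show ?thesis
    unfolding filtration_bimodule_def I by simp
qed

\<comment> \<open>keeps \<open>frob_dist 1\<close> in the form in which the rules about it are stated\<close>
declare One_nat_def [simp del]

section \<open>Taylor expansion along curves\<close>

text \<open>Over a finite field, one plus the product of all \<open>X - a\<close> has no root.
  Infinitely many points are what makes Taylor expansions unique below.\<close>

lemma infinite_alg_closed: "infinite (UNIV :: 'k::alg_closed_field set)"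
proof
  assume fin: "finite (UNIV :: 'k set)"
  define P :: "'k poly" where "P = (\<Prod>a\<in>UNIV. [:-a, 1:])"
  have deg: "degree P = card (UNIV :: 'k set)"
    unfolding P_def by (subst degree_prod_sum_eq) auto
  then have "degree (P + 1) = card (UNIV :: 'k set)"
    using fin by (subst degree_add_eq_left) (auto simp: card_gt_0_iff)
  then obtain x where "poly (P + 1) x = 0"
    using alg_closed_imp_poly_has_root[of "P + 1"] fin by (auto simp: card_gt_0_iff)
  moreover have "poly P x = 0"
    unfolding P_def poly_prod using fin by (auto intro!: bexI[of _ x])
  ultimately show False by simp
qed

text \<open>Along the curve \<open>f\<close> may have a pole at \<open>y = -1\<close>, as
  \<open>1/t\<close> has on the torus with \<open>t = 1 + y\<close>. Up to a power of
  \<open>1 + y\<close> it is a polynomial, and \<open>F\<close> is the expansion of the quotient at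
  \<open>y = 0\<close>.\<close>

definition expands :: "('k::alg_closed_field \<Rightarrow> 'k SL2) \<Rightarrow> ('k SL2 \<Rightarrow> 'k) \<Rightarrow> 'k fps \<Rightarrow> bool" where
  "expands \<gamma> f F \<longleftrightarrow> (\<exists>n P. (\<forall>y. y \<noteq> -1 \<longrightarrow> f (\<gamma> y) * (1 + y) ^ n = poly P y) \<and>
     F * (1 + fps_X) ^ n = fps_of_poly P)"

lemma fps_of_poly_one_plus_X: "fps_of_poly [:1, 1:] = (1 + fps_X :: 'k::field fps)"
  by (simp add: fps_of_poly_pCons)

text \<open>After clearing denominators two polynomials agree at all \<open>y\<close> other than -1,
  hence coincide; then powers of \<open>1 + fps_X\<close> are cancelled.\<close>

lemma expands_unique:
  assumes "expands \<gamma> f F" "expands \<gamma> f G"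
  shows "F = G"
proof -
  obtain n P where P: "\<And>y. y \<noteq> -1 \<Longrightarrow> f (\<gamma> y) * (1 + y) ^ n = poly P y"
    "F * (1 + fps_X) ^ n = fps_of_poly P"
    using assms(1) unfolding expands_def by blast
  obtain m Q where Q: "\<And>y. y \<noteq> -1 \<Longrightarrow> f (\<gamma> y) * (1 + y) ^ m = poly Q y"
    "G * (1 + fps_X) ^ m = fps_of_poly Q"
    using assms(2) unfolding expands_def by blast
  have eq: "P * [:1, 1:] ^ m = Q * [:1, 1:] ^ n"
  proof (rule ccontr)
    define R where "R = P * [:1, 1:] ^ m - Q * [:1, 1:] ^ n"
    assume "\<not> ?thesis"
    then have "finite {y. poly R y = 0}"
      by (intro poly_roots_finite) (simp add: R_def)
    moreover have "UNIV - {-1} \<subseteq> {y. poly R y = 0}"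
    proof clarify
      fix y :: 'a assume "y \<noteq> -1"
      then show "poly R y = 0"
        by (simp add: R_def flip: P(1) Q(1))
    qed
    ultimately show False
      using infinite_alg_closed by (metis finite_Diff2 finite.emptyI finite.insertI finite_subset)
  qed
  have "fps_nth (1 + fps_X :: 'a fps) 0 \<noteq> 0" by simp
  then have nz: "(1 + fps_X :: 'a fps) \<noteq> 0" by fastforce
  have "F * (1 + fps_X) ^ (n + m) = fps_of_poly (P * [:1, 1:] ^ m)"
    by (simp add: P(2)[symmetric] fps_of_poly_mult fps_of_poly_power fps_of_poly_one_plus_X
        power_add mult_ac)
  also have "\<dots> = G * (1 + fps_X) ^ (n + m)"
    by (simp add: eq Q(2)[symmetric] fps_of_poly_mult fps_of_poly_power fps_of_poly_one_plus_X
        power_add mult_ac)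
  finally show ?thesis
    using nz by simp
qed

lemma expands_const: "expands \<gamma> (\<lambda>_. c) (fps_const c)"
  unfolding expands_def by (intro exI[of _ 0] exI[of _ "[:c:]"]) simp

lemma expands_X: "(\<And>y. y \<noteq> -1 \<Longrightarrow> f (\<gamma> y) = y) \<Longrightarrow> expands \<gamma> f fps_X"
  unfolding expands_def
  by (intro exI[of _ 0] exI[of _ "[:0, 1:]"]) (simp add: fps_of_poly_pCons)

lemma expands_inverse:
  "(\<And>y. y \<noteq> -1 \<Longrightarrow> f (\<gamma> y) = 1 / (1 + y)) \<Longrightarrow> expands \<gamma> f (inverse (1 + fps_X))"
  unfolding expands_def
  by (intro exI[of _ 1] exI[of _ "1"])
    (auto simp: add_eq_0_iff inverse_mult_eq_1)

lemma expands_mult: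
  assumes "expands \<gamma> f F" "expands \<gamma> g G"
  shows "expands \<gamma> (\<lambda>x. f x * g x) (F * G)"
proof -
  obtain n P where P: "\<And>y. y \<noteq> -1 \<Longrightarrow> f (\<gamma> y) * (1 + y) ^ n = poly P y"
    "F * (1 + fps_X) ^ n = fps_of_poly P"
    using assms(1) unfolding expands_def by blast
  obtain m Q where Q: "\<And>y. y \<noteq> -1 \<Longrightarrow> g (\<gamma> y) * (1 + y) ^ m = poly Q y"
    "G * (1 + fps_X) ^ m = fps_of_poly Q"
    using assms(2) unfolding expands_def by blast
  show ?thesis unfolding expands_def
    by (intro exI[of _ "n + m"] exI[of _ "P * Q"])
      (simp add: fps_of_poly_mult power_add mult_ac flip: P Q)
qed

lemma expands_add:
  assumes "expands \<gamma> f F" "expands \<gamma> g G"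
  shows "expands \<gamma> (\<lambda>x. f x + g x) (F + G)"
proof -
  obtain n P where P: "\<And>y. y \<noteq> -1 \<Longrightarrow> f (\<gamma> y) * (1 + y) ^ n = poly P y"
    "F * (1 + fps_X) ^ n = fps_of_poly P"
    using assms(1) unfolding expands_def by blast
  obtain m Q where Q: "\<And>y. y \<noteq> -1 \<Longrightarrow> g (\<gamma> y) * (1 + y) ^ m = poly Q y"
    "G * (1 + fps_X) ^ m = fps_of_poly Q"
    using assms(2) unfolding expands_def by blast
  show ?thesis unfolding expands_def
    by (intro exI[of _ "n + m"] exI[of _ "P * [:1, 1:] ^ m + Q * [:1, 1:] ^ n"])
      (simp add: fps_of_poly_mult fps_of_poly_add fps_of_poly_power fps_of_poly_one_plus_X
        power_add algebra_simps flip: P Q)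
qed

lemma expands_nth_0:
  assumes "expands \<gamma> f F" shows "fps_nth F 0 = f (\<gamma> 0)"
proof -
  obtain n P where P: "\<And>y. y \<noteq> -1 \<Longrightarrow> f (\<gamma> y) * (1 + y) ^ n = poly P y"
    "F * (1 + fps_X) ^ n = fps_of_poly P"
    using assms(1) unfolding expands_def by blast
  have "fps_nth F 0 = fps_nth (F * (1 + fps_X) ^ n) 0"
    by (simp add: fps_power_zeroth)
  then show ?thesis using P(1)[of 0] by (simp add: P(2) poly_0_coeff_0)
qed

definition curve :: "('k::alg_closed_field \<Rightarrow> 'k SL2) \<Rightarrow> bool" where
  "curve \<gamma> \<longleftrightarrow> (\<forall>i j. \<exists>F. expands \<gamma> (entry i j) F)"

definition taylor :: "('k::alg_closed_field \<Rightarrow> 'k SL2) \<Rightarrow> ('k SL2 \<Rightarrow> 'k) \<Rightarrow> 'k fps" where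
  "taylor \<gamma> f = (THE F. expands \<gamma> f F)"

lemma taylor_eqI: "expands \<gamma> f F \<Longrightarrow> taylor \<gamma> f = F"
  unfolding taylor_def using expands_unique by (intro the_equality) blast+

lemma expands_taylor:
  assumes "curve \<gamma>" "f \<in> regular"
  shows "expands \<gamma> f (taylor \<gamma> f)"
proof -
  have "\<exists>F. expands \<gamma> f F" using assms(2)
    by induction (use assms(1) in \<open>auto simp: curve_def intro: expands_const expands_add expands_mult\<close>)
  then show ?thesis using taylor_eqI by blast
qed

lemma taylor_const: "taylor \<gamma> (\<lambda>_. c) = fps_const c"
  by (rule taylor_eqI[OF expands_const])

context
  fixes \<gamma> :: "'k::alg_closed_field \<Rightarrow> 'k SL2"
  assumes \<gamma>: "curve \<gamma>"
begin

lemma taylor_add: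
  "f \<in> regular \<Longrightarrow> g \<in> regular \<Longrightarrow> taylor \<gamma> (\<lambda>x. f x + g x) = taylor \<gamma> f + taylor \<gamma> g"
  by (intro taylor_eqI expands_add expands_taylor \<gamma>)

lemma taylor_mult:
  "f \<in> regular \<Longrightarrow> g \<in> regular \<Longrightarrow> taylor \<gamma> (\<lambda>x. f x * g x) = taylor \<gamma> f * taylor \<gamma> g"
  by (intro taylor_eqI expands_mult expands_taylor \<gamma>)

lemma taylor_uminus: "f \<in> regular \<Longrightarrow> taylor \<gamma> (\<lambda>x. - f x) = - taylor \<gamma> f"
  using taylor_mult[of "\<lambda>_. -1" f]
  by (simp add: regular_intros taylor_const flip: fps_const_neg)

lemma taylor_diff:
  "f \<in> regular \<Longrightarrow> g \<in> regular \<Longrightarrow> taylor \<gamma> (\<lambda>x. f x - g x) = taylor \<gamma> f - taylor \<gamma> g"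
  using taylor_add[of f "\<lambda>x. - g x"] by (simp add: regular_intros taylor_uminus)

lemma taylor_power: "f \<in> regular \<Longrightarrow> taylor \<gamma> (\<lambda>x. f x ^ n) = taylor \<gamma> f ^ n"
  by (induction n) (simp_all add: taylor_const taylor_mult regular_intros)

lemma taylor_nth_0: "f \<in> regular \<Longrightarrow> fps_nth (taylor \<gamma> f) 0 = f (\<gamma> 0)"
  by (intro expands_nth_0 expands_taylor \<gamma>)

end

definition taylor_coeff :: "('k::alg_closed_field \<Rightarrow> 'k SL2) \<Rightarrow> nat \<Rightarrow> 'k functional" where
  "taylor_coeff \<gamma> n = (\<lambda>f. if f \<in> regular then fps_nth (taylor \<gamma> f) n else 0)"

lemma taylor_coeff_dual: "curve \<gamma> \<Longrightarrow> taylor_coeff \<gamma> n \<in> dual"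
  by (rule dualI)
    (simp_all add: taylor_coeff_def regular_intros taylor_add taylor_mult taylor_const)

text \<open>The coefficient of \<open>y\<close> in a product of series whose constant terms are
  \<open>f 1\<close> and \<open>g 1\<close> is the Leibniz rule at the identity.\<close>

lemma taylor_coeff_1_sl2:
  assumes "curve \<gamma>" "\<gamma> 0 = 1"
  shows "taylor_coeff \<gamma> 1 \<in> sl2"
  using taylor_coeff_dual[OF assms(1)]
  by (auto simp: sl2_def taylor_coeff_def regular_intros taylor_mult[OF assms(1)] fps_mult_nth
      atLeast0_atMost_Suc One_nat_def taylor_nth_0[OF assms(1)] assms(2))

section \<open>One-parameter curves through the identity and their tangent vectors\<close>

definition torus_curve :: "'k::alg_closed_field \<Rightarrow> 'k SL2" where
  "torus_curve y = mk_SL2 (1 + y) 0 0 (1 / (1 + y))"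

definition upper_curve :: "'k::alg_closed_field \<Rightarrow> 'k SL2" where
  "upper_curve y = mk_SL2 1 y 0 1"

definition lower_curve :: "'k::alg_closed_field \<Rightarrow> 'k SL2" where
  "lower_curve y = mk_SL2 1 0 y 1"

text \<open>At \<open>y = -1\<close> both diagonal arguments are 0, so \<open>mk_SL2\<close> falls
  back to the identity matrix there.\<close>

lemma entry_torus_curve:
  assumes "y \<noteq> -1"
  shows "entry 1 1 (torus_curve y) = 1 + y" "entry 1 2 (torus_curve y) = 0"
    "entry 2 1 (torus_curve y) = 0" "entry 2 2 (torus_curve y) = 1 / (1 + y)"
  unfolding torus_curve_def
  by (subst entry_mk_SL2; use assms in \<open>simp add: add_eq_0_iff\<close>)+

lemma entry_upper_curve:
  "entry 1 1 (upper_curve y) = 1" "entry 1 2 (upper_curve y) = y"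
  "entry 2 1 (upper_curve y) = 0" "entry 2 2 (upper_curve y) = 1"
  unfolding upper_curve_def by (subst entry_mk_SL2; simp)+

lemma entry_lower_curve:
  "entry 1 1 (lower_curve y) = 1" "entry 1 2 (lower_curve y) = 0"
  "entry 2 1 (lower_curve y) = y" "entry 2 2 (lower_curve y) = 1"
  unfolding lower_curve_def by (subst entry_mk_SL2; simp)+

lemma expands_cong:
  "expands \<gamma> f F \<Longrightarrow> (\<And>y. y \<noteq> -1 \<Longrightarrow> g (\<gamma> y) = f (\<gamma> y)) \<Longrightarrow> expands \<gamma> g F"
  unfolding expands_def by metis

lemma expands_torus_curve:
  "expands torus_curve (entry 1 1) (1 + fps_X)" "expands torus_curve (entry 1 2) 0"
  "expands torus_curve (entry 2 1) 0" "expands torus_curve (entry 2 2) (inverse (1 + fps_X))"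
proof -
  have "expands torus_curve (\<lambda>x. entry 1 1 x - 1) fps_X"
    by (rule expands_X) (simp add: entry_torus_curve)
  from expands_add[OF expands_const[of _ 1] this]
  show "expands torus_curve (entry 1 1) (1 + fps_X)" by simp
  show "expands torus_curve (entry 2 2) (inverse (1 + fps_X))"
    by (rule expands_inverse) (simp add: entry_torus_curve)
  show "expands torus_curve (entry 1 2) 0" "expands torus_curve (entry 2 1) 0"
    by (rule expands_cong[OF expands_const[of _ 0], simplified]; simp add: entry_torus_curve)+
qed

lemma expands_upper_curve:
  "expands upper_curve (entry 1 1) 1" "expands upper_curve (entry 1 2) fps_X"
  "expands upper_curve (entry 2 1) 0" "expands upper_curve (entry 2 2) 1"
proof -
  show "expands upper_curve (entry 1 2) fps_X"
    by (rule expands_X) (simp add: entry_upper_curve)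
  show "expands upper_curve (entry 2 1) 0"
    by (rule expands_cong[OF expands_const[of _ 0], simplified]) (simp add: entry_upper_curve)
  show "expands upper_curve (entry 1 1) 1" "expands upper_curve (entry 2 2) 1"
    by (rule expands_cong[OF expands_const[of _ 1], simplified]; simp add: entry_upper_curve)+
qed

lemma expands_lower_curve:
  "expands lower_curve (entry 1 1) 1" "expands lower_curve (entry 1 2) 0"
  "expands lower_curve (entry 2 1) fps_X" "expands lower_curve (entry 2 2) 1"
proof -
  show "expands lower_curve (entry 2 1) fps_X"
    by (rule expands_X) (simp add: entry_lower_curve)
  show "expands lower_curve (entry 1 2) 0"
    by (rule expands_cong[OF expands_const[of _ 0], simplified]) (simp add: entry_lower_curve)
  show "expands lower_curve (entry 1 1) 1" "expands lower_curve (entry 2 2) 1"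
    by (rule expands_cong[OF expands_const[of _ 1], simplified]; simp add: entry_lower_curve)+
qed

lemma curveI:
  assumes "\<exists>F. expands \<gamma> (entry 1 1) F" "\<exists>F. expands \<gamma> (entry 1 2) F"
    "\<exists>F. expands \<gamma> (entry 2 1) F" "\<exists>F. expands \<gamma> (entry 2 2) F"
  shows "curve \<gamma>"
  unfolding curve_def using assms by (metis index_2_cases)

lemma curve_torus_curve: "curve torus_curve"
  using expands_torus_curve by (intro curveI) blast+

lemma curve_upper_curve: "curve upper_curve"
  using expands_upper_curve by (intro curveI) blast+

lemma curve_lower_curve: "curve lower_curve"
  using expands_lower_curve by (intro curveI) blast+

lemma curves_0: "torus_curve 0 = 1" "upper_curve 0 = 1" "lower_curve 0 = 1"
proof -
  have "entry i j (torus_curve 0) = entry i j 1 \<and> entry i j (upper_curve 0) = entry i j 1 \<and>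
    entry i j (lower_curve 0) = entry i j 1" for i j
    by (cases i rule: index_2_cases; cases j rule: index_2_cases)
      (simp_all add: entry_torus_curve entry_upper_curve entry_lower_curve)
  then show "torus_curve 0 = 1" "upper_curve 0 = 1" "lower_curve 0 = 1"
    by (auto intro: SL2_eqI)
qed

text \<open>First-order coefficients along curves give the standard basis as functionals on all
  regular functions at once.\<close>

definition sl2_e :: "'k::alg_closed_field functional" where "sl2_e = taylor_coeff upper_curve 1"
definition sl2_f :: "'k::alg_closed_field functional" where "sl2_f = taylor_coeff lower_curve 1"
definition sl2_h :: "'k::alg_closed_field functional" where "sl2_h = taylor_coeff torus_curve 1"

lemma sl2_efh: "sl2_e \<in> sl2" "sl2_f \<in> sl2" "sl2_h \<in> sl2"
  unfolding sl2_e_def sl2_f_def sl2_h_def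
  by (intro taylor_coeff_1_sl2 curve_torus_curve curve_upper_curve curve_lower_curve curves_0)+

lemma sl2_e_entry: "sl2_e (entry 1 1) = 0" "sl2_e (entry 1 2) = 1" "sl2_e (entry 2 1) = 0" "sl2_e (entry 2 2) = 0"
  and sl2_f_entry: "sl2_f (entry 1 1) = 0" "sl2_f (entry 1 2) = 0" "sl2_f (entry 2 1) = 1" "sl2_f (entry 2 2) = 0"
  and sl2_h_entry: "sl2_h (entry 1 1) = 1" "sl2_h (entry 1 2) = 0" "sl2_h (entry 2 1) = 0"
  by (simp_all add: sl2_e_def sl2_f_def sl2_h_def taylor_coeff_def regular_intros
      taylor_eqI[OF expands_upper_curve(1)] taylor_eqI[OF expands_upper_curve(2)]
      taylor_eqI[OF expands_upper_curve(3)] taylor_eqI[OF expands_upper_curve(4)]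
      taylor_eqI[OF expands_lower_curve(1)] taylor_eqI[OF expands_lower_curve(2)]
      taylor_eqI[OF expands_lower_curve(3)] taylor_eqI[OF expands_lower_curve(4)]
      taylor_eqI[OF expands_torus_curve(1)] taylor_eqI[OF expands_torus_curve(2)]
      taylor_eqI[OF expands_torus_curve(3)])

section \<open>Divided powers of the torus\<close>

lemmas taylor_torus_simps =
  taylor_mult[OF curve_torus_curve] taylor_power[OF curve_torus_curve]
  taylor_diff[OF curve_torus_curve] taylor_nth_0[OF curve_torus_curve] taylor_const

text \<open>
  \<open>\<delta> i\<close> is the divided power \<open>h choose p i\<close>, i.e. the coefficient of \<open>(t - 1)\<^sup>p\<^sup>i\<close> in the expansion
  of a function on the torus.
\<close>

definition \<delta> :: "nat \<Rightarrow> 'k::alg_closed_field functional" where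
  "\<delta> i = taylor_coeff torus_curve (CHAR('k) * i)"

lemma \<delta>_dual: "\<delta> i \<in> dual"
  unfolding \<delta>_def by (rule taylor_coeff_dual[OF curve_torus_curve])

lemma taylor_torus_entry:
  "taylor torus_curve (entry 1 1) = 1 + fps_X" "taylor torus_curve (entry 1 2) = 0"
  "taylor torus_curve (entry 2 1) = 0" "taylor torus_curve (entry 2 2) = inverse (1 + fps_X)"
  by (intro taylor_eqI expands_torus_curve)+

lemma \<delta>_apply: "f \<in> regular \<Longrightarrow> \<delta> i (f :: 'k::alg_closed_field SL2 \<Rightarrow> 'k) = fps_nth (taylor torus_curve f) (CHAR('k) * i)"
  by (simp add: \<delta>_def taylor_coeff_def)

text \<open>\<open>x_11 - 1\<close> expands to the parameter itself, so its power shifts the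
  coefficient read by \<open>\<delta> i\<close> down to degree 0. This normalization is what lets
  \<open>\<delta> i\<close> remove the top order of a functional.\<close>

lemma \<delta>_power:
  assumes "f \<in> regular"
  shows "\<delta> i (\<lambda>x. (entry 1 1 x - 1) ^ (CHAR('k) * i) * f x) = f (1 :: 'k::alg_closed_field SL2)"
  using assms
  by (simp add: \<delta>_apply regular_intros taylor_torus_simps taylor_torus_entry fps_X_power_mult_nth curves_0)

lemma \<delta>_dist:
  assumes p: "prime CHAR('k::alg_closed_field)"
  shows "(\<delta> i :: 'k functional) \<in> frob_dist (Suc i)"
  using prime_gt_0_nat[OF p]
  by (auto simp: frob_dist_def \<delta>_dual kills_def \<delta>_apply regular_intros taylor_torus_simps
      taylor_torus_entry fps_X_power_mult_nth zero_power)

text \<open>Let \<open>s\<close> be \<open>u\<close> multiplied by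
  \<open>(x_11 - 1) ^ (p m)\<close>. By \<open>\<delta>_power\<close> and the collapse of p-th
  powers, the convolution of \<open>\<delta> m\<close> with \<open>s\<close> agrees with
  \<open>u\<close> on all multiples of that power, so the difference has order
  \<open>m\<close>.\<close>

lemma dist_eq_\<delta>_left:
  assumes p: "prime CHAR('k::alg_closed_field)" and u: "(u :: 'k functional) \<in> frob_dist m"
  shows "\<exists>s. (\<forall>i. s i \<in> frob_dist 1) \<and> u = (\<lambda>f. \<Sum>i<m. convolution (\<delta> i) (s i) f)"
  using u
proof (induction m arbitrary: u)
  case 0
  then have "u = (\<lambda>_. 0)"
    by (intro dual_eqI[OF _ dual_0]) (auto simp: frob_dist_def kills_def)
  then show ?case by (intro exI[of _ "\<lambda>_ _. 0"]) (simp add: frob_dist_zero)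
next
  case (Suc m)
  let ?q = "\<lambda>x :: 'k SL2. (entry 1 1 x - 1) ^ m"
  have q: "?q \<in> regular" by (intro regular_intros)
  define s where "s = fn_act (\<lambda>x. ?q x ^ CHAR('k)) u"
  have s: "s \<in> frob_dist 1"
    using frob_dist_Suc_peel[OF Suc(2)] by (simp add: s_def mult.commute flip: power_mult)
  define v where "v = (\<lambda>f. u f - convolution (\<delta> m) s f)"
  have "v \<in> frob_dist (Suc m)"
    unfolding v_def by (intro frob_dist_minus Suc frob_dist_convolution[OF p s] \<delta>_dist[OF p])
  moreover have "v (\<lambda>x. ?q x ^ CHAR('k) * f x) = 0" if f: "f \<in> regular" for f
  proof -
    have "convolution (\<delta> m) s (\<lambda>x. ?q x ^ CHAR('k) * f x) = \<delta> m (\<lambda>x. ?q x ^ CHAR('k) * s (\<lambda>y. f (x * y)))"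
      by (rule convolution_dist_1_right[OF p s q f])
    also have "\<dots> = s f"
      using \<delta>_power[OF regular_partial(1)[OF frob_dist_dual[OF s] f], of m]
      by (simp add: mult.commute flip: power_mult)
    finally show ?thesis using f by (simp add: v_def s_def fn_act_def)
  qed
  ultimately have "v \<in> frob_dist m"
    by (simp add: frob_dist_def kills_def mult.commute[of _ m] power_mult)
  from Suc.IH[OF this] obtain s' where
    s': "\<forall>i. s' i \<in> frob_dist 1" "v = (\<lambda>f. \<Sum>i<m. convolution (\<delta> i) (s' i) f)" by blast
  have "u = (\<lambda>f. v f + convolution (\<delta> m) s f)" by (simp add: v_def)
  then show ?case
    using s s' by (intro exI[of _ "s'(m := s)"]) auto
qed

text \<open>Mirror image, with the \<open>SL2_1\<close> factor on the left as in
  \<open>SL2_1_T\<close>. The previous order is the one suited to tensoring over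
  \<open>kSL(2)_1\<close>.\<close>

lemma dist_eq_\<delta>_right:
  assumes p: "prime CHAR('k::alg_closed_field)" and u: "(u :: 'k functional) \<in> frob_dist m"
  shows "\<exists>s. (\<forall>i. s i \<in> frob_dist 1) \<and> u = (\<lambda>f. \<Sum>i<m. convolution (s i) (\<delta> i) f)"
  using u
proof (induction m arbitrary: u)
  case 0
  then have "u = (\<lambda>_. 0)"
    by (intro dual_eqI[OF _ dual_0]) (auto simp: frob_dist_def kills_def)
  then show ?case by (intro exI[of _ "\<lambda>_ _. 0"]) (simp add: frob_dist_zero)
next
  case (Suc m)
  let ?q = "\<lambda>x :: 'k SL2. (entry 1 1 x - 1) ^ m"
  have q: "?q \<in> regular" by (intro regular_intros)
  define s where "s = fn_act (\<lambda>x. ?q x ^ CHAR('k)) u"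
  have s: "s \<in> frob_dist 1"
    using frob_dist_Suc_peel[OF Suc(2)] by (simp add: s_def mult.commute flip: power_mult)
  define v where "v = (\<lambda>f. u f - convolution s (\<delta> m) f)"
  have "v \<in> frob_dist (Suc m)"
    unfolding v_def by (intro frob_dist_minus Suc frob_dist_convolution[OF p s] \<delta>_dist[OF p])
  moreover have "v (\<lambda>x. ?q x ^ CHAR('k) * f x) = 0" if f: "f \<in> regular" for f
  proof -
    have "convolution s (\<delta> m) (\<lambda>x. ?q x ^ CHAR('k) * f x) = \<delta> m (\<lambda>y. ?q y ^ CHAR('k) * s (\<lambda>x. f (x * y)))"
      by (rule convolution_dist_1_left[OF p s \<delta>_dual q f])
    also have "\<dots> = s f"
      using \<delta>_power[OF regular_partial(2)[OF frob_dist_dual[OF s] f], of m]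
      by (simp add: mult.commute flip: power_mult)
    finally show ?thesis using f by (simp add: v_def s_def fn_act_def)
  qed
  ultimately have "v \<in> frob_dist m"
    by (simp add: frob_dist_def kills_def mult.commute[of _ m] power_mult)
  from Suc.IH[OF this] obtain s' where
    s': "\<forall>i. s' i \<in> frob_dist 1" "v = (\<lambda>f. \<Sum>i<m. convolution (s' i) (\<delta> i) f)" by blast
  have "u = (\<lambda>f. v f + convolution s (\<delta> m) f)" by (simp add: v_def)
  then show ?case
    using s s' by (intro exI[of _ "s'(m := s)"]) auto
qed

section \<open>The group algebra of $SL(2)_1T_r$\<close>

lemma T_frob_generators_regular:
  "vanishing torus \<union> {\<lambda>x. f x ^ (CHAR('k) ^ n) |f. f \<in> regular \<and> f 1 = 0}
    \<subseteq> (regular :: ('k::field SL2 \<Rightarrow> 'k) set)"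
  by (auto simp: vanishing_def intro: regular_intros)

lemma T_frob_mult:
  "f \<in> T_frob r \<Longrightarrow> h \<in> regular \<Longrightarrow> (\<lambda>x. f x * h x) \<in> (T_frob r :: ('k::field SL2 \<Rightarrow> 'k) set)"
  unfolding T_frob_def frobenius_kernel_def
  by (rule Idl_mult[OF T_frob_generators_regular])

text \<open>The series of a function vanishing at 1 is divisible by the parameter, so its
  \<open>p ^ r\<close>-th power starts beyond degree \<open>p i\<close>; a function vanishing on the
  torus has series 0.\<close>

lemma \<delta>_vanishes_on_T_frob:
  assumes p: "prime CHAR('k::alg_closed_field)" and i: "CHAR('k) * i < CHAR('k) ^ r"
    and f: "f \<in> T_frob r"
  shows "\<delta> i (f :: 'k SL2 \<Rightarrow> 'k) = 0"
proof -
  have "kills (\<delta> i) q" if "q \<in> vanishing torus \<union> {\<lambda>x. f x ^ (CHAR('k) ^ r) |f. f \<in> regular \<and> f 1 = 0}"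
    for q :: "'k SL2 \<Rightarrow> 'k"
    using that
  proof
    assume q: "q \<in> vanishing torus"
    have "torus_curve y \<in> torus" if "y \<noteq> -1" for y :: 'k
      using that by (simp add: torus_def entry_torus_curve)
    then have "expands torus_curve q 0"
      using q by (intro expands_cong[OF expands_const[of _ 0], simplified]) (auto simp: vanishing_def)
    then have "taylor torus_curve q = 0" by (rule taylor_eqI)
    then show "kills (\<delta> i) q"
      using q by (simp add: kills_def \<delta>_apply regular_intros taylor_mult[OF curve_torus_curve] vanishing_def)
  next
    assume "q \<in> {\<lambda>x. f x ^ (CHAR('k) ^ r) |f. f \<in> regular \<and> f 1 = 0}"
    then obtain f where q: "q = (\<lambda>x. f x ^ (CHAR('k) ^ r))" and f: "f \<in> regular" "f 1 = 0" by blast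
    define F where "F = taylor torus_curve f"
    have "fps_nth F 0 = 0"
      using f by (simp add: F_def taylor_nth_0[OF curve_torus_curve] curves_0)
    define G where "G = fps_shift 1 F"
    have G: "F = fps_X * G"
      unfolding G_def using \<open>fps_nth F 0 = 0\<close>
      by (intro fps_ext) (simp add: fps_X_mult_nth)
    show "kills (\<delta> i) q" unfolding kills_def q
    proof
      fix h :: "'k SL2 \<Rightarrow> 'k" assume h: "h \<in> regular"
      have "\<delta> i (\<lambda>x. f x ^ (CHAR('k) ^ r) * h x) =
        fps_nth (fps_X ^ (CHAR('k) ^ r) * (G ^ (CHAR('k) ^ r) * taylor torus_curve h)) (CHAR('k) * i)"
        using f h by (simp add: \<delta>_apply regular_intros taylor_mult[OF curve_torus_curve]
            taylor_power[OF curve_torus_curve] G power_mult_distrib mult.assoc flip: F_def)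
      then show "\<delta> i (\<lambda>x. f x ^ (CHAR('k) ^ r) * h x) = 0"
        using i by (simp add: fps_X_power_mult_nth)
    qed
  qed
  then show ?thesis
    using f vanishes_on_Idl_iff[OF \<delta>_dual[of i] T_frob_generators_regular[of r]]
    unfolding T_frob_def frobenius_kernel_def by blast
qed

lemma SL2_1_T_ideal:
  fixes f h :: "'k::field SL2 \<Rightarrow> 'k"
  assumes "f \<in> regular" "(\<lambda>x y. f (x * y)) \<in> biregular SL2_1 (T_frob r)" "h \<in> regular"
  shows "(\<lambda>x. f x * h x) \<in> SL2_1_T r"
proof -
  have "(\<lambda>x y. h (x * y) * f (x * y)) \<in> biregular SL2_1 (T_frob r)"
    by (rule biregular_mult[OF biregular_comult[OF assms(3)] assms(2)])
      (simp_all add: mult.commute[of "_ :: 'k"] SL2_1_mult T_frob_mult)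
  then show ?thesis
    using assms(1,3) unfolding SL2_1_T_def product_scheme_def biregular_iff
    by (simp add: regular_intros mult.commute)
qed

text \<open>For one inclusion, additivity of p-th powers puts the comultiplied defining equations
  into the ideal of the product. For the other, \<open>u\<close> is a sum of convolutions of some
  \<open>s i\<close>, which vanishes on \<open>SL2_1\<close>, with \<open>\<delta> i\<close>, which
  vanishes on \<open>T_frob r\<close>.\<close>

lemma carrier_group_algebra_SL2_1_T:
  assumes p: "prime CHAR('k::alg_closed_field)" and r: "r \<ge> 1"
  shows "carrier (group_algebra (SL2_1_T r)) = (frob_dist (CHAR('k) ^ (r - 1)) :: 'k functional set)"
proof (rule Set.set_eqI, rule iffI)
  fix u :: "'k functional" assume u: "u \<in> carrier (group_algebra (SL2_1_T r))"
  have power: "CHAR('k) * CHAR('k) ^ (r - 1) = CHAR('k) ^ r"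
    using r by (cases r) simp_all
  have v: "f \<in> vanishing torus \<Longrightarrow> f \<in> T_frob r" for f :: "'k SL2 \<Rightarrow> 'k"
    unfolding T_frob_def frobenius_kernel_def by (rule Idl_incl[OF T_frob_generators_regular]) auto
  have w: "f \<in> regular \<Longrightarrow> f 1 = 0 \<Longrightarrow> (\<lambda>x. f x ^ (CHAR('k) ^ r)) \<in> T_frob r" for f :: "'k SL2 \<Rightarrow> 'k"
    unfolding T_frob_def frobenius_kernel_def by (rule Idl_incl[OF T_frob_generators_regular]) auto
  have p0: "CHAR('k) > 0" using p by (simp add: prime_gt_0_nat)
  have T_12: "(\<lambda>x :: 'k SL2. entry 1 2 x ^ CHAR('k)) \<in> T_frob r"
    using p0 by (intro v) (auto simp: vanishing_def torus_def intro: regular_intros)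
  have T_21: "(\<lambda>x :: 'k SL2. entry 2 1 x ^ CHAR('k)) \<in> T_frob r"
    using p0 by (intro v) (auto simp: vanishing_def torus_def intro: regular_intros)
  have N_12: "(\<lambda>x :: 'k SL2. entry 1 2 x ^ CHAR('k)) \<in> SL2_1"
    and N_21: "(\<lambda>x :: 'k SL2. entry 2 1 x ^ CHAR('k)) \<in> SL2_1"
    by (intro SL2_1_power regular.entry entry_1)+
  have N_11: "(\<lambda>x :: 'k SL2. (entry 1 1 x - 1) ^ (CHAR('k) ^ r)) \<in> SL2_1"
  proof -
    have "(\<lambda>x :: 'k SL2. ((entry 1 1 x - 1) ^ (CHAR('k) ^ (r - 1))) ^ CHAR('k)) \<in> SL2_1"
      using p0 by (intro SL2_1_power regular_intros) auto
    then show ?thesis by (simp add: mult.commute power flip: power_mult)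
  qed
  have b12: "(\<lambda>x y :: 'k SL2. entry 1 2 (x * y) ^ CHAR('k)) \<in> biregular SL2_1 (T_frob r)"
  proof -
    have "(\<lambda>x y :: 'k SL2. entry 1 1 x ^ CHAR('k) * entry 1 2 y ^ CHAR('k) +
      entry 1 2 x ^ CHAR('k) * entry 2 2 y ^ CHAR('k)) \<in> biregular SL2_1 (T_frob r)"
      by (intro biregular_add biregular_single regular_intros disjI1[OF N_12] disjI2[OF T_12])
    then show ?thesis by (simp add: entry_mult freshmans_dream[OF p refl] power_mult_distrib)
  qed
  have b21: "(\<lambda>x y :: 'k SL2. entry 2 1 (x * y) ^ CHAR('k)) \<in> biregular SL2_1 (T_frob r)"
  proof -
    have "(\<lambda>x y :: 'k SL2. entry 2 1 x ^ CHAR('k) * entry 1 1 y ^ CHAR('k) +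
      entry 2 2 x ^ CHAR('k) * entry 2 1 y ^ CHAR('k)) \<in> biregular SL2_1 (T_frob r)"
      by (intro biregular_add biregular_single regular_intros disjI1[OF N_21] disjI2[OF T_21])
    then show ?thesis by (simp add: entry_mult freshmans_dream[OF p refl] power_mult_distrib)
  qed
  have b11: "(\<lambda>x y :: 'k SL2. (entry 1 1 (x * y) - 1) ^ (CHAR('k) ^ r)) \<in> biregular SL2_1 (T_frob r)"
  proof -
    have T: "(\<lambda>y :: 'k SL2. (entry 1 1 y - 1) ^ (CHAR('k) ^ r)) \<in> T_frob r"
      by (intro w regular_intros) simp
    have N: "(\<lambda>x :: 'k SL2. entry 1 2 x ^ (CHAR('k) ^ r)) \<in> SL2_1"
    proof -
      have "(\<lambda>x :: 'k SL2. (entry 1 2 x ^ (CHAR('k) ^ (r - 1))) ^ CHAR('k)) \<in> SL2_1"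
        using p0 by (intro SL2_1_power regular_intros) auto
      then show ?thesis by (simp add: mult.commute power flip: power_mult)
    qed
    have "(\<lambda>x y :: 'k SL2. ((entry 1 1 x - 1) ^ (CHAR('k) ^ r) * entry 1 1 y ^ (CHAR('k) ^ r) +
      entry 1 2 x ^ (CHAR('k) ^ r) * entry 2 1 y ^ (CHAR('k) ^ r)) +
      1 * (entry 1 1 y - 1) ^ (CHAR('k) ^ r)) \<in> biregular SL2_1 (T_frob r)"
      by (intro biregular_add biregular_single regular_intros disjI1[OF N_11] disjI1[OF N] disjI2[OF T])
    \<comment> \<open>Grouped so that every summand has a factor whose \<open>p ^ r\<close>-th power
      lies in one of the two ideals.\<close>
    moreover have "entry 1 1 (x * y) - 1 = ((entry 1 1 x - 1) * entry 1 1 y + entry 1 2 x * entry 2 1 y) +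
      (entry 1 1 y - 1)" for x y :: "'k SL2"
      by (simp add: entry_mult algebra_simps)
    ultimately show ?thesis
      by (simp only: freshmans_dream'[OF p refl] power_mult_distrib mult_1_left)
  qed
  have "u \<in> dual" and u0: "f \<in> SL2_1_T r \<Longrightarrow> u f = 0" for f
    using u by (auto simp: carrier_group_algebra)
  then show "u \<in> frob_dist (CHAR('k) ^ (r - 1))"
    unfolding frob_dist_def power kills_def
    by (auto intro!: u0 SL2_1_T_ideal b12 b21 b11 regular_intros)
next
  fix u :: "'k functional" assume u: "u \<in> frob_dist (CHAR('k) ^ (r - 1))"
  from dist_eq_\<delta>_right[OF p u] obtain s where s: "\<And>i. s i \<in> frob_dist 1"
    "u = (\<lambda>f. \<Sum>i<CHAR('k) ^ (r - 1). convolution (s i) (\<delta> i) f)" by blast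
  have "convolution (s i) (\<delta> i) f = 0" if f: "f \<in> SL2_1_T r" and i: "i < CHAR('k) ^ (r - 1)" for f i
  proof -
    have fr: "f \<in> regular" and b: "(\<lambda>x y. f (x * y)) \<in> biregular SL2_1 (T_frob r)"
      using f unfolding SL2_1_T_def product_scheme_def biregular_iff by auto
    have i': "CHAR('k) * i < CHAR('k) ^ r"
      using i r prime_gt_0_nat[OF p] by (cases r) simp_all
    have d: "s i \<in> dual" using s(1) by (rule frob_dist_dual)
    have "s i (\<lambda>x. \<delta> i (\<lambda>y. F x y)) = 0" if "F \<in> biregular SL2_1 (T_frob r)" for F
      using that
    proof induction
      case zero
      then show ?case by (simp add: dual_zero[OF \<delta>_dual] dual_zero[OF d])
    next
      case (step F \<phi> \<psi>)
      note r = biregular_dual[OF step(1) \<delta>_dual \<delta>_dual]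
      have "\<delta> i (\<lambda>y. F x y + \<phi> x * \<psi> y) = \<delta> i (F x) + \<delta> i \<psi> * \<phi> x" for x
        using step r(1) by (simp add: dual_add[OF \<delta>_dual] dual_scale[OF \<delta>_dual] regular_intros)
      then have "s i (\<lambda>x. \<delta> i (\<lambda>y. F x y + \<phi> x * \<psi> y)) = s i (\<lambda>x. \<delta> i (F x)) + \<delta> i \<psi> * s i \<phi>"
        using step r(3)
        by (simp add: dual_add[OF d] dual_scale[OF d] regular_intros)
      moreover have "\<delta> i \<psi> = 0 \<or> s i \<phi> = 0"
        using step(4) \<delta>_vanishes_on_T_frob[OF p i'] frob_dist_1_SL2_1[OF p s(1)] by blast
      ultimately show ?case using step by auto
    qed
    from this[OF b] show ?thesis using fr by (simp add: convolution_apply)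
  qed
  then show "u \<in> carrier (group_algebra (SL2_1_T r))"
    using frob_dist_dual[OF u] by (simp add: carrier_group_algebra s(2))
qed

section \<open>A basis of the restricted enveloping algebra\<close>

text \<open>The group algebra of the first Frobenius kernel of \<open>B\<close>, as
  \<open>x_21\<close> is the equation of \<open>B\<close>; \<open>torus_dist\<close> plays the same
  role for \<open>T\<close>.\<close>

definition borel_dist :: "'k::field functional set" where
  "borel_dist = {u \<in> frob_dist 1. kills u (entry 2 1)}"

definition torus_dist :: "'k::field functional set" where
  "torus_dist = {u \<in> borel_dist. kills u (entry 1 2)}"

text \<open>In \<open>x_21(xy) = x_21(x) x_11(y) + x_22(x) x_21(y)\<close> the first summand is
  killed by \<open>u\<close> and the second by \<open>v\<close>. The next lemma is the analogue for
  lower triangular matrices.\<close>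

lemma kills_convolution_entry_21:
  assumes u: "u \<in> dual" "kills u (entry 2 1)" and v: "v \<in> dual" "kills v (entry 2 1)"
  shows "kills (convolution u v) (entry 2 1)"
  unfolding kills_def
proof
  fix f :: "'a SL2 \<Rightarrow> 'a" assume f: "f \<in> regular"
  have "v (\<lambda>y. entry 2 1 (x * y) * f (x * y)) = entry 2 1 x * v (\<lambda>y. entry 1 1 y * f (x * y))" for x
  proof -
    have "v (\<lambda>y. entry 2 1 (x * y) * f (x * y)) =
      v (\<lambda>y. entry 2 1 x * (entry 1 1 y * f (x * y)) + entry 2 1 y * (entry 2 2 x * f (x * y)))"
      by (simp add: entry_mult algebra_simps)
    also have "\<dots> = entry 2 1 x * v (\<lambda>y. entry 1 1 y * f (x * y))"
      using killsD[OF v(2), of "\<lambda>y. entry 2 2 x * f (x * y)"] regular_left[OF f]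
      by (simp add: dual_add[OF v(1)] dual_scale[OF v(1)] regular_intros)
    finally show ?thesis .
  qed
  moreover have "(\<lambda>x. v (\<lambda>y. entry 1 1 y * f (x * y))) \<in> regular"
    using regular_partial(1)[OF fn_act_dual[OF v(1) regular.entry[of 1 1]] f] regular_left[OF f]
    by (simp add: fn_act_def)
  ultimately show "convolution u v (\<lambda>x. entry 2 1 x * f x) = 0"
    using f killsD[OF u(2)] by (simp add: convolution_apply regular_intros)
qed

lemma kills_convolution_entry_12:
  assumes u: "u \<in> dual" "kills u (entry 1 2)" and v: "v \<in> dual" "kills v (entry 1 2)"
  shows "kills (convolution u v) (entry 1 2)"
  unfolding kills_def
proof
  fix f :: "'a SL2 \<Rightarrow> 'a" assume f: "f \<in> regular"
  have "v (\<lambda>y. entry 1 2 (x * y) * f (x * y)) = entry 1 2 x * v (\<lambda>y. entry 2 2 y * f (x * y))" for x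
  proof -
    have "v (\<lambda>y. entry 1 2 (x * y) * f (x * y)) =
      v (\<lambda>y. entry 1 2 x * (entry 2 2 y * f (x * y)) + entry 1 2 y * (entry 1 1 x * f (x * y)))"
      by (simp add: entry_mult algebra_simps)
    also have "\<dots> = entry 1 2 x * v (\<lambda>y. entry 2 2 y * f (x * y))"
      using killsD[OF v(2), of "\<lambda>y. entry 1 1 x * f (x * y)"] regular_left[OF f]
      by (simp add: dual_add[OF v(1)] dual_scale[OF v(1)] regular_intros)
    finally show ?thesis .
  qed
  moreover have "(\<lambda>x. v (\<lambda>y. entry 2 2 y * f (x * y))) \<in> regular"
    using regular_partial(1)[OF fn_act_dual[OF v(1) regular.entry[of 2 2]] f] regular_left[OF f]
    by (simp add: fn_act_def)
  ultimately show "convolution u v (\<lambda>x. entry 1 2 x * f x) = 0"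
    using f killsD[OF u(2)] by (simp add: convolution_apply regular_intros)
qed

lemma sl2_kills: "D \<in> sl2 \<Longrightarrow> f \<in> regular \<Longrightarrow> f 1 = 0 \<Longrightarrow> D f = 0 \<Longrightarrow> kills D f"
  by (simp add: kills_def sl2_mult)

lemma borel_dist_convolution:
  assumes p: "prime CHAR('k::field)" and "(u :: 'k functional) \<in> borel_dist" "v \<in> borel_dist"
  shows "convolution u v \<in> borel_dist"
  using assms(2,3) frob_dist_convolution(1)[OF p, of v u 1] kills_convolution_entry_21[of u v]
  by (auto simp: borel_dist_def dest: frob_dist_dual)

lemma borel_algebra_borel_dist:
  assumes p: "prime CHAR('k::field)" and "(D :: 'k functional) \<in> borel_algebra"
  shows "D \<in> borel_dist"
  using assms(2) sl2_dist_1[OF p] by (simp add: borel_algebra_def borel_dist_def sl2_kills regular.entry)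

lemma scalar_kills: "f \<in> regular \<Longrightarrow> f 1 = 0 \<Longrightarrow> kills (scalar c) f"
  by (simp add: kills_def scalar_def)

text \<open>The killed functions generate the ideal of the identity, \<open>x_22 - 1\<close> coming
  from the determinant, so only evaluation at 1 survives.\<close>

lemma torus_dist_kernel_scalar:
  assumes u: "u \<in> torus_dist" and k: "kills u (\<lambda>x. entry 1 1 x - 1)"
  shows "u = scalar (u (\<lambda>_. 1))"
proof -
  have d: "u \<in> dual" and k21: "kills u (entry 2 1)" and k12: "kills u (entry 1 2)"
    using u by (auto simp: torus_dist_def borel_dist_def frob_dist_dual)
  have main: "u (\<lambda>x. f x * h x) = f 1 * u h" if f: "f \<in> regular" and "h \<in> regular" for f h
    using that
  proof (induction f arbitrary: h rule: regular.induct)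
    case (const c)
    then show ?case by (simp add: dual_scale[OF d])
  next
    case (entry i j)
    note h = \<open>h \<in> regular\<close>
    have k11: "u (\<lambda>x. entry 1 1 x * h x) = u h" if "h \<in> regular" for h
    proof -
      have "u (\<lambda>x. entry 1 1 x * h x) = u (\<lambda>x. (entry 1 1 x - 1) * h x + h x)"
        by (simp add: algebra_simps)
      also have "\<dots> = u h"
        using killsD[OF k that] that by (simp add: dual_add[OF d] regular_intros)
      finally show ?thesis .
    qed
    have k22: "u (\<lambda>x. entry 2 2 x * h x) = u h"
    proof -
      have "u (\<lambda>x. entry 2 2 x * h x) = u (\<lambda>x. entry 1 1 x * (entry 2 2 x * h x))"
        using h by (simp add: k11 regular_intros)
      also have "(\<lambda>x. entry 1 1 x * (entry 2 2 x * h x)) = (\<lambda>x. h x + entry 1 2 x * (entry 2 1 x * h x))"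
      proof
        fix x :: "'a SL2"
        have "entry 1 1 x * entry 2 2 x = 1 + entry 1 2 x * entry 2 1 x"
          using entry_det[of x] by (simp add: algebra_simps)
        then show "entry 1 1 x * (entry 2 2 x * h x) = h x + entry 1 2 x * (entry 2 1 x * h x)"
          by (simp add: distrib_right flip: mult.assoc)
      qed
      also have "u \<dots> = u h"
        using killsD[OF k12, of "\<lambda>x. entry 2 1 x * h x"] h by (simp add: dual_add[OF d] regular_intros)
      finally show ?thesis .
    qed
    show ?case
      using k11[OF h] k22 killsD[OF k12 h] killsD[OF k21 h]
      by (cases i rule: index_2_cases; cases j rule: index_2_cases) simp_all
  next
    case (add f g)
    then show ?case by (simp add: distrib_right dual_add[OF d] regular_intros)
  next
    case (mult f g)
    then show ?case by (simp add: mult.assoc regular_intros)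
  qed
  show ?thesis
  proof (rule dual_eqI[OF d scalar_dual])
    fix f :: "'a SL2 \<Rightarrow> 'a" assume f: "f \<in> regular"
    from main[OF f regular.const[of 1]] have "u f = f 1 * u (\<lambda>_. 1)" by (simp only: mult_1_right)
    then show "u f = scalar (u (\<lambda>_. 1)) f" using f by (simp add: scalar_def mult.commute)
  qed
qed

text \<open>Supplies the functions \<open>\<kappa>\<close> for the applications of
  \<open>peel\<close>.\<close>

lemma sl2_translate:
  assumes "D \<in> sl2"
  shows "D (\<lambda>x. entry i j (x * y)) = D (entry i 1) * entry 1 j y + D (entry i 2) * entry 2 j y"
proof -
  have "D (\<lambda>x. entry i j (x * y)) = D (\<lambda>x. entry 1 j y * entry i 1 x + entry 2 j y * entry i 2 x)"
    by (simp add: entry_mult mult.commute)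
  then show ?thesis
    by (simp add: sl2_add[OF assms] sl2_scale[OF assms] regular_intros mult.commute[of "D _"])
qed

lemma U0_b_closed:
  assumes "(u :: 'k::field functional) \<in> U0_b" "v \<in> U0_b"
  shows "convolution u v \<in> U0_b" "(\<lambda>f. u f + v f) \<in> U0_b"
  using assms generate_ring.eng_add[of u U0_sl2 "range scalar \<union> borel_algebra" v]
    generate_ring.eng_mult[of u U0_sl2 "range scalar \<union> borel_algebra" v]
  by (simp_all add: U0_b_def U0_sl2_def)

text \<open>\<open>borel_dist\<close> is given by equations, \<open>U0_b\<close> by generators. Two
  applications of \<open>peel\<close> lead from the former to the latter: powers of \<open>h\<close>
  reduce the torus part to scalars, powers of \<open>e\<close> reduce the Borel part to the torus
  part. The converse is an induction over the generated ring.\<close>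

lemma borel_dist_eq:
  assumes p: "prime CHAR('k::alg_closed_field)"
  shows "(borel_dist :: 'k functional set) = U0_b"
proof
  have U_incl: "D \<in> sl2 \<Longrightarrow> D (entry 2 1) = 0 \<Longrightarrow> D \<in> U0_b" "scalar c \<in> U0_b" for D :: "'k functional" and c
    unfolding U0_b_def by (auto intro!: generate_ring.incl simp: borel_algebra_def)
  have U_0: "(\<lambda>_. 0) \<in> (U0_b :: 'k functional set)"
    using U_incl(2)[of 0] by (simp add: scalar_def cong: if_cong)
  have fn: "fn_act h u \<in> borel_dist" "fn_act h u \<in> torus_dist"
    if "h \<in> regular" "u \<in> torus_dist" for u :: "'k functional" and h
    using that by (auto simp: torus_dist_def borel_dist_def frob_dist_fn_act kills_fn_act)
  have torus: "torus_dist \<subseteq> (U0_b :: 'k functional set)"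
  proof
    fix u :: "'k functional" assume u: "u \<in> torus_dist"
    \<comment> \<open>Only membership in the ring counts here, so the family \<open>S\<close> is
      constant.\<close>
    show "u \<in> U0_b"
    proof (rule peel[where D = sl2_h and q = "\<lambda>x. entry 1 1 x - 1" and P = torus_dist
          and \<kappa> = "entry 1 1" and m = "CHAR('k)" and S = "\<lambda>_. U0_b"])
      show "sl2_h (\<lambda>x. entry 1 1 (x * y) - 1) = entry 1 1 y" for y :: "'k SL2"
        using regular_right[OF regular.entry[of 1 1], of y]
        by (simp add: dual_diff[OF sl2_dual[OF sl2_efh(3)]] sl2_translate[OF sl2_efh(3)] sl2_h_entry
            regular_intros sl2_const[OF sl2_efh(3)])
      show "convolution sl2_h u \<in> torus_dist" if "u \<in> torus_dist" for u :: "'k functional"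
        using that sl2_dist_1[OF p sl2_efh(3)] sl2_kills[OF sl2_efh(3) regular.entry, of 1 2]
          sl2_kills[OF sl2_efh(3) regular.entry, of 2 1]
        by (auto simp: torus_dist_def borel_dist_def sl2_h_entry frob_dist_dual
            intro!: frob_dist_convolution[OF p] kills_convolution_entry_12 kills_convolution_entry_21)
      show "u (\<lambda>x. entry 1 1 x ^ CHAR('k) * f x) = u f" if "u \<in> torus_dist" "f \<in> regular" for u :: "'k functional" and f
        using that frob_dist_1_power[OF p _ regular.entry[of 1 1], of u f]
        by (simp add: torus_dist_def borel_dist_def)
      show "convolution sl2_h u \<in> U0_b" if "u \<in> U0_b" for u :: "'k functional"
        using U0_b_closed[OF U_incl(1)[OF sl2_efh(3)] that] by (simp add: sl2_h_entry)
      show "u \<in> U0_b" if "u \<in> torus_dist" "kills u (\<lambda>x. entry 1 1 x - 1)" for u :: "'k functional"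
        using torus_dist_kernel_scalar[OF that] U_incl(2) by metis
      show "kills u (\<lambda>x. (entry 1 1 x - 1) ^ CHAR('k))"
        using u by (simp add: torus_dist_def borel_dist_def frob_dist_def)
      show "(\<lambda>f. u f - v f) \<in> torus_dist" if "u \<in> torus_dist" "v \<in> torus_dist" for u v :: "'k functional"
        using that by (simp add: torus_dist_def borel_dist_def frob_dist_minus kills_minus)
    qed (use p fn u U_0 in \<open>auto simp: sl2_efh regular_intros U0_b_closed torus_dist_def
          borel_dist_def frob_dist_dual\<close>)
  qed
  show "(borel_dist :: 'k functional set) \<subseteq> U0_b"
  proof
    fix u :: "'k functional" assume u: "u \<in> borel_dist"
    show "u \<in> U0_b"
    proof (rule peel[where D = sl2_e and q = "entry 1 2" and P = borel_dist
          and \<kappa> = "entry 2 2" and m = "CHAR('k)" and S = "\<lambda>_. U0_b"])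
      show "sl2_e (\<lambda>x. entry 1 2 (x * y)) = entry 2 2 y" for y :: "'k SL2"
        by (simp add: sl2_translate[OF sl2_efh(1)] sl2_e_entry)
      show "convolution sl2_e u \<in> borel_dist" if "u \<in> borel_dist" for u :: "'k functional"
        using that sl2_dist_1[OF p sl2_efh(1)] sl2_kills[OF sl2_efh(1) regular.entry, of 2 1]
        by (intro borel_dist_convolution[OF p]) (auto simp: borel_dist_def sl2_e_entry)
      show "u (\<lambda>x. entry 2 2 x ^ CHAR('k) * f x) = u f" if "u \<in> borel_dist" "f \<in> regular" for u :: "'k functional" and f
        using that frob_dist_1_power[OF p _ regular.entry[of 2 2], of u f]
        by (simp add: borel_dist_def)
      show "convolution sl2_e u \<in> U0_b" if "u \<in> U0_b" for u :: "'k functional"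
        using U0_b_closed[OF U_incl(1)[OF sl2_efh(1)] that] by (simp add: sl2_e_entry)
      show "u \<in> U0_b" if "u \<in> borel_dist" "kills u (entry 1 2)" for u :: "'k functional"
        using that torus by (auto simp: torus_dist_def)
      show "kills u (\<lambda>x. entry 1 2 x ^ CHAR('k))"
        using u by (simp add: borel_dist_def frob_dist_def)
      show "(\<lambda>f. u f - v f) \<in> borel_dist" if "u \<in> borel_dist" "v \<in> borel_dist" for u v :: "'k functional"
        using that by (simp add: borel_dist_def frob_dist_minus kills_minus)
      show "fn_act h u \<in> borel_dist" if "u \<in> borel_dist" "h \<in> regular" for u :: "'k functional" and h
        using that by (simp add: borel_dist_def frob_dist_fn_act kills_fn_act)
    qed (use p u U_0 in \<open>auto simp: sl2_efh regular_intros U0_b_closed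
          borel_dist_def frob_dist_dual\<close>)
  qed
  show "U0_b \<subseteq> (borel_dist :: 'k functional set)"
  proof
    fix u :: "'k functional" assume "u \<in> U0_b"
    then have "u \<in> generate_ring (group_algebra SL2_1) (range scalar \<union> borel_algebra)"
      by (simp add: U0_b_def U0_sl2_def)
    then show "u \<in> borel_dist"
    proof induction
      case one
      then show ?case by (simp add: borel_dist_def scalar_dist_1[OF p] scalar_kills regular.entry)
    next
      case (incl h)
      then show ?case
        using borel_algebra_borel_dist[OF p]
        by (auto simp: borel_dist_def scalar_dist_1[OF p] scalar_kills regular.entry)
    next
      case (a_inv h)
      then have "h \<in> carrier (group_algebra SL2_1)"
        by (simp add: carrier_group_algebra_SL2_1[OF p] borel_dist_def)
      then show ?case
        using a_inv frob_dist_minus[OF frob_dist_zero, of h 1]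
        by (simp add: group_algebra_a_inv borel_dist_def kills_def)
    next
      case (eng_add h1 h2)
      then show ?case by (simp add: borel_dist_def frob_dist_plus kills_plus)
    next
      case (eng_mult h1 h2)
      then show ?case by (simp add: borel_dist_convolution[OF p])
    qed
  qed
qed

section \<open>Powers of \<open>f\<close> over \<open>U_0(b)\<close>\<close>

definition f_power :: "nat \<Rightarrow> 'k::alg_closed_field functional" where
  "f_power j = (convolution sl2_f ^^ j) (scalar 1)"

lemma f_power_0: "f_power 0 = scalar 1"
  by (simp add: f_power_def)

lemma f_power_Suc: "f_power (Suc j) = convolution sl2_f (f_power j)"
  by (simp add: f_power_def)

lemma f_power_dist:
  assumes p: "prime CHAR('k::alg_closed_field)"
  shows "(f_power j :: 'k functional) \<in> frob_dist 1"
  by (induction j)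
    (simp_all add: f_power_0 f_power_Suc scalar_dist_1[OF p] frob_dist_convolution[OF p] sl2_dist_1[OF p] sl2_efh)

text \<open>The spanning half of a PBW decomposition. The family \<open>S m\<close> now bounds the
  number of powers of \<open>f\<close>, and what \<open>peel\<close> leaves at the bottom is killed
  by \<open>x_21\<close>, hence lies in \<open>U_0(b)\<close>.\<close>

lemma dist_1_eq_f_power:
  assumes p: "prime CHAR('k::alg_closed_field)" and u: "(u :: 'k functional) \<in> frob_dist 1"
  shows "\<exists>b. (\<forall>j. b j \<in> U0_b) \<and> u = (\<lambda>F. \<Sum>j<CHAR('k). convolution (f_power j) (b j) F)"
proof -
  define S :: "nat \<Rightarrow> 'k functional set" where
    "S m = {u. \<exists>b. (\<forall>j. b j \<in> U0_b) \<and> u = (\<lambda>F. \<Sum>j<m. convolution (f_power j) (b j) F)}" for m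
  have U_0: "(\<lambda>_. 0) \<in> (U0_b :: 'k functional set)"
    by (simp add: borel_dist_def frob_dist_zero kills_def flip: borel_dist_eq[OF p])
  have U_dual: "b \<in> dual" if "b \<in> U0_b" for b :: "'k functional"
    using that frob_dist_dual[of b 1] by (simp add: borel_dist_def flip: borel_dist_eq[OF p])
  note f_dual = frob_dist_dual[OF f_power_dist[OF p]]
  have "u \<in> S (CHAR('k))"
  proof (rule peel[where D = sl2_f and q = "entry 2 1" and P = "frob_dist 1"
        and \<kappa> = "entry 1 1" and m = "CHAR('k)" and S = S])
    show "sl2_f (\<lambda>x. entry 2 1 (x * y)) = entry 1 1 y" for y :: "'k SL2"
      by (simp add: sl2_translate[OF sl2_efh(2)] sl2_f_entry)
    show "convolution sl2_f u \<in> frob_dist 1" if "u \<in> frob_dist 1" for u :: "'k functional"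
      using frob_dist_convolution(1)[OF p that sl2_dist_1[OF p sl2_efh(2)]] .
    show "u (\<lambda>x. entry 1 1 x ^ CHAR('k) * f x) = u f" if "u \<in> frob_dist 1" "f \<in> regular" for u :: "'k functional" and f
      using that frob_dist_1_power[OF p _ regular.entry[of 1 1], of u f] by simp
    show "kills u (\<lambda>x. entry 2 1 x ^ CHAR('k))"
      using u by (simp add: frob_dist_def)
    show "(\<lambda>_. 0) \<in> S 0"
      using U_0 by (auto simp: S_def)
    show "(\<lambda>f. u f + v f) \<in> S n" if uv: "u \<in> S n" "v \<in> S n" for u v n
    proof -
      obtain b c where b: "\<forall>j. b j \<in> U0_b" "u = (\<lambda>F. \<Sum>j<n. convolution (f_power j) (b j) F)"
        and c: "\<forall>j. c j \<in> U0_b" "v = (\<lambda>F. \<Sum>j<n. convolution (f_power j) (c j) F)"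
        using uv by (auto simp: S_def)
      have "convolution (f_power j) (\<lambda>f. b j f + c j f) =
        (\<lambda>f. convolution (f_power j) (b j) f + convolution (f_power j) (c j) f)" for j
        by (intro convolution_plus_right f_dual U_dual) (use b c in auto)
      then show ?thesis
        unfolding S_def
        by (intro CollectI exI[of _ "\<lambda>j f. b j f + c j f"]) (use b c in \<open>simp add: sum.distrib U0_b_closed\<close>)
    qed
    show "u \<in> S (Suc n)" if u: "u \<in> S n" for u n
    proof -
      obtain b where b: "\<forall>j. b j \<in> U0_b" "u = (\<lambda>F. \<Sum>j<n. convolution (f_power j) (b j) F)"
        using u by (auto simp: S_def)
      then show ?thesis
        unfolding S_def
        by (intro CollectI exI[of _ "b(n := (\<lambda>_. 0))"]) (auto simp: U_0 convolution_zero_right f_dual)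
    qed
    show "convolution sl2_f u \<in> S (Suc n)" if u: "u \<in> S n" for u n
    proof -
      obtain b where b: "\<forall>j. b j \<in> U0_b" "u = (\<lambda>F. \<Sum>j<n. convolution (f_power j) (b j) F)"
        using u by (auto simp: S_def)
      have "convolution sl2_f u = (\<lambda>F. \<Sum>j<n. convolution sl2_f (convolution (f_power j) (b j)) F)"
        unfolding b(2) using b(1)
        by (intro convolution_sum_right sl2_dual[OF sl2_efh(2)] convolution_dual f_dual U_dual) auto
      also have "\<dots> = (\<lambda>F. \<Sum>j<n. convolution (f_power (Suc j)) (b j) F)"
        using b(1) by (simp add: f_power_Suc convolution_assoc sl2_dual[OF sl2_efh(2)] f_dual U_dual)
      \<comment> \<open>Multiplication by \<open>f\<close> shifts the coefficients up by one;
        \<open>case_nat\<close> puts 0 into the freed place.\<close>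
      finally show ?thesis
        unfolding S_def using b(1) U_0
        by (intro CollectI exI[of _ "case_nat (\<lambda>_. 0) b"])
          (auto simp: sum.lessThan_Suc_shift convolution_zero_right f_dual split: nat.split
            simp del: sum.lessThan_Suc)
    qed
    show "u \<in> S 1" if "u \<in> frob_dist 1" "kills u (entry 2 1)" for u
    proof -
      have "u \<in> U0_b" using that by (simp add: borel_dist_def flip: borel_dist_eq[OF p])
      moreover have "convolution (scalar 1) u = u"
        using that by (simp add: convolution_scalar_left frob_dist_dual)
      ultimately show ?thesis
        unfolding S_def by (intro CollectI exI[of _ "\<lambda>_. u"]) (simp add: f_power_0)
    qed
  qed (use p u in \<open>auto simp: sl2_efh regular_intros frob_dist_dual frob_dist_minus frob_dist_fn_act\<close>)
  then show ?thesis by (simp add: S_def)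
qed

section \<open>Weyl modules\<close>

text \<open>Substituting \<open>s = i - t\<close> leaves a single index and exposes the exponent
  \<open>i - t\<close> of \<open>x_21\<close>, from which orders are read off later.\<close>

lemma weyl_coeff_alt:
  assumes "i \<le> d" "j \<le> d"
  shows "weyl_coeff d i j x = (\<Sum>t | t \<le> i \<and> t \<le> j \<and> j - t \<le> d - i.
     of_nat ((d - i) choose (j - t)) * of_nat (i choose t) *
     entry 1 1 x ^ (d - i - (j - t)) * entry 2 1 x ^ (i - t) * entry 1 2 x ^ (j - t) * entry 2 2 x ^ t)"
  unfolding weyl_coeff_def
proof (rule sum.reindex_bij_witness[of _ "\<lambda>t. (i - t, t)" snd])
  fix q assume q: "q \<in> {(s, t). s \<le> d - j \<and> t \<le> j \<and> s + t = i}"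
  then obtain s t where st: "q = (s, t)" "s \<le> d - j" "t \<le> j" "s + t = i" by auto
  then show "(i - snd q, snd q) = q" "snd q \<in> {t. t \<le> i \<and> t \<le> j \<and> j - t \<le> d - i}"
    using assms by auto
  have "d - i - (j - t) = d - j - s" "i - t = s" using st assms by auto
  then show "of_nat ((d - i) choose (j - snd q)) * of_nat (i choose snd q) *
     entry 1 1 x ^ (d - i - (j - snd q)) * entry 2 1 x ^ (i - snd q) * entry 1 2 x ^ (j - snd q) * entry 2 2 x ^ snd q =
    (case q of (s, t) \<Rightarrow> of_nat ((d - i) choose (j - t)) * of_nat (i choose t) *
     entry 1 1 x ^ (d - j - s) * entry 2 1 x ^ s * entry 1 2 x ^ (j - t) * entry 2 2 x ^ t)"
    by (simp add: st(1))
qed (use assms in auto)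

text \<open>Divided powers are dual to symmetric powers: row \<open>i\<close> of the matrix lists
  the coefficients of the form that arises from \<open>A ^ (d - i) * B ^ i\<close> by a linear
  substitution. The binomial theorem then suffices, and arbitrary \<open>A\<close>, \<open>B\<close>
  permit a second substitution.\<close>

lemma weyl_coeff_expansion:
  fixes A B :: "'k::field poly"
  assumes "i \<le> d"
  shows "([:entry 1 1 x:] * A + [:entry 1 2 x:] * B) ^ (d - i) *
      ([:entry 2 1 x:] * A + [:entry 2 2 x:] * B) ^ i =
    (\<Sum>j\<le>d. [:weyl_coeff d i j x:] * (A ^ (d - j) * B ^ j))"
proof -
  let ?a = "[:entry 1 1 x:]" and ?b = "[:entry 1 2 x:]" and ?c = "[:entry 2 1 x:]" and ?d = "[:entry 2 2 x:]"
  define G where "G m t = of_nat ((d - i) choose m) * of_nat (i choose t) *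
    (?a ^ (d - i - m) * ?c ^ (i - t) * ?b ^ m * ?d ^ t) * (A ^ (d - (m + t)) * B ^ (m + t))" for m t
  have "(?a * A + ?b * B) ^ (d - i) * (?c * A + ?d * B) ^ i =
    (?b * B + ?a * A) ^ (d - i) * (?d * B + ?c * A) ^ i" by (simp add: add.commute)
  also have "\<dots> = (\<Sum>m\<le>d - i. \<Sum>t\<le>i.
      (of_nat ((d - i) choose m) * (?b * B) ^ m * (?a * A) ^ (d - i - m)) *
      (of_nat (i choose t) * (?d * B) ^ t * (?c * A) ^ (i - t)))"
    by (simp only: binomial_ring sum_product)
  also have "\<dots> = (\<Sum>m\<le>d - i. \<Sum>t\<le>i. G m t)"
  proof (intro sum.cong refl)
    fix m t assume mt: "m \<in> {..d - i}" "t \<in> {..i}"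
    then have "d - (m + t) = (d - i - m) + (i - t)" using assms by auto
    then show "(of_nat ((d - i) choose m) * (?b * B) ^ m * (?a * A) ^ (d - i - m)) *
      (of_nat (i choose t) * (?d * B) ^ t * (?c * A) ^ (i - t)) = G m t"
      unfolding G_def by (simp only: power_mult_distrib power_add mult_ac)
  qed
  also have "\<dots> = (\<Sum>(m, t)\<in>{..d - i} \<times> {..i}. G m t)"
    by (simp add: sum.cartesian_product)
  \<comment> \<open>Terms are collected by their total degree \<open>j = m + t\<close> in
    \<open>B\<close>.\<close>
  also have "\<dots> = (\<Sum>(j, t)\<in>(SIGMA j:{..d}. {t. t \<le> i \<and> t \<le> j \<and> j - t \<le> d - i}). G (j - t) t)"
    by (rule sum.reindex_bij_witness[of _ "\<lambda>(j, t). (j - t, t)" "\<lambda>(m, t). (m + t, t)"])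
      (use assms in auto)
  also have "\<dots> = (\<Sum>j\<le>d. \<Sum>t | t \<le> i \<and> t \<le> j \<and> j - t \<le> d - i. G (j - t) t)"
    by (subst sum.Sigma) (auto intro: finite_subset[of _ "{..i}"])
  also have "\<dots> = (\<Sum>j\<le>d. [:weyl_coeff d i j x:] * (A ^ (d - j) * B ^ j))"
  proof (intro sum.cong refl)
    fix j assume j: "j \<in> {..d}"
    have const_sum: "[:\<Sum>t\<in>S. F t:] = (\<Sum>t\<in>S. [:F t:])" for S and F :: "nat \<Rightarrow> 'k"
    proof (induction S rule: infinite_finite_induct)
      case (insert a S)
      then show ?case by (simp flip: insert(3))
    qed simp_all
    have const_power: "[:c:] ^ n = [:c ^ n:]" for c :: 'k and n
      by (induction n) (simp_all add: one_pCons)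
    have "[:weyl_coeff d i j x:] * (A ^ (d - j) * B ^ j) = (\<Sum>t | t \<le> i \<and> t \<le> j \<and> j - t \<le> d - i.
       [:of_nat ((d - i) choose (j - t)) * of_nat (i choose t) *
     entry 1 1 x ^ (d - i - (j - t)) * entry 2 1 x ^ (i - t) * entry 1 2 x ^ (j - t) * entry 2 2 x ^ t:] *
       (A ^ (d - j) * B ^ j))"
      using j assms by (simp only: weyl_coeff_alt atMost_iff const_sum sum_distrib_right)
    also have "\<dots> = (\<Sum>t | t \<le> i \<and> t \<le> j \<and> j - t \<le> d - i. G (j - t) t)"
      by (intro sum.cong refl) (simp add: G_def const_power of_nat_poly mult_ac)
    finally show "(\<Sum>t | t \<le> i \<and> t \<le> j \<and> j - t \<le> d - i. G (j - t) t) =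
      [:weyl_coeff d i j x:] * (A ^ (d - j) * B ^ j)" by simp
  qed
  finally show ?thesis .
qed

lemma weyl_coeff_coeff:
  assumes "i \<le> d" "j \<le> d"
  shows "Polynomial.coeff ([:entry 1 1 x, entry 1 2 x:] ^ (d - i) * [:entry 2 1 x, entry 2 2 x:] ^ i) j =
    weyl_coeff d i j x"
proof -
  have X: "[:0, 1:] ^ k = Polynomial.monom (1 :: 'a) k" for k
    by (induction k) (simp_all add: monom_Suc one_pCons)
  have "[:entry 1 1 x, entry 1 2 x:] ^ (d - i) * [:entry 2 1 x, entry 2 2 x:] ^ i =
    (\<Sum>k\<le>d. [:weyl_coeff d i k x:] * [:0, 1:] ^ k)"
    using weyl_coeff_expansion[OF assms(1), of x 1 "[:0, 1:]"] by simp
  then show ?thesis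
    using assms(2) by (simp add: X coeff_sum smult_monom)
qed

text \<open>The linear forms given by the rows of \<open>y\<close> are substituted into the
  expansion for \<open>x\<close>, and coefficients are compared.\<close>

lemma weyl_coeff_mult:
  assumes "i \<le> d" "j \<le> d"
  shows "weyl_coeff d i j (x * y) = (\<Sum>k\<le>d. weyl_coeff d i k x * weyl_coeff d k j y)"
proof -
  define L1 where "L1 = [:entry 1 1 y, entry 1 2 y:]"
  define L2 where "L2 = [:entry 2 1 y, entry 2 2 y:]"
  have L: "[:entry 1 1 (x * y), entry 1 2 (x * y):] = [:entry 1 1 x:] * L1 + [:entry 1 2 x:] * L2"
    "[:entry 2 1 (x * y), entry 2 2 (x * y):] = [:entry 2 1 x:] * L1 + [:entry 2 2 x:] * L2"
    by (simp_all add: L1_def L2_def entry_mult mult.commute)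
  have "weyl_coeff d i j (x * y) = Polynomial.coeff (\<Sum>k\<le>d. [:weyl_coeff d i k x:] * (L1 ^ (d - k) * L2 ^ k)) j"
    unfolding weyl_coeff_coeff[OF assms, symmetric] L weyl_coeff_expansion[OF assms(1)] ..
  then show ?thesis
    using assms by (simp add: coeff_sum L1_def L2_def weyl_coeff_coeff)
qed

lemma weyl_coeff_1:
  assumes "i \<le> d" "j \<le> d"
  shows "weyl_coeff d i j 1 = (if i = j then 1 else 0)"
proof -
  have X: "[:0, 1:] ^ k = Polynomial.monom (1 :: 'a) k" for k
    by (induction k) (simp_all add: monom_Suc one_pCons)
  show ?thesis
    unfolding weyl_coeff_coeff[OF assms, symmetric] entry_1 X
    by (simp add: pCons_one)
qed

lemma weyl_coeff_regular: "weyl_coeff d i j \<in> (regular :: ('k::field SL2 \<Rightarrow> 'k) set)"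
proof -
  have "finite ({..d - j} \<times> {..j})" by simp
  then have "finite {(s, t). s \<le> d - j \<and> t \<le> j \<and> s + t = i}"
    by (rule rev_finite_subset) auto
  then have "(\<lambda>x. \<Sum>q\<in>{(s, t). s \<le> d - j \<and> t \<le> j \<and> s + t = i}.
     of_nat ((d - i) choose (j - snd q)) * of_nat (i choose snd q) *
     entry 1 1 x ^ (d - j - fst q) * entry 2 1 x ^ fst q * entry 1 2 x ^ (j - snd q) * entry 2 2 x ^ snd q) \<in>
     (regular :: ('k SL2 \<Rightarrow> 'k) set)"
    by (rule regular_sum) (intro regular_intros)
  then show ?thesis
    unfolding weyl_coeff_def by (simp add: case_prod_beta)
qed

lemma weyl_act_convolution:
  assumes u: "u \<in> dual" and v: "v \<in> dual"
  shows "weyl_act d (convolution u v) w = weyl_act d u (weyl_act d v w)"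
proof
  fix i
  have "convolution u v (weyl_coeff d i j) = (\<Sum>k\<le>d. u (weyl_coeff d i k) * v (weyl_coeff d k j))"
    if "i \<le> d" "j \<le> d" for i j
  proof -
    have "v (\<lambda>y. weyl_coeff d i j (x * y)) = (\<Sum>k\<le>d. v (weyl_coeff d k j) * weyl_coeff d i k x)" for x
      using that by (simp add: weyl_coeff_mult dual_sum[OF v] regular_intros weyl_coeff_regular
          dual_scale[OF v]) (simp add: mult.commute)
    then show ?thesis
      by (simp add: convolution_apply weyl_coeff_regular dual_sum[OF u] dual_scale[OF u] regular_intros)
        (simp add: mult.commute)
  qed
  then have "(\<Sum>j\<le>d. convolution u v (weyl_coeff d i j) * w j) =
    (\<Sum>k\<le>d. u (weyl_coeff d i k) * (\<Sum>j\<le>d. v (weyl_coeff d k j) * w j))" if "i \<le> d"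
    using that
    by (simp add: sum_distrib_left sum_distrib_right mult.assoc) (subst sum.swap, rule refl)
  then show "weyl_act d (convolution u v) w i = weyl_act d u (weyl_act d v w) i"
    by (simp add: weyl_act_def)
qed

lemma weyl_act_plus_left: "weyl_act d (\<lambda>f. u f + v f) w = (\<lambda>i. weyl_act d u w i + weyl_act d v w i)"
  by (auto simp: weyl_act_def distrib_right sum.distrib)

lemma weyl_act_plus_right: "weyl_act d u (\<lambda>i. v i + w i) = (\<lambda>i. weyl_act d u v i + weyl_act d u w i)"
  by (auto simp: weyl_act_def distrib_left sum.distrib)

lemma weyl_act_times_right: "weyl_act d u (\<lambda>i. c * v i) = (\<lambda>i. c * weyl_act d u v i)"
  by (auto simp: weyl_act_def sum_distrib_left mult_ac)

lemma weyl_act_sum_right: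
  "weyl_act d u (\<lambda>i. \<Sum>s\<in>S. v s i) = (\<lambda>i. \<Sum>s\<in>S. weyl_act d u (v s) i)"
  by (rule ext) (auto simp: weyl_act_def sum_distrib_left intro: sum.swap)

lemma weyl_group_act_eq: "weyl_group_act d g v = weyl_act d (evaluation g) v"
  by (auto simp: weyl_group_act_def weyl_act_def evaluation_def weyl_coeff_regular)

lemma weyl_act_one: "v \<in> weyl_carrier d \<Longrightarrow> weyl_act d (scalar 1) v = v"
  by (rule ext) (auto simp: weyl_act_def scalar_def weyl_coeff_regular weyl_coeff_1 weyl_carrier_def
      if_distrib[of "\<lambda>c. c * _"] cong: if_cong)

lemma weyl_group_act_inverse:
  "v \<in> weyl_carrier d \<Longrightarrow> weyl_group_act d (inverse g) (weyl_group_act d g v) = v"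
  by (simp add: weyl_group_act_eq evaluation_dual evaluation_mult evaluation_1 weyl_act_one
      flip: weyl_act_convolution)

lemma weyl_act_group_act:
  "u \<in> dual \<Longrightarrow> weyl_act d u (weyl_group_act d g v) =
    weyl_group_act d g (weyl_act d (adjoint (inverse g) u) v)"
  by (simp add: weyl_group_act_eq evaluation_dual convolution_adjoint adjoint_dual
      flip: weyl_act_convolution)

section \<open>The highest weight vector under powers of \<open>f\<close> and under
  \<open>U_0(b)\<close>\<close>

abbreviation weyl_basis :: "nat \<Rightarrow> nat \<Rightarrow> 'k::field" where
  "weyl_basis j \<equiv> (\<lambda>i. if i = j then 1 else 0)"

lemma weyl_act_f_power:
  assumes p: "prime CHAR('k::alg_closed_field)" and "j \<le> d"
  shows "weyl_act d (f_power j) (weyl_basis 0) = (\<lambda>i. of_nat (fact j) * weyl_basis j i :: 'k)"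
  using assms(2)
proof (induction j)
  case 0
  then show ?case by (simp add: f_power_0 weyl_act_one weyl_carrier_def)
next
  case (Suc j)
  have "weyl_act d (f_power (Suc j)) (weyl_basis 0) =
    (\<lambda>i. of_nat (fact j) * weyl_act d sl2_f (weyl_basis j) i :: 'k)"
    using Suc by (simp add: f_power_Suc weyl_act_convolution sl2_dual sl2_efh
        frob_dist_dual[OF f_power_dist[OF p]] weyl_act_times_right)
  also have "\<dots> = (\<lambda>i. of_nat (fact (Suc j)) * weyl_basis (Suc j) i)"
    using Suc(2) by (subst weyl_act_sl2[OF sl2_efh(2)]) (auto simp: sl2_f_entry algebra_simps)
  finally show ?case .
qed

text \<open>Column 0 of the matrix consists of \<open>x_11 ^ (d - i) * x_21 ^ i\<close>. As
  \<open>b\<close> kills \<open>x_21\<close>, only \<open>i = 0\<close> remains, and in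
  \<open>x_11 ^ d\<close> the p-th power \<open>x_11 ^ (s p)\<close> counts as 1.\<close>

lemma weyl_act_U0_b:
  assumes p: "prime CHAR('k::alg_closed_field)" and b: "(b :: 'k functional) \<in> U0_b"
    and d: "d = s * CHAR('k) + a"
  shows "weyl_act d b (weyl_basis 0) = (\<lambda>i. b (\<lambda>x. entry 1 1 x ^ a) * weyl_basis 0 i)"
proof
  fix i
  have b': "b \<in> frob_dist 1" "kills b (entry 2 1)"
    using b by (simp_all add: borel_dist_def flip: borel_dist_eq[OF p])
  have coeff: "weyl_coeff d i 0 = (\<lambda>x. entry 1 1 x ^ (d - i) * entry 2 1 x ^ i)" if "i \<le> d"
  proof -
    have "{t. t \<le> i \<and> t \<le> 0 \<and> 0 - t \<le> d - i} = {0}" by auto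
    then show ?thesis using weyl_coeff_alt[OF that, of 0] by (intro ext) simp
  qed
  have "weyl_act d b (weyl_basis 0) i = (if i \<le> d then b (weyl_coeff d i 0) else 0)"
    by (simp add: weyl_act_def sum.delta if_distrib[of "\<lambda>c. _ * c"] cong: if_cong)
  also have "\<dots> = b (\<lambda>x. entry 1 1 x ^ a) * weyl_basis 0 i"
  proof (cases i)
    case 0
    have b_eq: "b (\<lambda>x. (entry 1 1 x ^ s) ^ CHAR('k) * entry 1 1 x ^ a) = b (\<lambda>x. entry 1 1 x ^ a)"
      by (subst frob_dist_1_power[OF p b'(1)]) (simp_all add: regular_intros)
    have eq: "weyl_coeff d i 0 = (\<lambda>x. (entry 1 1 x ^ s) ^ CHAR('k) * entry 1 1 x ^ a)"
      using 0 coeff by (simp add: d power_add flip: power_mult)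
    from trans[OF arg_cong[OF eq, of b] b_eq] show ?thesis using 0 by simp
  next
    case (Suc k)
    have "b (\<lambda>x. entry 2 1 x * (entry 2 1 x ^ k * entry 1 1 x ^ (d - i))) = 0"
      by (rule killsD[OF b'(2)]) (intro regular_intros)
    note b_eq = this
    have eq: "weyl_coeff d i 0 = (\<lambda>x. entry 2 1 x * (entry 2 1 x ^ k * entry 1 1 x ^ (d - i)))" if "i \<le> d"
      using coeff[OF that] Suc by (simp add: mult_ac)
    have "b (weyl_coeff d i 0) = 0" if "i \<le> d"
      by (rule trans[OF arg_cong[OF eq[OF that], of b] b_eq])
    then show ?thesis using Suc by simp
  qed
  finally show "weyl_act d b (weyl_basis 0) i = b (\<lambda>x. entry 1 1 x ^ a) * weyl_basis 0 i" .
qed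

section \<open>Translates of divided powers on the Weyl module\<close>

text \<open>In Vandermonde's sum the binomials \<open>(m p choose k)\<close> with
  \<open>0 < k < p\<close> vanish mod p: p divides \<open>k\<close> times each of them, but not
  \<open>k\<close>.\<close>

lemma choose_CHAR:
  assumes p: "prime CHAR('k::field)" and t: "t < CHAR('k)"
  shows "of_nat ((m * CHAR('k) + j) choose t) = (of_nat (j choose t) :: 'k)"
proof -
  have zero: "of_nat ((m * CHAR('k)) choose k) = (0 :: 'k)" if k: "0 < k" "k < CHAR('k)" for k
  proof -
    have "k * ((m * CHAR('k)) choose k) = (m * CHAR('k)) * ((m * CHAR('k) - 1) choose (k - 1))"
      using times_binomial_minus1_eq[OF k(1)] by simp
    then have "CHAR('k) dvd k * ((m * CHAR('k)) choose k)" by simp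
    moreover have "\<not> CHAR('k) dvd k" using k by (simp add: nat_dvd_not_less)
    ultimately show ?thesis
      using p by (simp add: prime_dvd_mult_iff of_nat_eq_0_iff_char_dvd)
  qed
  have "of_nat ((m * CHAR('k) + j) choose t) =
    (\<Sum>k\<le>t. of_nat ((m * CHAR('k)) choose k) * of_nat (j choose (t - k)) :: 'k)"
    by (simp flip: vandermonde[of "m * CHAR('k)"])
  also have "\<dots> = (\<Sum>k\<in>{0}. of_nat ((m * CHAR('k)) choose k) * of_nat (j choose (t - k)) :: 'k)"
    using t zero by (intro sum.mono_neutral_right) auto
  finally show ?thesis by simp
qed

text \<open>Along the conjugated torus \<open>x_21\<close> has no constant term and linear
  coefficient \<open>-2 g_11 g_21\<close>. Its power \<open>s\<close> thus has no terms below degree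
  \<open>s\<close>, whereas \<open>\<delta> i\<close> reads degree \<open>p i\<close>.\<close>

lemma conj_\<delta>_apply:
  fixes g :: "'k::alg_closed_field SL2"
  assumes "\<phi> \<in> regular"
  shows "CHAR('k) * i < s \<Longrightarrow> adjoint (inverse g) (\<delta> i) (\<lambda>x. entry 2 1 x ^ s * \<phi> x) = 0"
    and "adjoint (inverse g) (\<delta> i) (\<lambda>x. entry 2 1 x ^ (CHAR('k) * i) * \<phi> x) =
      (- 2 * entry 1 1 g * entry 2 1 g) ^ (CHAR('k) * i) * \<phi> 1"
proof -
  define \<sigma> where "\<sigma> x = inverse g * x * g" for x
  \<comment> \<open>\<open>fps_X * G\<close> is the expansion of
    \<open>g_11 g_21 (1/(1 + y) - (1 + y))\<close>; the factor \<open>-(2 + y)/(1 + y)\<close> has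
    constant term -2.\<close>
  define G where "G = fps_const (entry 1 1 g * entry 2 1 g) * (- (2 + fps_X) * inverse (1 + fps_X))"
  have \<sigma>_reg: "f \<in> regular \<Longrightarrow> (\<lambda>x. f (\<sigma> x)) \<in> regular" for f :: "'k SL2 \<Rightarrow> 'k"
    unfolding \<sigma>_def by (rule regular_conj)
  have \<sigma>_1: "\<sigma> 1 = 1" by (simp add: \<sigma>_def)
  have "taylor torus_curve (\<lambda>x. entry 2 1 (\<sigma> x)) = fps_X * G"
  proof (rule taylor_eqI)
    \<comment> \<open>The terms in \<open>x_21\<close> and \<open>x_12\<close> vanish on the torus,
      which leaves the difference of the diagonal entries.\<close>
    have eq: "(\<lambda>x. entry 2 1 (\<sigma> x)) = (\<lambda>x. (entry 1 1 g * entry 2 1 g) * (entry 2 2 x + (-1) * entry 1 1 x)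
      + (entry 1 1 g ^ 2 * entry 2 1 x + (- (entry 2 1 g ^ 2)) * entry 1 2 x))"
      by (intro ext) (simp add: \<sigma>_def entry_mult entry_inverse algebra_simps power2_eq_square)
    have inv: "(1 + fps_X) * inverse (1 + fps_X :: 'k fps) = 1"
      by (rule inverse_mult_eq_1') simp
    have "expands torus_curve (\<lambda>x. entry 2 1 (\<sigma> x)) (fps_const (entry 1 1 g * entry 2 1 g) *
      (inverse (1 + fps_X) + fps_const (-1) * (1 + fps_X)) + (fps_const (entry 1 1 g ^ 2) * 0 +
        fps_const (- (entry 2 1 g ^ 2)) * 0))"
      unfolding eq by (intro expands_add expands_mult expands_const expands_torus_curve)
    also have "inverse (1 + fps_X) + fps_const (-1) * (1 + fps_X) =
      (1 - (1 + fps_X) * (1 + fps_X)) * inverse (1 + fps_X :: 'k fps)"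
      using inv by (simp add: left_diff_distrib mult.assoc flip: fps_const_neg)
    also have "1 - (1 + fps_X) * (1 + fps_X) = fps_X * (- (2 + fps_X) :: 'k fps)"
      by (simp add: algebra_simps)
    finally show "expands torus_curve (\<lambda>x. entry 2 1 (\<sigma> x)) (fps_X * G)"
      by (simp add: G_def mult_ac)
  qed
  then have main: "adjoint (inverse g) (\<delta> i) (\<lambda>x. entry 2 1 x ^ s * \<phi> x) =
    fps_nth (fps_X ^ s * G ^ s * taylor torus_curve (\<lambda>x. \<phi> (\<sigma> x))) (CHAR('k) * i)" for s
    using assms \<sigma>_reg[OF assms] \<sigma>_reg[OF regular.entry[of 2 1]]
    by (simp add: adjoint_def regular_intros \<delta>_apply taylor_torus_simps power_mult_distrib
        flip: \<sigma>_def)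
  show "CHAR('k) * i < s \<Longrightarrow> adjoint (inverse g) (\<delta> i) (\<lambda>x. entry 2 1 x ^ s * \<phi> x) = 0"
    by (simp add: main mult.assoc fps_X_power_mult_nth)
  have "fps_nth G 0 = - 2 * entry 1 1 g * entry 2 1 g"
    by (simp add: G_def)
  then show "adjoint (inverse g) (\<delta> i) (\<lambda>x. entry 2 1 x ^ (CHAR('k) * i) * \<phi> x) =
      (- 2 * entry 1 1 g * entry 2 1 g) ^ (CHAR('k) * i) * \<phi> 1"
    using \<sigma>_reg[OF assms]
    by (simp add: main mult.assoc fps_X_power_mult_nth fps_power_zeroth taylor_torus_simps curves_0 \<sigma>_1)
qed

text \<open>The summands contain \<open>x_21 ^ (I - t)\<close> with \<open>I = np + j'\<close>. For
  \<open>t > j'\<close> the binomial vanishes mod p; otherwise the exponent is at least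
  \<open>p n\<close>, hence at least \<open>p i\<close>, and only the exponent \<open>p i\<close>
  survives. This forces \<open>t = j'\<close> and \<open>n = i\<close>.\<close>

lemma conj_\<delta>_weyl_coeff:
  fixes g :: "'k::alg_closed_field SL2"
  assumes p: "prime CHAR('k)" and j: "j < CHAR('k)" "j' < CHAR('k)" "j \<le> d"
    and n: "n * CHAR('k) + j' \<le> d" "i \<le> n"
  shows "adjoint (inverse g) (\<delta> i) (weyl_coeff d (n * CHAR('k) + j') j) =
    (if i = n \<and> j = j' then (- 2 * entry 1 1 g * entry 2 1 g) ^ (CHAR('k) * i) else 0)"
proof -
  define u where "u = adjoint (inverse g) (\<delta> i)"
  define I where "I = n * CHAR('k) + j'"
  define T where "T = {t. t \<le> I \<and> t \<le> j \<and> j - t \<le> d - I}"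
  define c where "c t = of_nat ((d - I) choose (j - t)) * (of_nat (I choose t) :: 'k)" for t
  define \<phi> where "\<phi> t x = entry 1 1 x ^ (d - I - (j - t)) * entry 1 2 x ^ (j - t) * entry 2 2 x ^ t"
    for t and x :: "'k SL2"
  have u: "u \<in> dual" unfolding u_def by (intro adjoint_dual \<delta>_dual)
  have fin: "finite T" unfolding T_def by (rule finite_subset[of _ "{..I}"]) auto
  have \<phi>: "\<phi> t \<in> regular" for t unfolding \<phi>_def by (intro regular_intros)
  have ap: "u (\<lambda>x. entry 2 1 x ^ s * \<phi> t x) = (if s = CHAR('k) * i then
    (- 2 * entry 1 1 g * entry 2 1 g) ^ (CHAR('k) * i) * \<phi> t 1 else 0)" if "CHAR('k) * i \<le> s" for s t
    using conj_\<delta>_apply(1)[OF \<phi>[of t], of i s g] conj_\<delta>_apply(2)[OF \<phi>[of t], of g i] that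
    unfolding u_def by auto
  have "weyl_coeff d I j = (\<lambda>x. \<Sum>t\<in>T. c t * (entry 2 1 x ^ (I - t) * \<phi> t x))"
    using n j unfolding T_def c_def \<phi>_def I_def
    by (intro ext) (subst weyl_coeff_alt, simp_all add: mult_ac)
  then have "u (weyl_coeff d I j) = (\<Sum>t\<in>T. c t * u (\<lambda>x. entry 2 1 x ^ (I - t) * \<phi> t x))"
    using fin \<phi> by (simp add: dual_sum[OF u] dual_scale[OF u] regular_intros)
  also have "\<dots> = (\<Sum>t\<in>T. if i = n \<and> t = j' \<and> j = j' then (- 2 * entry 1 1 g * entry 2 1 g) ^ (CHAR('k) * i) else 0)"
  proof (rule sum.cong[OF refl])
    fix t assume t: "t \<in> T"
    have c: "c t = of_nat ((d - I) choose (j - t)) * of_nat (j' choose t)"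
      using choose_CHAR[OF p, of t n j'] t j by (simp add: c_def I_def T_def)
    show "c t * u (\<lambda>x. entry 2 1 x ^ (I - t) * \<phi> t x) =
      (if i = n \<and> t = j' \<and> j = j' then (- 2 * entry 1 1 g * entry 2 1 g) ^ (CHAR('k) * i) else 0)"
    proof (cases "t \<le> j'")
      case False
      then have "c t = 0" using c by (simp add: binomial_eq_0)
      then show ?thesis using False by auto
    next
      case True
      have le: "CHAR('k) * i \<le> n * CHAR('k)" using n by (simp add: mult.commute)
      have It: "I - t = n * CHAR('k) + (j' - t)" using True by (simp add: I_def)
      have eq: "I - t = CHAR('k) * i \<longleftrightarrow> i = n \<and> t = j'"
      proof
        assume *: "I - t = CHAR('k) * i"
        then have "n * CHAR('k) = CHAR('k) * i" "j' = t" using le It True by linarith+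
        then show "i = n \<and> t = j'" using prime_gt_0_nat[OF p] by simp
      next
        assume "i = n \<and> t = j'"
        then show "I - t = CHAR('k) * i" using It by (simp add: mult.commute)
      qed
      show ?thesis
      proof (cases "i = n \<and> t = j'")
        case True
        then have "c t = of_nat ((d - I) choose (j - j'))" "j' \<le> j" using c t by (simp_all add: T_def)
        \<comment> \<open>\<open>x_12\<close> vanishes at 1, so its exponent \<open>j - j'\<close>
          must be 0; with \<open>j' \<le> j\<close> this means \<open>j = j'\<close>.\<close>
        moreover have "\<phi> j' 1 = (if j \<le> j' then 1 else 0)" by (simp add: \<phi>_def)
        ultimately show ?thesis using ap[of "I - t" t] le It eq True by auto
      next
        case False
        then show ?thesis using ap[of "I - t" t] le It eq by auto
      qed
    qed
  qed
  also have "\<dots> = (if i = n \<and> j = j' then (- 2 * entry 1 1 g * entry 2 1 g) ^ (CHAR('k) * i) else 0)"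
  proof (cases "i = n \<and> j = j'")
    case True
    then have "j' \<in> T" using n j by (auto simp: T_def I_def)
    then show ?thesis using True fin by simp
  qed auto
  finally show ?thesis by (simp add: u_def I_def)
qed

text \<open>Sequences supported on the first \<open>m\<close> blocks of length p:
  \<open>blocks 1\<close> models \<open>Z(a)\<close>, and \<open>blocks (l + 1)\<close> models
  \<open>W(d)\<close>.\<close>

definition blocks :: "nat \<Rightarrow> (nat \<Rightarrow> 'k::field) set" where
  "blocks m = {v. \<forall>i \<ge> m * CHAR('k). v i = 0}"

text \<open>By \<open>conj_\<delta>_weyl_coeff\<close> the rows in block \<open>i\<close> form a
  scalar matrix and those beyond it vanish. The bound on \<open>d\<close> places all of block
  \<open>i\<close> inside \<open>V(d)\<close>.\<close>

lemma conj_\<delta>_weyl_act: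
  fixes g :: "'k::alg_closed_field SL2"
  assumes p: "prime CHAR('k)" and z: "z \<in> blocks 1" and d: "(i + 1) * CHAR('k) \<le> d + 1"
  shows "weyl_act d (adjoint (inverse g) (\<delta> i)) z \<in> blocks (i + 1)"
    and "j < CHAR('k) \<Longrightarrow> weyl_act d (adjoint (inverse g) (\<delta> i)) z (i * CHAR('k) + j) =
      (- 2 * entry 1 1 g * entry 2 1 g) ^ (CHAR('k) * i) * z j"
proof -
  have act: "weyl_act d (adjoint (inverse g) (\<delta> i)) z (n * CHAR('k) + j') =
      (if i = n then (- 2 * entry 1 1 g * entry 2 1 g) ^ (CHAR('k) * i) * z j' else 0)"
    if j': "j' < CHAR('k)" and n: "n * CHAR('k) + j' \<le> d" "i \<le> n" for n j'
  proof -
    have "weyl_act d (adjoint (inverse g) (\<delta> i)) z (n * CHAR('k) + j') =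
      (\<Sum>j\<le>d. adjoint (inverse g) (\<delta> i) (weyl_coeff d (n * CHAR('k) + j') j) * z j)"
      using n by (simp add: weyl_act_def)
    also have "\<dots> = (\<Sum>j\<le>d. if j = j' then (if i = n then (- 2 * entry 1 1 g * entry 2 1 g) ^ (CHAR('k) * i) * z j' else 0) else 0)"
    proof (intro sum.cong refl)
      fix j assume "j \<in> {..d}"
      then show "adjoint (inverse g) (\<delta> i) (weyl_coeff d (n * CHAR('k) + j') j) * z j =
        (if j = j' then (if i = n then (- 2 * entry 1 1 g * entry 2 1 g) ^ (CHAR('k) * i) * z j' else 0) else 0)"
        using conj_\<delta>_weyl_coeff[OF p _ j' _ n, of j g] z j' by (cases "j < CHAR('k)") (auto simp: blocks_def)
    qed
    also have "\<dots> = (if i = n then (- 2 * entry 1 1 g * entry 2 1 g) ^ (CHAR('k) * i) * z j' else 0)"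
      using n by simp
    finally show ?thesis .
  qed
  show "weyl_act d (adjoint (inverse g) (\<delta> i)) z \<in> blocks (i + 1)"
    unfolding blocks_def
  proof (intro CollectI allI impI)
    fix I assume I: "(i + 1) * CHAR('k) \<le> I"
    show "weyl_act d (adjoint (inverse g) (\<delta> i)) z I = 0"
    proof (cases "I \<le> d")
      case True
      \<comment> \<open>Index \<open>I\<close> belongs to block \<open>I div p\<close>, which lies
        strictly beyond block \<open>i\<close>.\<close>
      have "i + 1 \<le> I div CHAR('k)"
        using I prime_gt_0_nat[OF p] by (simp add: less_eq_div_iff_mult_less_eq)
      then show ?thesis
        using act[of "I mod CHAR('k)" "I div CHAR('k)"] True prime_gt_0_nat[OF p] by simp
    qed (simp add: weyl_act_def)
  qed
  show "weyl_act d (adjoint (inverse g) (\<delta> i)) z (i * CHAR('k) + j) =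
      (- 2 * entry 1 1 g * entry 2 1 g) ^ (CHAR('k) * i) * z j" if "j < CHAR('k)"
    using act[OF that, of i] that d by (simp add: algebra_simps)
qed

text \<open>Back substitution from the last block: \<open>y\<close> is chosen to reproduce that
  block of \<open>v\<close>, and the remainder lives on the first \<open>m\<close> blocks.\<close>

lemma block_triangular_ex:
  fixes L :: "nat \<Rightarrow> (nat \<Rightarrow> 'k::field) \<Rightarrow> (nat \<Rightarrow> 'k)"
  assumes L: "\<And>i z. i < m \<Longrightarrow> z \<in> blocks 1 \<Longrightarrow> L i z \<in> blocks (i + 1)"
    "\<And>i z j. i < m \<Longrightarrow> z \<in> blocks 1 \<Longrightarrow> j < CHAR('k) \<Longrightarrow> L i z (i * CHAR('k) + j) = c i * z j"
    and c: "\<And>i. c i \<noteq> 0" and v: "v \<in> blocks m"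
  shows "\<exists>z. (\<forall>i. z i \<in> blocks 1) \<and> v = (\<lambda>I. \<Sum>i<m. L i (z i) I)"
  using L v
proof (induction m arbitrary: v)
  case 0
  then have "v = (\<lambda>_. 0)" by (auto simp: blocks_def)
  then show ?case by (intro exI[of _ "\<lambda>_ _. 0"]) (simp add: blocks_def)
next
  case (Suc m)
  define y where "y j = (if j < CHAR('k) then v (m * CHAR('k) + j) / c m else 0)" for j
  have y: "y \<in> blocks 1" by (simp add: y_def blocks_def)
  define w where "w I = v I - L m y I" for I
  have "w \<in> blocks m"
    unfolding blocks_def
  proof (intro CollectI allI impI)
    fix I assume I: "m * CHAR('k) \<le> I"
    show "w I = 0"
    proof (cases "I < (m + 1) * CHAR('k)")
      case True
      define j where "j = I - m * CHAR('k)"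
      have j: "j < CHAR('k)" "I = m * CHAR('k) + j"
        using I True by (auto simp: algebra_simps j_def)
      have "L m y I = c m * y j"
        unfolding j(2) by (rule Suc.prems(2)[OF _ y j(1)]) simp
      then show ?thesis
        using c[of m] j(1) by (simp add: w_def y_def j(2))
    next
      case False
      then have "(m + 1) * CHAR('k) \<le> I" by simp
      then show ?thesis
        using Suc.prems(1)[of m y] Suc.prems(3) y unfolding w_def blocks_def Suc_eq_plus1 by simp
    qed
  qed
  then obtain z where z: "\<forall>i. z i \<in> blocks 1" "w = (\<lambda>I. \<Sum>i<m. L i (z i) I)"
    using Suc.IH[of w] Suc.prems(1,2) less_SucI by blast
  have "v = (\<lambda>I. w I + L m y I)" by (simp add: w_def)
  then show ?case
    using z y by (intro exI[of _ "z(m := y)"]) auto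
qed

text \<open>In the last block only the last summand is nonzero, which determines its argument; that
  summand then cancels and the induction descends.\<close>

lemma block_triangular_unique:
  fixes L :: "nat \<Rightarrow> (nat \<Rightarrow> 'k::field) \<Rightarrow> (nat \<Rightarrow> 'k)"
  assumes L: "\<And>i z. i < m \<Longrightarrow> z \<in> blocks 1 \<Longrightarrow> L i z \<in> blocks (i + 1)"
    "\<And>i z j. i < m \<Longrightarrow> z \<in> blocks 1 \<Longrightarrow> j < CHAR('k) \<Longrightarrow> L i z (i * CHAR('k) + j) = c i * z j"
    and c: "\<And>i. c i \<noteq> 0"
    and z: "\<And>i. i < m \<Longrightarrow> z i \<in> blocks 1" "\<And>i. i < m \<Longrightarrow> z' i \<in> blocks 1"
    and eq: "\<And>I. (\<Sum>i<m. L i (z i) I) = (\<Sum>i<m. L i (z' i) I)"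
  shows "\<forall>i<m. z i = z' i"
  using L z eq
proof (induction m)
  case (Suc m)
  have top: "(\<Sum>i<Suc m. L i (y i) (m * CHAR('k) + j)) = c m * y m j"
    if j: "j < CHAR('k)" and y: "\<And>i. i < Suc m \<Longrightarrow> y i \<in> blocks 1" for y j
  proof -
    have "L i (y i) (m * CHAR('k) + j) = 0" if "i < m" for i
    proof -
      have "(i + 1) * CHAR('k) \<le> m * CHAR('k)" using that by (intro mult_right_mono) auto
      then have "(i + 1) * CHAR('k) \<le> m * CHAR('k) + j" by linarith
      then show ?thesis using Suc.prems(1)[of i "y i"] y[of i] that unfolding blocks_def by simp
    qed
    then show ?thesis using Suc.prems(2)[of m "y m" j] y[of m] j by simp
  qed
  have zm: "z m = z' m"
  proof
    fix j
    show "z m j = z' m j"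
    proof (cases "j < CHAR('k)")
      case True
      then show ?thesis
        using top[OF True, of z] top[OF True, of z'] Suc.prems(3-5) c[of m] by simp
    next
      case False
      then show ?thesis using Suc.prems(3,4)[of m] by (simp add: blocks_def)
    qed
  qed
  then have "\<forall>i<m. z i = z' i"
    using Suc.prems by (intro Suc.IH) auto
  then show ?case using zm by (simp add: less_Suc_eq)
qed simp

section \<open>Tensor products\<close>

text \<open>A coset in the free abelian group does not depend on the generating set, which restricts
  only the carrier. So \<open>H_l\<close> and the whole group algebra can share one
  notation.\<close>

definition frag_coset :: "('x \<Rightarrow>\<^sub>0 int) set \<Rightarrow> ('x \<Rightarrow>\<^sub>0 int) \<Rightarrow> ('x \<Rightarrow>\<^sub>0 int) set" where
  "frag_coset K c = (\<lambda>k. k + c) ` K"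

lemma r_coset_free_Abelian_group: "K #>\<^bsub>free_Abelian_group S\<^esub> c = frag_coset K c"
  by (auto simp: r_coset_def frag_coset_def)

section \<open>Additive maps out of free abelian groups\<close>

definition frag_lin :: "('x \<Rightarrow> 'k::comm_ring_1) \<Rightarrow> ('x \<Rightarrow>\<^sub>0 int) \<Rightarrow> 'k" where
  "frag_lin \<phi> c = (\<Sum>x\<in>Poly_Mapping.keys c. of_int (Poly_Mapping.lookup c x) * \<phi> x)"

lemma frag_lin_superset:
  "finite T \<Longrightarrow> Poly_Mapping.keys c \<subseteq> T \<Longrightarrow>
    frag_lin \<phi> c = (\<Sum>x\<in>T. of_int (Poly_Mapping.lookup c x) * \<phi> x)"
  unfolding frag_lin_def by (intro sum.mono_neutral_left) (auto simp: in_keys_iff)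

lemma frag_lin_0 [simp]: "frag_lin \<phi> 0 = 0"
  by (simp add: frag_lin_def)

lemma frag_lin_frag_of [simp]: "frag_lin \<phi> (frag_of x) = \<phi> x"
  by (simp add: frag_lin_def)

lemma frag_lin_diff: "frag_lin \<phi> (a - b) = frag_lin \<phi> a - frag_lin \<phi> b"
proof -
  let ?T = "Poly_Mapping.keys a \<union> Poly_Mapping.keys b"
  show ?thesis
    using keys_diff[of a b]
    by (subst (1 2 3) frag_lin_superset[of ?T])
      (auto simp: lookup_minus algebra_simps sum_subtractf)
qed

lemma frag_lin_minus: "frag_lin \<phi> (- a) = - frag_lin \<phi> a"
  using frag_lin_diff[of \<phi> 0 a] by simp

lemma frag_lin_add: "frag_lin \<phi> (a + b) = frag_lin \<phi> a + frag_lin \<phi> b"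
  using frag_lin_diff[of \<phi> a "- b"] by (simp add: frag_lin_minus)

lemma frag_lin_sum: "frag_lin \<phi> (\<Sum>i\<in>S. c i) = (\<Sum>i\<in>S. frag_lin \<phi> (c i))"
  by (induction S rule: infinite_finite_induct) (simp_all add: frag_lin_add)

lemma frag_lin_extend: "frag_lin \<phi> (frag_extend (\<lambda>x. frag_of (F x)) c) = frag_lin (\<lambda>x. \<phi> (F x)) c"
  using subset_UNIV
  by (induction c rule: frag_induction) (auto simp: frag_extend_diff frag_lin_diff)

lemma frag_lin_cong:
  "(\<And>x. x \<in> Poly_Mapping.keys c \<Longrightarrow> \<phi> x = \<psi> x) \<Longrightarrow> frag_lin \<phi> c = frag_lin \<psi> c"
  by (simp add: frag_lin_def)

lemma keys_sum_frag_of: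
  assumes "\<And>i. i \<in> T \<Longrightarrow> x i \<in> S"
  shows "Poly_Mapping.keys (\<Sum>i\<in>T. frag_of (x i)) \<subseteq> S"
  by (rule order.trans[OF keys_sum]) (use assms in auto)

lemma weyl_act_frag_lin:
  "weyl_act d u (\<lambda>i. frag_lin (\<lambda>x. \<phi> x i) c) = (\<lambda>i. frag_lin (\<lambda>x. weyl_act d u (\<phi> x) i) c)"
  by (simp add: frag_lin_def weyl_act_sum_right weyl_act_times_right)

text \<open>The map induced on a quotient, taken at a chosen representative; by
  \<open>coset_value_eq\<close> the choice is immaterial once the subgroup is sent to 0.\<close>

definition coset_value :: "('x \<Rightarrow> nat \<Rightarrow> 'k::comm_ring_1) \<Rightarrow> ('x \<Rightarrow>\<^sub>0 int) set \<Rightarrow> nat \<Rightarrow> 'k" where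
  "coset_value \<phi> X = (\<lambda>i. frag_lin (\<lambda>x. \<phi> x i) (SOME c. c \<in> X))"

lemma coset_value_eq:
  assumes "0 \<in> K" "\<And>k i. k \<in> K \<Longrightarrow> frag_lin (\<lambda>x. \<phi> x i) k = 0"
  shows "coset_value \<phi> (frag_coset K c) = (\<lambda>i. frag_lin (\<lambda>x. \<phi> x i) c)"
proof -
  have "0 + c \<in> frag_coset K c" using assms(1) by (auto simp: frag_coset_def)
  then have "(SOME c'. c' \<in> frag_coset K c) \<in> frag_coset K c" by (rule someI)
  then obtain k where "k \<in> K" "(SOME c'. c' \<in> frag_coset K c) = k + c"
    by (auto simp: frag_coset_def)
  then show ?thesis by (simp add: coset_value_def frag_lin_add assms(2))
qed

text \<open>Serves the baby Verma module, with \<open>R = U0_b\<close>, as well as the induced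
  modules, with \<open>R = frob_dist 1\<close>. The assumptions on \<open>Z\<close> are of the form
  that \<open>tensor_module\<close> establishes for the result, so the construction can be
  iterated.\<close>

locale tensor_product =
  fixes I :: "('k::field SL2 \<Rightarrow> 'k) set" and R H :: "'k functional set"
    and Z :: "('k functional, 'z) module"
  assumes H_dual: "H \<subseteq> dual" and R_dual: "R \<subseteq> dual"
    and H_zero: "(\<lambda>_. 0) \<in> H"
    and H_add: "h \<in> H \<Longrightarrow> h' \<in> H \<Longrightarrow> (\<lambda>f. h f + h' f) \<in> H"
    and H_mult: "h \<in> H \<Longrightarrow> r \<in> R \<Longrightarrow> convolution h r \<in> H"
    and Z_zero: "\<zero>\<^bsub>Z\<^esub> \<in> carrier Z" "\<zero>\<^bsub>Z\<^esub> \<oplus>\<^bsub>Z\<^esub> \<zero>\<^bsub>Z\<^esub> = \<zero>\<^bsub>Z\<^esub>"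
    and Z_add: "z \<in> carrier Z \<Longrightarrow> z' \<in> carrier Z \<Longrightarrow> z \<oplus>\<^bsub>Z\<^esub> z' \<in> carrier Z"
    and Z_neg: "z \<in> carrier Z \<Longrightarrow> \<exists>z'\<in>carrier Z. z \<oplus>\<^bsub>Z\<^esub> z' = \<zero>\<^bsub>Z\<^esub>"
    and Z_smult: "r \<in> R \<Longrightarrow> z \<in> carrier Z \<Longrightarrow> r \<odot>\<^bsub>Z\<^esub> z \<in> carrier Z"
begin

abbreviation "S \<equiv> H \<times> carrier Z"
abbreviation "rel \<equiv> tensor_relations (group_algebra I) R H Z"
abbreviation "K \<equiv> tensor_kernel (group_algebra I) R H Z"
abbreviation "M \<equiv> tensor (group_algebra I) R H Z"

lemma rel_keys: "c \<in> rel \<Longrightarrow> Poly_Mapping.keys c \<subseteq> S"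
  unfolding tensor_relations_def
  by (auto simp: H_add H_mult Z_add Z_smult dest!: subsetD[OF keys_diff])

lemma subgroup_K: "subgroup K (free_Abelian_group S)"
  unfolding tensor_kernel_def
  by (rule group.generate_is_subgroup, simp, rule subsetI) (simp add: rel_keys)

lemma K_keys: "c \<in> K \<Longrightarrow> Poly_Mapping.keys c \<subseteq> S"
  using subgroup.subset[OF subgroup_K, THEN subsetD, of c] by simp

lemma K_zero: "0 \<in> K"
  using subgroup.one_closed[OF subgroup_K] by simp

lemma K_add: "a \<in> K \<Longrightarrow> b \<in> K \<Longrightarrow> a + b \<in> K"
  using subgroup.m_closed[OF subgroup_K] by simp

lemma K_uminus: "a \<in> K \<Longrightarrow> - a \<in> K"
  using subgroup.m_inv_closed[OF subgroup_K, of a] K_keys[of a] by simp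

lemma K_diff: "a \<in> K \<Longrightarrow> b \<in> K \<Longrightarrow> a - b \<in> K"
  using K_add[of a "- b"] K_uminus by simp

lemma K_sum: "(\<And>i. i \<in> T \<Longrightarrow> c i \<in> K) \<Longrightarrow> (\<Sum>i\<in>T. c i) \<in> K"
  by (induction T rule: infinite_finite_induct) (auto simp: K_zero K_add)

lemma rel_K: "c \<in> rel \<Longrightarrow> c \<in> K"
  unfolding tensor_kernel_def by (rule generate.incl)

text \<open>Replaces the case of inverted generators in \<open>generate\<close> by closure under
  negation, the form in which additive maps are checked.\<close>

lemma K_induct:
  assumes "c \<in> K" "P 0" "\<And>r. r \<in> rel \<Longrightarrow> P r" "\<And>a. P a \<Longrightarrow> P (- a)" "\<And>a b. P a \<Longrightarrow> P b \<Longrightarrow> P (a + b)"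
  shows "P c"
  using assms(1) unfolding tensor_kernel_def
proof induction
  case (inv h)
  then show ?case using assms(3,4) rel_keys[of h] by simp
qed (use assms in auto)

lemma K_add_left:
  "h \<in> H \<Longrightarrow> h' \<in> H \<Longrightarrow> z \<in> carrier Z \<Longrightarrow>
    frag_of (\<lambda>f. h f + h' f, z) - frag_of (h, z) - frag_of (h', z) \<in> K"
  by (rule rel_K) (auto simp: tensor_relations_def)

lemma K_add_right:
  "h \<in> H \<Longrightarrow> z \<in> carrier Z \<Longrightarrow> z' \<in> carrier Z \<Longrightarrow>
    frag_of (h, z \<oplus>\<^bsub>Z\<^esub> z') - frag_of (h, z) - frag_of (h, z') \<in> K"
  by (rule rel_K) (auto simp: tensor_relations_def)

lemma K_balanced:
  "h \<in> H \<Longrightarrow> r \<in> R \<Longrightarrow> z \<in> carrier Z \<Longrightarrow>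
    frag_of (convolution h r, z) - frag_of (h, r \<odot>\<^bsub>Z\<^esub> z) \<in> K"
  by (rule rel_K) (auto simp: tensor_relations_def)

lemma K_zero_left: "z \<in> carrier Z \<Longrightarrow> frag_of (\<lambda>_. 0, z) \<in> K"
  using K_uminus[OF K_add_left[OF H_zero H_zero, of z]] by simp

lemma K_zero_right: "h \<in> H \<Longrightarrow> frag_of (h, \<zero>\<^bsub>Z\<^esub>) \<in> K"
  using K_uminus[OF K_add_right[OF _ Z_zero(1) Z_zero(1), of h]] Z_zero(2) by simp

lemma frag_coset_eq_iff: "frag_coset K c = frag_coset K c' \<longleftrightarrow> c - c' \<in> K"
proof
  assume "frag_coset K c = frag_coset K c'"
  then have "0 + c \<in> frag_coset K c'" using K_zero by (auto simp: frag_coset_def)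
  then obtain k where "k \<in> K" "c = k + c'" by (auto simp: frag_coset_def)
  then show "c - c' \<in> K" by simp
next
  assume "c - c' \<in> K"
  have sub: "frag_coset K a \<subseteq> frag_coset K b" if "a - b \<in> K" for a b
  proof
    fix x assume "x \<in> frag_coset K a"
    then obtain k where "k \<in> K" "x = (k + (a - b)) + b" by (auto simp: frag_coset_def)
    then show "x \<in> frag_coset K b" unfolding frag_coset_def using K_add[OF _ that] by blast
  qed
  show "frag_coset K c = frag_coset K c'"
    using sub[OF \<open>c - c' \<in> K\<close>] sub[of c' c] K_uminus[OF \<open>c - c' \<in> K\<close>] by simp
qed

lemma carrier_M: "carrier M = frag_coset K ` {c. Poly_Mapping.keys c \<subseteq> S}"
  by (auto simp: tensor_def Let_def FactGroup_def RCOSETS_def r_coset_free_Abelian_group)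

lemma set_mult_frag_coset:
  "frag_coset K c <#>\<^bsub>free_Abelian_group S'\<^esub> frag_coset K c' = frag_coset K (c + c')"
proof (intro equalityI subsetI)
  fix x assume "x \<in> frag_coset K c <#>\<^bsub>free_Abelian_group S'\<^esub> frag_coset K c'"
  then obtain k k' where "k \<in> K" "k' \<in> K" "x = (k + c) + (k' + c')"
    by (auto simp: set_mult_def frag_coset_def)
  then have "k + k' \<in> K" "x = (k + k') + (c + c')" by (auto simp: K_add)
  then show "x \<in> frag_coset K (c + c')" by (auto simp: frag_coset_def)
next
  fix x assume "x \<in> frag_coset K (c + c')"
  then obtain k where "k \<in> K" "x = (k + c) + (0 + c')" by (auto simp: frag_coset_def add.assoc)
  moreover have "0 + c' \<in> frag_coset K c'" unfolding frag_coset_def using K_zero by blast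
  ultimately show "x \<in> frag_coset K c <#>\<^bsub>free_Abelian_group S'\<^esub> frag_coset K c'"
    unfolding set_mult_def frag_coset_def[of K c] by auto
qed

lemma add_M: "frag_coset K c \<oplus>\<^bsub>M\<^esub> frag_coset K c' = frag_coset K (c + c')"
  by (simp add: tensor_def Let_def FactGroup_def set_mult_frag_coset)

lemma zero_M: "\<zero>\<^bsub>M\<^esub> = frag_coset K 0"
  by (simp add: tensor_def Let_def FactGroup_def frag_coset_def)

definition act :: "'k functional \<Rightarrow> ('k functional \<times> 'z \<Rightarrow>\<^sub>0 int) \<Rightarrow> ('k functional \<times> 'z \<Rightarrow>\<^sub>0 int)" where
  "act s = frag_extend (\<lambda>x. frag_of (convolution s (fst x), snd x))"

text \<open>\<open>act s\<close> preserves each type of relation, the balanced one by associativity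
  of convolution, and therefore descends to the quotient.\<close>

lemma smult_M:
  assumes s: "s \<in> dual" and sH: "\<And>h. h \<in> H \<Longrightarrow> convolution s h \<in> H"
  shows "s \<odot>\<^bsub>M\<^esub> frag_coset K c = frag_coset K (act s c)"
proof -
  have rel: "act s r \<in> rel" if r: "r \<in> rel" for r
  proof -
    consider (1) h h' z where "r = frag_of (\<lambda>f. h f + h' f, z) - frag_of (h, z) - frag_of (h', z)"
        "h \<in> H" "h' \<in> H" "z \<in> carrier Z"
      | (2) h z z' where "r = frag_of (h, z \<oplus>\<^bsub>Z\<^esub> z') - frag_of (h, z) - frag_of (h, z')"
        "h \<in> H" "z \<in> carrier Z" "z' \<in> carrier Z"
      | (3) h t z where "r = frag_of (convolution h t, z) - frag_of (h, t \<odot>\<^bsub>Z\<^esub> z)"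
        "h \<in> H" "t \<in> R" "z \<in> carrier Z"
      using r by (auto simp: tensor_relations_def)
    then show ?thesis
    proof cases
      case 1
      have "convolution s (\<lambda>f. h f + h' f) = (\<lambda>f. convolution s h f + convolution s h' f)"
        using 1 H_dual s by (intro convolution_plus_right) auto
      then have "act s r = frag_of (\<lambda>f. convolution s h f + convolution s h' f, z) -
        frag_of (convolution s h, z) - frag_of (convolution s h', z)"
        by (simp add: 1(1) act_def frag_extend_diff)
      then show ?thesis
        using 1 sH unfolding tensor_relations_def group_algebra_simps by blast
    next
      case 2
      have "act s r = frag_of (convolution s h, z \<oplus>\<^bsub>Z\<^esub> z') -
        frag_of (convolution s h, z) - frag_of (convolution s h, z')"
        by (simp add: 2(1) act_def frag_extend_diff)
      then show ?thesis
        using 2 sH unfolding tensor_relations_def group_algebra_simps by blast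
    next
      case 3
      have "convolution s (convolution h t) = convolution (convolution s h) t"
        using 3 H_dual R_dual s by (intro convolution_assoc[symmetric]) auto
      then have "act s r = frag_of (convolution (convolution s h) t, z) -
        frag_of (convolution s h, t \<odot>\<^bsub>Z\<^esub> z)"
        by (simp add: 3(1) act_def frag_extend_diff)
      then show ?thesis
        using 3 sH unfolding tensor_relations_def group_algebra_simps by blast
    qed
  qed
  have act_add: "act s (a + b) = act s a + act s b" for a b
    by (simp add: act_def frag_extend_add)
  have K: "act s k \<in> K" if "k \<in> K" for k
    using that
    by (rule K_induct) (auto simp: act_def frag_extend_minus frag_extend_add K_zero K_uminus K_add
        intro: rel_K[OF rel, unfolded act_def])
  have "s \<odot>\<^bsub>M\<^esub> frag_coset K c = (\<Union>x\<in>frag_coset K c. frag_coset K (act s x))"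
    by (simp add: tensor_def Let_def r_coset_free_Abelian_group act_def case_prod_unfold)
  \<comment> \<open>All representatives give the same coset, so the union in the definition of
    \<open>smult\<close> collapses.\<close>
  also have "\<dots> = (\<Union>x\<in>frag_coset K c. frag_coset K (act s c))"
  proof (rule SUP_cong[OF refl])
    fix x assume "x \<in> frag_coset K c"
    then obtain k where "k \<in> K" "x = k + c" by (auto simp: frag_coset_def)
    then show "frag_coset K (act s x) = frag_coset K (act s c)"
      using K[of k] by (simp add: frag_coset_eq_iff act_add)
  qed
  also have "\<dots> = frag_coset K (act s c)"
    using K_zero by (auto simp: frag_coset_def)
  finally show ?thesis .
qed

lemma act_keys:
  assumes "\<And>h. h \<in> H \<Longrightarrow> convolution s h \<in> H" "Poly_Mapping.keys c \<subseteq> S"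
  shows "Poly_Mapping.keys (act s c) \<subseteq> S"
  using keys_frag_extend[of "\<lambda>x. frag_of (convolution s (fst x), snd x)" c] assms
  unfolding act_def by fastforce

text \<open>The universal property: a biadditive balanced map factors through the tensor
  product.\<close>

lemma frag_lin_K:
  fixes \<phi> :: "'k functional \<times> 'z \<Rightarrow> 'k"
  assumes "\<And>h h' z. h \<in> H \<Longrightarrow> h' \<in> H \<Longrightarrow> z \<in> carrier Z \<Longrightarrow> \<phi> (\<lambda>f. h f + h' f, z) = \<phi> (h, z) + \<phi> (h', z)"
    and "\<And>h z z'. h \<in> H \<Longrightarrow> z \<in> carrier Z \<Longrightarrow> z' \<in> carrier Z \<Longrightarrow> \<phi> (h, z \<oplus>\<^bsub>Z\<^esub> z') = \<phi> (h, z) + \<phi> (h, z')"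
    and "\<And>h r z. h \<in> H \<Longrightarrow> r \<in> R \<Longrightarrow> z \<in> carrier Z \<Longrightarrow> \<phi> (convolution h r, z) = \<phi> (h, r \<odot>\<^bsub>Z\<^esub> z)"
    and "k \<in> K"
  shows "frag_lin \<phi> k = 0"
  using assms(4)
proof (rule K_induct)
  fix r assume "r \<in> rel"
  then show "frag_lin \<phi> r = 0"
    unfolding tensor_relations_def group_algebra_simps
    using assms(1-3) by (auto simp: frag_lin_diff)
qed (auto simp: frag_lin_minus frag_lin_add)

text \<open>Coefficients are moved across the tensor sign. Left factors come from a subset
  \<open>H'\<close> while the relations are those over \<open>H\<close>; in this way
  \<open>N_l\<close> is handled inside the full induced module.\<close>

lemma normal_form:
  fixes n :: nat and e :: "nat \<Rightarrow> 'k functional"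
  assumes e: "\<And>i. i < n \<Longrightarrow> e i \<in> H"
    and H': "H' \<subseteq> H" "\<And>h. h \<in> H' \<Longrightarrow> \<exists>r. (\<forall>i. r i \<in> R) \<and> h = (\<lambda>f. \<Sum>i<n. convolution (e i) (r i) f)"
    and c: "Poly_Mapping.keys c \<subseteq> H' \<times> carrier Z"
  shows "\<exists>z. (\<forall>i. z i \<in> carrier Z) \<and> c - (\<Sum>i<n. frag_of (e i, z i)) \<in> K"
  using c
proof (induction c rule: frag_induction)
  case zero
  have "- (\<Sum>i<n. frag_of (e i, \<zero>\<^bsub>Z\<^esub>)) \<in> K"
    using e by (intro K_uminus K_sum K_zero_right) auto
  then show ?case using Z_zero(1) by (intro exI[of _ "\<lambda>_. \<zero>\<^bsub>Z\<^esub>"]) simp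
next
  case (one x)
  obtain h z where x: "x = (h, z)" "h \<in> H'" "z \<in> carrier Z" using one by auto
  obtain r where r: "\<And>i. r i \<in> R" "h = (\<lambda>f. \<Sum>i<n. convolution (e i) (r i) f)"
    using H'(2)[OF x(2)] by blast
  have sum: "(\<lambda>f. \<Sum>i<m. convolution (e i) (r i) f) \<in> H \<and>
    frag_of (\<lambda>f. \<Sum>i<m. convolution (e i) (r i) f, z) -
    (\<Sum>i<m. frag_of (convolution (e i) (r i), z)) \<in> K" if "m \<le> n" for m
    using that
  proof (induction m)
    case 0
    then show ?case using H_zero K_zero_left[OF x(3)] by simp
  next
    case (Suc m)
    let ?s = "\<lambda>f. \<Sum>i<m. convolution (e i) (r i) f"
    have m: "convolution (e m) (r m) \<in> H" using Suc(2) e r(1) by (intro H_mult) auto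
    have s: "?s \<in> H" using Suc by simp
    have "(frag_of (\<lambda>f. ?s f + convolution (e m) (r m) f, z) - frag_of (?s, z) -
        frag_of (convolution (e m) (r m), z)) +
      (frag_of (?s, z) - (\<Sum>i<m. frag_of (convolution (e i) (r i), z))) \<in> K"
      using Suc by (intro K_add K_add_left[OF s m x(3)]) simp
    then show ?case using H_add[OF s m] by (simp add: algebra_simps)
  qed
  have "(frag_of (h, z) - (\<Sum>i<n. frag_of (convolution (e i) (r i), z))) +
    (\<Sum>i<n. frag_of (convolution (e i) (r i), z) - frag_of (e i, r i \<odot>\<^bsub>Z\<^esub> z)) \<in> K"
    using sum[of n] e r x by (intro K_add K_sum K_balanced) auto
  then show ?case
    using Z_smult[OF r(1) x(3)]
    by (intro exI[of _ "\<lambda>i. r i \<odot>\<^bsub>Z\<^esub> z"]) (simp add: sum_subtractf x(1))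
next
  case (diff a b)
  from diff obtain z where z: "\<And>i. z i \<in> carrier Z" "a - (\<Sum>i<n. frag_of (e i, z i)) \<in> K" by blast
  from diff obtain z' where z': "\<And>i. z' i \<in> carrier Z" "b - (\<Sum>i<n. frag_of (e i, z' i)) \<in> K" by blast
  obtain y where y: "\<And>i. y i \<in> carrier Z" "\<And>i. z' i \<oplus>\<^bsub>Z\<^esub> y i = \<zero>\<^bsub>Z\<^esub>"
    using Z_neg[OF z'(1)] by metis
  \<comment> \<open>\<open>y i\<close> is an additive inverse of \<open>z' i\<close>; the relations
    combine to make \<open>e_i \<otimes> (z_i + y_i)\<close> the difference of the two
    tensors.\<close>
  have t: "(frag_of (e i, z i \<oplus>\<^bsub>Z\<^esub> y i) - frag_of (e i, z i) - frag_of (e i, y i)) -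
      (frag_of (e i, z' i \<oplus>\<^bsub>Z\<^esub> y i) - frag_of (e i, z' i) - frag_of (e i, y i)) +
      frag_of (e i, z' i \<oplus>\<^bsub>Z\<^esub> y i) \<in> K" if "i < n" for i
    using K_zero_right[OF e[OF that]] y(2)
    by (intro K_add K_diff[OF K_add_right K_add_right]) (simp_all add: e[OF that] z z' y(1))
  from K_diff[OF K_diff[OF z(2) z'(2)] K_sum[OF t, of "{..<n}" id, simplified]]
  have "a - b - (\<Sum>i<n. frag_of (e i, z i \<oplus>\<^bsub>Z\<^esub> y i)) \<in> K"
    by (simp add: y(2) sum_subtractf sum.distrib algebra_simps)
  then show ?case using Z_add z(1) y(1) by (intro exI[of _ "\<lambda>i. z i \<oplus>\<^bsub>Z\<^esub> y i"]) auto
qed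

lemma tensor_module:
  shows "\<zero>\<^bsub>M\<^esub> \<in> carrier M" "\<zero>\<^bsub>M\<^esub> \<oplus>\<^bsub>M\<^esub> \<zero>\<^bsub>M\<^esub> = \<zero>\<^bsub>M\<^esub>"
    and "X \<in> carrier M \<Longrightarrow> Y \<in> carrier M \<Longrightarrow> X \<oplus>\<^bsub>M\<^esub> Y \<in> carrier M"
    and "X \<in> carrier M \<Longrightarrow> \<exists>Y\<in>carrier M. X \<oplus>\<^bsub>M\<^esub> Y = \<zero>\<^bsub>M\<^esub>"
    and "s \<in> dual \<Longrightarrow> (\<And>h. h \<in> H \<Longrightarrow> convolution s h \<in> H) \<Longrightarrow> X \<in> carrier M \<Longrightarrow> s \<odot>\<^bsub>M\<^esub> X \<in> carrier M"
proof -
  show "\<zero>\<^bsub>M\<^esub> \<in> carrier M" by (auto simp: zero_M carrier_M)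
  show "\<zero>\<^bsub>M\<^esub> \<oplus>\<^bsub>M\<^esub> \<zero>\<^bsub>M\<^esub> = \<zero>\<^bsub>M\<^esub>" by (simp add: zero_M add_M)
  show "X \<oplus>\<^bsub>M\<^esub> Y \<in> carrier M" if XY: "X \<in> carrier M" "Y \<in> carrier M"
  proof -
    obtain c c' where c: "X = frag_coset K c" "Y = frag_coset K c'" "Poly_Mapping.keys c \<subseteq> S" "Poly_Mapping.keys c' \<subseteq> S"
      using XY by (auto simp: carrier_M)
    then have "Poly_Mapping.keys (c + c') \<subseteq> S" using keys_add[of c c'] by blast
    then show ?thesis by (auto simp: c add_M carrier_M)
  qed
  show "\<exists>Y\<in>carrier M. X \<oplus>\<^bsub>M\<^esub> Y = \<zero>\<^bsub>M\<^esub>" if X: "X \<in> carrier M"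
  proof -
    obtain c where c: "X = frag_coset K c" "Poly_Mapping.keys c \<subseteq> S"
      using X by (auto simp: carrier_M)
    then have "frag_coset K (- c) \<in> carrier M" by (auto simp: carrier_M)
    then show ?thesis by (intro bexI[of _ "frag_coset K (- c)"]) (simp_all add: c(1) add_M zero_M)
  qed
  show "s \<odot>\<^bsub>M\<^esub> X \<in> carrier M"
    if s: "s \<in> dual" "\<And>h. h \<in> H \<Longrightarrow> convolution s h \<in> H" and X: "X \<in> carrier M"
  proof -
    obtain c where c: "X = frag_coset K c" "Poly_Mapping.keys c \<subseteq> S"
      using X by (auto simp: carrier_M)
    then show ?thesis using smult_M[OF s] act_keys[OF s(2)] by (auto simp: carrier_M)
  qed
qed

end

section \<open>The baby Verma module inside the Weyl module\<close>

lemma frob_dist_1_convolution: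
  assumes "prime CHAR('k::field)" "(u :: 'k functional) \<in> frob_dist 1" "v \<in> frob_dist 1"
  shows "convolution u v \<in> frob_dist 1"
  using frob_dist_convolution(1)[OF assms(1,3,2)] .

lemma U0_b_dist:
  assumes "prime CHAR('k::alg_closed_field)" "(b :: 'k functional) \<in> U0_b" shows "b \<in> frob_dist 1"
  using assms(2) by (simp add: borel_dist_def flip: borel_dist_eq[OF assms(1)])

lemma k_char_simps [simp]:
  "carrier (k_char a) = UNIV" "\<zero>\<^bsub>k_char a\<^esub> = 0" "c \<oplus>\<^bsub>k_char a\<^esub> c' = c + c'"
  "u \<odot>\<^bsub>k_char a\<^esub> c = u (\<lambda>x. entry 1 1 x ^ a) * c"
  by (simp_all add: k_char_def)

lemma tensor_product_baby_verma:
  assumes p: "prime CHAR('k::alg_closed_field)"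
  shows "tensor_product (U0_b :: 'k functional set) (frob_dist 1) (k_char a)"
  using U0_b_dist[OF p] frob_dist_1_convolution[OF p]
  by unfold_locales (auto intro: frob_dist_dual frob_dist_zero frob_dist_plus
      exI[of _ "- c" for c :: 'k])

text \<open>The homomorphism from \<open>Z(a)\<close> to \<open>V(d)\<close> that sends the
  canonical generator to \<open>v_0\<close>.\<close>

definition verma_value :: "nat \<Rightarrow> ('k::alg_closed_field functional \<times> 'k \<Rightarrow>\<^sub>0 int) set \<Rightarrow> nat \<Rightarrow> 'k" where
  "verma_value d = coset_value (\<lambda>x i. snd x * weyl_act d (fst x) (weyl_basis 0) i)"

text \<open>Well-definedness is \<open>weyl_act_U0_b\<close>. On the normal form over the powers of
  \<open>f\<close> the map is diagonal with entries \<open>j!\<close> for \<open>j < p\<close>.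
  These are invertible, which gives injectivity and surjectivity onto the first block.\<close>

lemma verma_value:
  fixes a d s :: nat
  defines "V \<equiv> baby_verma a :: ('k::alg_closed_field functional, ('k functional \<times> 'k \<Rightarrow>\<^sub>0 int) set) module"
  assumes p: "prime CHAR('k)" and d: "d = s * CHAR('k) + a" "s \<ge> 1"
  shows "bij_betw (verma_value d) (carrier V) (blocks 1)"
    and "X \<in> carrier V \<Longrightarrow> Y \<in> carrier V \<Longrightarrow>
      verma_value d (X \<oplus>\<^bsub>V\<^esub> Y) = (\<lambda>i. verma_value d X i + verma_value d Y i)"
    and "u \<in> frob_dist 1 \<Longrightarrow> X \<in> carrier V \<Longrightarrow> verma_value d (u \<odot>\<^bsub>V\<^esub> X) = weyl_act d u (verma_value d X)"
proof -
  interpret tensor_product SL2_1 U0_b "frob_dist 1" "k_char a :: ('k functional, 'k) module"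
    by (rule tensor_product_baby_verma[OF p])
  have V: "V = M"
    by (simp add: V_def baby_verma_def U0_sl2_def carrier_group_algebra_SL2_1[OF p])
  define \<phi> :: "'k functional \<times> 'k \<Rightarrow> nat \<Rightarrow> 'k"
    where "\<phi> = (\<lambda>x i. snd x * weyl_act d (fst x) (weyl_basis 0) i)"
  have \<phi>: "verma_value d = coset_value \<phi>"
    by (simp add: verma_value_def \<phi>_def)
  have zero: "frag_lin (\<lambda>x. \<phi> x i) k = 0" if "k \<in> K" for k i
  proof (rule frag_lin_K[OF _ _ _ that])
    fix h r :: "'k functional" and z :: 'k
    assume h: "h \<in> frob_dist 1" and r: "r \<in> U0_b"
    have "weyl_act d (convolution h r) (weyl_basis 0) = weyl_act d h (weyl_act d r (weyl_basis 0))"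
      by (intro weyl_act_convolution frob_dist_dual[OF h] frob_dist_dual[OF U0_b_dist[OF p r]])
    then show "\<phi> (convolution h r, z) i = \<phi> (h, r \<odot>\<^bsub>k_char a\<^esub> z) i"
      by (simp add: \<phi>_def weyl_act_U0_b[OF p r d(1)] weyl_act_times_right)
  qed (simp_all add: \<phi>_def weyl_act_plus_left algebra_simps)
  have val: "verma_value d (frag_coset K c) = (\<lambda>i. frag_lin (\<lambda>x. \<phi> x i) c)" for c
    unfolding \<phi> by (rule coset_value_eq[OF K_zero zero])
  let ?N = "\<lambda>z. frag_coset K (\<Sum>j<CHAR('k). frag_of (f_power j, z j))"
  have val_N: "verma_value d (?N z) = (\<lambda>i. if i < CHAR('k) then of_nat (fact i) * z i else 0)" for z
  proof
    fix i
    have "verma_value d (?N z) i = (\<Sum>j<CHAR('k). \<phi> (f_power j, z j) i)"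
      by (simp add: val frag_lin_sum)
    also have "\<dots> = (\<Sum>j<CHAR('k). if i = j then of_nat (fact i) * z i else 0)"
    proof (intro sum.cong refl)
      fix j assume "j \<in> {..<CHAR('k)}"
      \<comment> \<open>\<open>s \<ge> 1\<close> ensures that all \<open>v_j\<close> with
        \<open>j < p\<close> exist in \<open>V(d)\<close>.\<close>
      moreover have "CHAR('k) \<le> d" using d(1) mult_le_mono1[OF d(2), of "CHAR('k)"] by linarith
      ultimately show "\<phi> (f_power j, z j) i = (if i = j then of_nat (fact i) * z i else 0)"
        by (simp add: \<phi>_def weyl_act_f_power[OF p])
    qed
    finally show "verma_value d (?N z) i = (if i < CHAR('k) then of_nat (fact i) * z i else 0)" by simp
  qed
  have N: "\<exists>z. X = ?N z" if X: "X \<in> carrier V" for X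
  proof -
    obtain c where c: "X = frag_coset K c" "Poly_Mapping.keys c \<subseteq> frob_dist 1 \<times> carrier (k_char a)"
      using X by (auto simp: V carrier_M)
    have "\<exists>z. (\<forall>i. z i \<in> carrier (k_char a)) \<and> c - (\<Sum>j<CHAR('k). frag_of (f_power j, z j)) \<in> K"
      using dist_1_eq_f_power[OF p] f_power_dist[OF p] c(2) by (intro normal_form[of _ _ "frob_dist 1"]) auto
    then show ?thesis by (auto simp: c(1) frag_coset_eq_iff)
  qed
  have N_carrier: "?N z \<in> carrier V" for z
  proof -
    have "Poly_Mapping.keys (\<Sum>j<CHAR('k). frag_of (f_power j :: 'k functional, z j)) \<subseteq> frob_dist 1 \<times> carrier (k_char a)"
      by (rule keys_sum_frag_of) (simp add: f_power_dist[OF p])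
    then show ?thesis unfolding V carrier_M by blast
  qed
  have fact: "of_nat (fact i) \<noteq> (0 :: 'k)" if "i < CHAR('k)" for i
    using that p by (simp add: of_nat_eq_0_iff_char_dvd prime_dvd_fact_iff del: of_nat_fact)
  show "bij_betw (verma_value d) (carrier V) (blocks 1)"
  proof (rule bij_betw_imageI)
    show "inj_on (verma_value d) (carrier V)"
    proof (rule inj_onI)
      fix X Y assume XY: "X \<in> carrier V" "Y \<in> carrier V" "verma_value d X = verma_value d Y"
      obtain z y where z: "X = ?N z" "Y = ?N y" using N XY by blast
      have "z i = y i" if "i < CHAR('k)" for i
        using fun_cong[OF XY(3), of i] that fact[OF that] by (simp add: z val_N del: of_nat_fact)
      then show "X = Y" by (simp add: z)
    qed
    show "verma_value d ` carrier V = blocks 1"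
    proof (intro equalityI subsetI)
      fix v assume "v \<in> verma_value d ` carrier V"
      then obtain z where "v = verma_value d (?N z)" using N by blast
      then show "v \<in> blocks 1" unfolding val_N by (simp add: blocks_def)
    next
      fix v :: "nat \<Rightarrow> 'k" assume v: "v \<in> blocks 1"
      have "verma_value d (?N (\<lambda>i. v i / of_nat (fact i))) = v"
        using v fact by (auto simp: val_N blocks_def simp del: of_nat_fact)
      from imageI[OF N_carrier, of "verma_value d" "\<lambda>i. v i / of_nat (fact i)", unfolded this]
      show "v \<in> verma_value d ` carrier V" .
    qed
  qed
  show "verma_value d (X \<oplus>\<^bsub>V\<^esub> Y) = (\<lambda>i. verma_value d X i + verma_value d Y i)"
    if "X \<in> carrier V" "Y \<in> carrier V"
    using that by (auto simp: V carrier_M add_M val frag_lin_add)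
  show "verma_value d (u \<odot>\<^bsub>V\<^esub> X) = weyl_act d u (verma_value d X)"
    if u: "u \<in> frob_dist 1" and X: "X \<in> carrier V"
  proof -
    obtain c where c: "X = frag_coset K c" "Poly_Mapping.keys c \<subseteq> frob_dist 1 \<times> carrier (k_char a)"
      using X by (auto simp: V carrier_M)
    have "verma_value d (u \<odot>\<^bsub>V\<^esub> X) = (\<lambda>i. frag_lin (\<lambda>x. \<phi> (convolution u (fst x), snd x) i) c)"
      using frob_dist_1_convolution[OF p u]
      by (simp add: V c(1) smult_M[OF frob_dist_dual[OF u]] val act_def frag_lin_extend)
    also have "\<dots> = (\<lambda>i. frag_lin (\<lambda>x. weyl_act d u (\<phi> x) i) c)"
    proof (intro ext frag_lin_cong)
      fix x i assume "x \<in> Poly_Mapping.keys c"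
      then have "fst x \<in> dual" using c(2) frob_dist_dual by fastforce
      then show "\<phi> (convolution u (fst x), snd x) i = weyl_act d u (\<phi> x) i"
        by (simp add: \<phi>_def weyl_act_convolution frob_dist_dual[OF u] weyl_act_times_right)
    qed
    finally show ?thesis by (simp add: c(1) val weyl_act_frag_lin)
  qed
qed

text \<open>The twisted action goes through conjugated functionals, which stay in
  \<open>frob_dist 1\<close> by normality.\<close>

lemma tensor_product_induced:
  fixes g :: "'k::alg_closed_field SL2"
  assumes p: "prime CHAR('k)"
  shows "tensor_product (frob_dist 1) (frob_dist n) (twist g (baby_verma a))"
proof -
  interpret V: tensor_product SL2_1 U0_b "frob_dist 1" "k_char a :: ('k functional, 'k) module"
    by (rule tensor_product_baby_verma[OF p])
  have V: "baby_verma a = V.M"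
    by (simp add: baby_verma_def U0_sl2_def carrier_group_algebra_SL2_1[OF p])
  show ?thesis
  proof
    fix r :: "'k functional" and z assume r: "r \<in> frob_dist 1" and z: "z \<in> carrier (twist g (baby_verma a))"
    have s: "adjoint (inverse g) r \<in> frob_dist 1" by (rule adjoint_dist_1[OF p r])
    have "adjoint (inverse g) r \<odot>\<^bsub>V.M\<^esub> z \<in> carrier V.M"
      using z by (intro V.tensor_module(5) frob_dist_dual[OF s] frob_dist_1_convolution[OF p s])
        (simp_all add: twist_def V)
    then show "r \<odot>\<^bsub>twist g (baby_verma a)\<^esub> z \<in> carrier (twist g (baby_verma a))"
      by (simp add: twist_def V)
  qed (auto simp: twist_def V V.tensor_module frob_dist_zero frob_dist_plus
      frob_dist_convolution[OF p] intro: frob_dist_dual)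
qed

text \<open>\<open>x_21 = 0\<close> would place \<open>g\<close> in the coset of 1, and
  \<open>x_11 = 0\<close> in that of \<open>w0\<close>; each coset has only one representative in
  \<open>C\<close>.\<close>

lemma coset_reps_entries:
  assumes C: "coset_reps C" "{1, w0} \<subseteq> C" "g \<in> C - {1, w0}"
  shows "entry 1 1 g \<noteq> (0 :: 'k::field)" "entry 2 1 g \<noteq> 0"
proof -
  have unique: "c = c'" if "c \<in> C" "c' \<in> C" "inverse c * g \<in> borel" "inverse c' * g \<in> borel" for c c'
    using C(1) that unfolding coset_reps_def by metis
  have g: "inverse g * g \<in> borel" by (simp add: borel_def)
  show "entry 2 1 g \<noteq> 0"
  proof
    assume "entry 2 1 g = 0"
    then have "inverse 1 * g \<in> borel"
      by (simp add: borel_def entry_mult entry_inverse)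
    then show False using unique[of g 1] g C by auto
  qed
  show "entry 1 1 g \<noteq> 0"
  proof
    assume "entry 1 1 g = 0"
    then have "inverse w0 * g \<in> borel"
      by (simp add: borel_def entry_mult entry_inverse entry_w0)
    then show False using unique[of g w0] g C by auto
  qed
qed

text \<open>The isomorphism sends \<open>h \<otimes> z\<close> to \<open>h.(g.v)\<close>, where
  \<open>v\<close> is the image of \<open>z\<close> in \<open>V(d)\<close>. It is defined on cosets
  modulo the relations over the whole group algebra, the form in which \<open>N_l\<close> is
  given.\<close>

theorem proposition3p1:
  fixes r a :: nat and C :: "('k::alg_closed_field) SL2 set" and g :: "'k SL2"
  assumes "CHAR('k) > 2"
    and "r \<ge> 1"
    and "coset_reps C" and "{1, w0} \<subseteq> C" and "g \<in> C - {1, w0}"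
    and "a \<le> CHAR('k) - 2"
  shows "\<forall>l \<in> {0..CHAR('k) ^ (r - 1) - 1}.
    module_iso (group_algebra SL2_1)
      (induced_filtration (SL2_1_T r) SL2_1 (twist g (baby_verma a)) l)
      (translated_W g ((l + 1) * CHAR('k) + a))"
proof
  fix l assume "l \<in> {0..CHAR('k) ^ (r - 1) - 1}"
  \<comment> \<open>The range of \<open>l\<close> involves a subtraction of natural numbers, so
    positivity is what yields \<open>l + 1 \<le> p ^ (r - 1)\<close>.\<close>
  moreover have "0 < CHAR('k) ^ (r - 1)" using assms(1) by simp
  ultimately have l: "Suc l \<le> CHAR('k) ^ (r - 1)" unfolding atLeastAtMost_iff by linarith
  have p: "prime CHAR('k)" using assms(1) by (intro prime_CHAR_semidom) simp
  define d where "d = (l + 1) * CHAR('k) + a"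
  define n where "n = CHAR('k) ^ (r - 1)"
  define Z where "Z = twist g (baby_verma a :: ('k functional, ('k functional \<times> 'k \<Rightarrow>\<^sub>0 int) set) module)"
  note G = carrier_group_algebra_SL2_1_T[OF p assms(2), folded n_def]
  note N = carrier_group_algebra_SL2_1[OF p]
  interpret T: tensor_product "SL2_1_T r" "frob_dist 1" "frob_dist n" Z
    unfolding Z_def by (rule tensor_product_induced[OF p])
  interpret T': tensor_product "SL2_1_T r" "frob_dist 1" "frob_dist (Suc l)" Z
    unfolding Z_def by (rule tensor_product_induced[OF p])
  have sub: "frob_dist (Suc l) \<subseteq> (frob_dist n :: 'k functional set)"
    using frob_dist_mono l by (auto simp: n_def)
  \<comment> \<open>Enlarging \<open>H\<close> only adds relations, so translating by
    \<open>T.K\<close> absorbs \<open>T'.K\<close>.\<close>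
  have "T'.rel \<subseteq> T.rel"
    unfolding tensor_relations_def using sub by blast
  then have K_sub: "T'.K \<subseteq> T.K"
    by (auto elim!: T'.K_induct simp: T.K_zero T.K_uminus T.K_add T.rel_K subset_iff)
  define Q where "Q = induced_filtration (SL2_1_T r) SL2_1 Z l"
  have Q: "carrier Q = frag_coset T.K ` {c. Poly_Mapping.keys c \<subseteq> frob_dist (Suc l) \<times> carrier Z}"
  proof -
    have "T.K <#>\<^bsub>free_Abelian_group (frob_dist n \<times> carrier Z)\<^esub> frag_coset T'.K c = frag_coset T.K c" for c
    proof (intro equalityI subsetI)
      fix x assume "x \<in> T.K <#>\<^bsub>free_Abelian_group (frob_dist n \<times> carrier Z)\<^esub> frag_coset T'.K c"
      then obtain k k' where "k \<in> T.K" "k' \<in> T'.K" "x = (k + k') + c"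
        by (auto simp: set_mult_def frag_coset_def add.assoc)
      then show "x \<in> frag_coset T.K c" using K_sub T.K_add by (auto simp: frag_coset_def)
    next
      fix x assume "x \<in> frag_coset T.K c"
      then obtain k where "k \<in> T.K" "x = k + (0 + c)" by (auto simp: frag_coset_def)
      moreover have "0 + c \<in> frag_coset T'.K c" unfolding frag_coset_def using T'.K_zero by blast
      ultimately show "x \<in> T.K <#>\<^bsub>free_Abelian_group (frob_dist n \<times> carrier Z)\<^esub> frag_coset T'.K c"
        unfolding set_mult_def by auto
    qed
    moreover have "carrier Q = (\<lambda>X. T.K <#>\<^bsub>free_Abelian_group (frob_dist n \<times> carrier Z)\<^esub> X) ` carrier T'.M"
      unfolding Q_def induced_filtration_def Let_def G N
        filtration_bimodule_eq[OF p G l[folded n_def]] by simp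
    ultimately show ?thesis by (simp add: T'.carrier_M image_image)
  qed
  have Q_add: "X \<oplus>\<^bsub>Q\<^esub> Y = X \<oplus>\<^bsub>T.M\<^esub> Y" and Q_smult: "u \<odot>\<^bsub>Q\<^esub> X = u \<odot>\<^bsub>T.M\<^esub> X" for X Y u
    unfolding Q_def induced_filtration_def induced_module_def Let_def G N by simp_all
  \<comment> \<open>Translation by \<open>g\<close> undoes the twist by \<open>g\<close>, so this is
    a \<open>kSL(2)_1\<close>-linear map from \<open>Z\<close> to \<open>V(d)\<close>.\<close>
  define \<theta> where "\<theta> z = weyl_group_act d g (verma_value d z)" for z :: "('k functional \<times> 'k \<Rightarrow>\<^sub>0 int) set"
  note vv = verma_value[OF p d_def]
  have \<theta>_add: "\<theta> (z \<oplus>\<^bsub>Z\<^esub> z') = (\<lambda>i. \<theta> z i + \<theta> z' i)" if "z \<in> carrier Z" "z' \<in> carrier Z" for z z'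
    using that vv(2) by (simp add: Z_def twist_def \<theta>_def weyl_group_act_eq weyl_act_plus_right)
  have \<theta>_smult: "\<theta> (u \<odot>\<^bsub>Z\<^esub> z) = weyl_act d u (\<theta> z)" if "u \<in> frob_dist 1" "z \<in> carrier Z" for u z
    using that vv(3)[OF _ adjoint_dist_1[OF p, of u "inverse g"]]
    by (simp add: Z_def twist_def \<theta>_def weyl_act_group_act frob_dist_dual)
  define \<phi> :: "'k functional \<times> ('k functional \<times> 'k \<Rightarrow>\<^sub>0 int) set \<Rightarrow> nat \<Rightarrow> 'k"
    where "\<phi> = (\<lambda>x. weyl_act d (fst x) (\<theta> (snd x)))"
  define \<Phi> where "\<Phi> = coset_value \<phi>"
  have zero: "frag_lin (\<lambda>x. \<phi> x i) k = 0" if "k \<in> T.K" for k i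
    by (rule T.frag_lin_K[OF _ _ _ that])
      (simp_all add: \<phi>_def weyl_act_plus_left \<theta>_add weyl_act_plus_right \<theta>_smult
        weyl_act_convolution frob_dist_dual[of _ n] frob_dist_dual[of _ 1])
  have val: "\<Phi> (frag_coset T.K c) = (\<lambda>i. frag_lin (\<lambda>x. \<phi> x i) c)" for c
    unfolding \<Phi>_def by (rule coset_value_eq[OF T.K_zero zero])
  define u where "u i = adjoint (inverse g) (\<delta> i)" for i
  define c where "c i = (- 2 * entry 1 1 g * entry 2 1 g) ^ (CHAR('k) * i)" for i
  \<comment> \<open>p > 2 enters through the factor 2, the choice of \<open>g\<close> through its
    two entries.\<close>
  have c: "c i \<noteq> 0" for i
  proof -
    have "\<not> CHAR('k) dvd 2" using assms(1) by (auto dest: dvd_imp_le)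
    then have "of_nat 2 \<noteq> (0 :: 'k)" by (simp only: of_nat_eq_0_iff_char_dvd not_False_eq_True)
    then show ?thesis using coset_reps_entries[OF assms(3-5)] by (simp add: c_def)
  qed
  have d_ge: "(i + 1) * CHAR('k) \<le> d + 1" if "i < Suc l" for i
  proof -
    have "(i + 1) * CHAR('k) \<le> (l + 1) * CHAR('k)" using that by (intro mult_right_mono) auto
    then show ?thesis unfolding d_def by linarith
  qed
  have L1: "weyl_act d (u i) z \<in> blocks (i + 1)" if "i < Suc l" "z \<in> blocks 1" for i z
    unfolding u_def by (rule conj_\<delta>_weyl_act(1)[OF p that(2) d_ge[OF that(1)]])
  have L2: "weyl_act d (u i) z (i * CHAR('k) + j) = c i * z j"
    if "i < Suc l" "z \<in> blocks 1" "j < CHAR('k)" for i z j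
    unfolding u_def c_def by (rule conj_\<delta>_weyl_act(2)[OF p that(2) d_ge[OF that(1)] that(3)])
  let ?N = "\<lambda>z. frag_coset T.K (\<Sum>i<Suc l. frag_of (\<delta> i, z i))"
  have \<delta>_dist_l: "(\<delta> i :: 'k functional) \<in> frob_dist (Suc l)" if "i < Suc l" for i
    using frob_dist_mono[OF \<delta>_dist[OF p]] that by simp
  have N_carrier: "?N z \<in> carrier Q" if "\<And>i. i < Suc l \<Longrightarrow> z i \<in> carrier Z" for z
  proof -
    have "Poly_Mapping.keys (\<Sum>i<Suc l. frag_of (\<delta> i :: 'k functional, z i)) \<subseteq> frob_dist (Suc l) \<times> carrier Z"
      by (rule keys_sum_frag_of) (simp add: \<delta>_dist_l that)
    then show ?thesis unfolding Q by blast
  qed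
  have NF: "\<exists>z. (\<forall>i. z i \<in> carrier Z) \<and> X = ?N z" if X: "X \<in> carrier Q" for X
  proof -
    obtain c where c: "X = frag_coset T.K c" "Poly_Mapping.keys c \<subseteq> frob_dist (Suc l) \<times> carrier Z"
      using X by (auto simp: Q)
    have "\<exists>z. (\<forall>i. z i \<in> carrier Z) \<and> c - (\<Sum>i<Suc l. frag_of (\<delta> i, z i)) \<in> T.K"
      using subsetD[OF sub] \<delta>_dist_l
      by (intro T.normal_form[OF _ sub dist_eq_\<delta>_left[OF p] c(2)]) simp
    then show ?thesis by (auto simp: c(1) T.frag_coset_eq_iff)
  qed
  \<comment> \<open>Moving \<open>\<delta> i\<close> past \<open>g\<close> turns it into the
    conjugate \<open>u i\<close>, so translation by \<open>g\<close> factors out of the sum and a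
    block-triangular system remains.\<close>
  have val_N: "\<Phi> (?N z) = weyl_group_act d g (\<lambda>I. \<Sum>i<Suc l. weyl_act d (u i) (verma_value d (z i)) I)" for z
  proof -
    have "\<Phi> (?N z) = (\<lambda>I. \<Sum>i<Suc l. weyl_act d (\<delta> i) (\<theta> (z i)) I)"
      by (simp add: val frag_lin_sum \<phi>_def del: sum.lessThan_Suc)
    moreover have "weyl_act d (\<delta> i) (\<theta> (z i)) = weyl_group_act d g (weyl_act d (u i) (verma_value d (z i)))" for i
      by (simp add: \<theta>_def u_def weyl_act_group_act[OF \<delta>_dual])
    ultimately show ?thesis
      by (simp add: weyl_group_act_eq weyl_act_sum_right del: sum.lessThan_Suc)
  qed
  have verma_bij: "bij_betw (verma_value d) (carrier Z) (blocks 1)"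
    using vv(1) by (simp add: Z_def twist_def)
  \<comment> \<open>Since \<open>a < p\<close>, the quotient of \<open>d\<close> by p is
    \<open>l + 1\<close>.\<close>
  have W: "W_carrier d = (blocks (Suc l) :: (nat \<Rightarrow> 'k) set)"
  proof -
    have "a < CHAR('k)" using assms(1,6) by simp
    then have "d div CHAR('k) = Suc l" by (simp add: d_def)
    moreover have "v i = 0" if "v \<in> blocks (Suc l)" "i > d" for v :: "nat \<Rightarrow> 'k" and i
      using that unfolding blocks_def d_def Suc_eq_plus1 by simp
    ultimately show ?thesis
      unfolding W_carrier_def weyl_carrier_def by (auto simp: blocks_def simp del: mult_Suc)
  qed
  have sum_blocks: "(\<lambda>I. \<Sum>i<Suc l. weyl_act d (u i) (y i) I) \<in> blocks (Suc l)"
    if "\<And>i. i < Suc l \<Longrightarrow> y i \<in> blocks 1" for y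
    unfolding blocks_def
  proof (intro CollectI allI impI sum.neutral ballI)
    fix I i assume I: "Suc l * CHAR('k) \<le> I" and i: "i \<in> {..<Suc l}"
    have "(i + 1) * CHAR('k) \<le> Suc l * CHAR('k)" using i by (intro mult_right_mono) auto
    then show "weyl_act d (u i) (y i) I = 0"
      using L1[of i "y i"] that[of i] i I by (simp add: blocks_def)
  qed
  have "bij_betw \<Phi> (carrier Q) (weyl_group_act d g ` W_carrier d)"
  proof (rule bij_betw_imageI)
    show "inj_on \<Phi> (carrier Q)"
    proof (rule inj_onI)
      fix X Y assume XY: "X \<in> carrier Q" "Y \<in> carrier Q" "\<Phi> X = \<Phi> Y"
      obtain z where z: "\<And>i. z i \<in> carrier Z" "X = ?N z" using NF XY by blast
      obtain y where y: "\<And>i. y i \<in> carrier Z" "Y = ?N y" using NF XY by blast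
      have b: "verma_value d x \<in> blocks 1" if "x \<in> carrier Z" for x
        using that verma_bij by (auto simp: bij_betw_def)
      let ?s = "\<lambda>z I. \<Sum>i<Suc l. weyl_act d (u i) (verma_value d (z i)) I"
      have "?s z \<in> W_carrier d" "?s y \<in> W_carrier d"
        unfolding W using z y b by (auto intro!: sum_blocks simp del: sum.lessThan_Suc)
      \<comment> \<open>\<open>weyl_group_act\<close> truncates at index \<open>d\<close>, so its
        inverse is available only on \<open>weyl_carrier d\<close>.\<close>
      then have "?s z \<in> weyl_carrier d" "?s y \<in> weyl_carrier d" by (simp_all add: W_carrier_def)
      moreover have "weyl_group_act d g (?s z) = weyl_group_act d g (?s y)"
        using XY(3) by (simp only: z y val_N)
      ultimately have "?s z = ?s y" by (metis (no_types) weyl_group_act_inverse)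
      then have "\<forall>i<Suc l. verma_value d (z i) = verma_value d (y i)"
        using z y b c by (intro block_triangular_unique[OF L1 L2]) (auto dest: fun_cong simp del: sum.lessThan_Suc)
      then have "\<forall>i<Suc l. z i = y i"
        using verma_bij z(1) y(1) by (auto simp: bij_betw_def inj_on_def)
      then show "X = Y" by (simp add: z y)
    qed
    show "\<Phi> ` carrier Q = weyl_group_act d g ` W_carrier d"
    proof (intro equalityI subsetI)
      fix v assume "v \<in> \<Phi> ` carrier Q"
      then obtain z where z: "\<And>i. z i \<in> carrier Z" "v = \<Phi> (?N z)" using NF by blast
      have "verma_value d (z i) \<in> blocks 1" for i
        using z(1) verma_bij by (auto simp: bij_betw_def)
      then show "v \<in> weyl_group_act d g ` W_carrier d"
        unfolding z(2) val_N W by (intro imageI sum_blocks)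
    next
      fix v assume "v \<in> weyl_group_act d g ` W_carrier d"
      then obtain w where w: "w \<in> blocks (Suc l)" "v = weyl_group_act d g w" by (auto simp: W)
      obtain y where y: "\<And>i. y i \<in> blocks 1" "w = (\<lambda>I. \<Sum>i<Suc l. weyl_act d (u i) (y i) I)"
        using block_triangular_ex[OF L1 L2 c w(1)] by blast
      have "\<forall>i. \<exists>z\<in>carrier Z. verma_value d z = y i"
        using verma_bij y(1) by (auto simp: bij_betw_def image_iff) (metis imageE)
      then obtain z where z: "\<And>i. z i \<in> carrier Z" "\<And>i. verma_value d (z i) = y i" by metis
      have "v = \<Phi> (?N z)" by (simp only: val_N z w y)
      then show "v \<in> \<Phi> ` carrier Q" using N_carrier[of z] z(1) by blast
    qed
  qed
  moreover have "\<Phi> (X \<oplus>\<^bsub>Q\<^esub> Y) = (\<lambda>i. \<Phi> X i + \<Phi> Y i)" if "X \<in> carrier Q" "Y \<in> carrier Q" for X Y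
    using that by (auto simp: Q Q_add T.add_M val frag_lin_add)
  moreover have "\<Phi> (s \<odot>\<^bsub>Q\<^esub> X) = weyl_act d s (\<Phi> X)" if s: "s \<in> frob_dist 1" and X: "X \<in> carrier Q" for s X
  proof -
    obtain c where c: "X = frag_coset T.K c" "Poly_Mapping.keys c \<subseteq> frob_dist (Suc l) \<times> carrier Z"
      using X by (auto simp: Q)
    have "\<Phi> (s \<odot>\<^bsub>Q\<^esub> X) = (\<lambda>i. frag_lin (\<lambda>x. \<phi> (convolution s (fst x), snd x) i) c)"
      using frob_dist_convolution(2)[OF p s]
      by (simp add: Q_smult c(1) T.smult_M[OF frob_dist_dual[OF s]] val T.act_def frag_lin_extend)
    also have "\<dots> = (\<lambda>i. frag_lin (\<lambda>x. weyl_act d s (\<phi> x) i) c)"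
    proof (intro ext frag_lin_cong)
      fix x i assume "x \<in> Poly_Mapping.keys c"
      then have "fst x \<in> dual" using c(2) frob_dist_dual by fastforce
      then show "\<phi> (convolution s (fst x), snd x) i = weyl_act d s (\<phi> x) i"
        by (simp add: \<phi>_def weyl_act_convolution frob_dist_dual[OF s])
    qed
    finally show ?thesis by (simp add: c(1) val weyl_act_frag_lin)
  qed
  ultimately show "module_iso (group_algebra SL2_1)
      (induced_filtration (SL2_1_T r) SL2_1 (twist g (baby_verma a)) l)
      (translated_W g ((l + 1) * CHAR('k) + a))"
    unfolding Q_def[symmetric] Z_def[symmetric] d_def[symmetric] module_iso_def N translated_W_def
    by (intro exI[of _ \<Phi>]) (simp add: weyl_sub_def)
qed

end
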